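(* (1) Every atomless regular MV-chain is elementarily equivalent to some simple atomless MV-chain. (2) Two atomless regular MV-chains $A,A'$ are elementarily equivalent if, and only if, the sub-MV-chains $T(A)\cup\{0,1\}$ and $T(A')\cup\{0,1\}$ formed by their torsion elements are isomorphic and their Chang $\ell$-groups $G_A,G_{A'}$ satisfy $[p]G_A=[p]G_{A'}$ for every prime $p$.
   Context: An MV-chain is an MV-algebra $(A,\oplus,\neg,0)$ (with $1=\neg0$, $x\odot y=\neg(\neg x\oplus\neg y)$) whose natural order is linear. Write $n.x=x\oplus\cdots\oplus x$ and $x^n=x\odot\cdots\odot x$ ($n$ times). It is atomless if there is no $x>0$ with $\{y\mid y\le x\}=\{0,x\}$. It is regular if for every $n\ge2$ and all $0<x_1<\cdots<x_n$ there is $x$ with $x_1\le n.x\le x_n$ and $0<x<2.x<\cdots<n.x$. It is simple if it embeds in $[0,1]_{\mathbb{R}}$. An element $x$ is a torsion element if there is $n\ge1$ with $n.x=1$ and $x^n=0$; $T(A)$ denotes the set of torsion elements. The Chang $\ell$-group $(G_A,u_A)$ is the linearly ordered abelian group with strong unit $u_A$ such that $A\cong[0,u_A]$, $x\oplus y=\min(x+y,u_A)$, $\neg x=u_A-x$. For an abelian group $B$ and prime $p$, the Zakon invariant $[p]B$ is the maximum number of pairwise $p$-incongruent elements of $B$ (i.e. $|B/pB|$), set to $\infty$ if infinite.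
   Formalization: A torsion element must also satisfy that its n-fold sum modulo u_A is 0 (i.e. nx = k u_A with 0<k<n); with only n.x=1 and x^n=0, [0,1] and a countable elementary submodel refute (2). MV-chains are assumed nontrivial (0≠1), since (1) fails for the one-element chain. *)

theory Defs
  imports Complex_Main "HOL-Computational_Algebra.Primes" "HOL-Algebra.Group" "HOL-Library.Extended_Nat"
begin

record 'a mv = "'a partial_object" +
  mv_plus :: "'a \<Rightarrow> 'a \<Rightarrow> 'a" (infixl "\<boxplus>\<index>" 65)
  mv_neg  :: "'a \<Rightarrow> 'a"
  mv_zero :: "'a"

definition mv_one :: "'a mv \<Rightarrow> 'a" where
  "mv_one A = mv_neg A (mv_zero A)"

definition mv_odot :: "'a mv \<Rightarrow> 'a \<Rightarrow> 'a \<Rightarrow> 'a" (infixl "\<boxdot>\<index>" 70) where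
  "x \<boxdot>\<^bsub>A\<^esub> y = mv_neg A (mv_neg A x \<boxplus>\<^bsub>A\<^esub> mv_neg A y)"

definition mv_le :: "'a mv \<Rightarrow> 'a \<Rightarrow> 'a \<Rightarrow> bool" where
  "mv_le A x y \<longleftrightarrow> mv_neg A x \<boxplus>\<^bsub>A\<^esub> y = mv_one A"

definition mv_less :: "'a mv \<Rightarrow> 'a \<Rightarrow> 'a \<Rightarrow> bool" where
  "mv_less A x y \<longleftrightarrow> mv_le A x y \<and> x \<noteq> y"

text \<open>\<open>n.x\<close> and \<open>x\<^sup>n\<close>.\<close>

primrec mv_mult :: "'a mv \<Rightarrow> nat \<Rightarrow> 'a \<Rightarrow> 'a" where
  "mv_mult A 0 x = mv_zero A"
| "mv_mult A (Suc n) x = mv_mult A n x \<boxplus>\<^bsub>A\<^esub> x"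

primrec mv_pow :: "'a mv \<Rightarrow> 'a \<Rightarrow> nat \<Rightarrow> 'a" where
  "mv_pow A x 0 = mv_one A"
| "mv_pow A x (Suc n) = mv_pow A x n \<boxdot>\<^bsub>A\<^esub> x"

locale mv_algebra =
  fixes A :: "'a mv" (structure)
  assumes zero_closed: "mv_zero A \<in> carrier A"
    and neg_closed: "x \<in> carrier A \<Longrightarrow> mv_neg A x \<in> carrier A"
    and plus_closed: "x \<in> carrier A \<Longrightarrow> y \<in> carrier A \<Longrightarrow> x \<boxplus> y \<in> carrier A"
    and plus_assoc: "x \<in> carrier A \<Longrightarrow> y \<in> carrier A \<Longrightarrow> z \<in> carrier A
      \<Longrightarrow> (x \<boxplus> y) \<boxplus> z = x \<boxplus> (y \<boxplus> z)"
    and plus_commute: "x \<in> carrier A \<Longrightarrow> y \<in> carrier A \<Longrightarrow> x \<boxplus> y = y \<boxplus> x"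
    and plus_zero: "x \<in> carrier A \<Longrightarrow> x \<boxplus> mv_zero A = x"
    and neg_neg: "x \<in> carrier A \<Longrightarrow> mv_neg A (mv_neg A x) = x"
    and plus_one: "x \<in> carrier A \<Longrightarrow> x \<boxplus> mv_neg A (mv_zero A) = mv_neg A (mv_zero A)"
    and lukasiewicz: "x \<in> carrier A \<Longrightarrow> y \<in> carrier A
      \<Longrightarrow> mv_neg A (mv_neg A x \<boxplus> y) \<boxplus> y = mv_neg A (mv_neg A y \<boxplus> x) \<boxplus> x"

text \<open>MV-chains are taken to be nontrivial. The one-element algebra is vacuously atomless and
  regular, but being simple (embeddable in the real unit interval) forces \<open>0 \<noteq> 1\<close>.\<close>

locale mv_chain = mv_algebra +
  assumes nontrivial: "mv_zero A \<noteq> mv_one A"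
    and linear: "x \<in> carrier A \<Longrightarrow> y \<in> carrier A \<Longrightarrow> mv_le A x y \<or> mv_le A y x"

definition mv_atomless :: "'a mv \<Rightarrow> bool" where
  "mv_atomless A \<longleftrightarrow>
     \<not> (\<exists>x\<in>carrier A. mv_less A (mv_zero A) x \<and> {y \<in> carrier A. mv_le A y x} = {mv_zero A, x})"

definition mv_regular :: "'a mv \<Rightarrow> bool" where
  "mv_regular A \<longleftrightarrow>
     (\<forall>n\<ge>2. \<forall>xs :: nat \<Rightarrow> 'a.
        (\<forall>i\<in>{1..n}. xs i \<in> carrier A) \<longrightarrow>
        mv_less A (mv_zero A) (xs 1) \<longrightarrow>
        (\<forall>i\<in>{1..<n}. mv_less A (xs i) (xs (Suc i))) \<longrightarrow>
        (\<exists>x\<in>carrier A.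
           mv_le A (xs 1) (mv_mult A n x) \<and> mv_le A (mv_mult A n x) (xs n) \<and>
           mv_less A (mv_zero A) x \<and>
           (\<forall>i\<in>{1..<n}. mv_less A (mv_mult A i x) (mv_mult A (Suc i) x))))"

definition mv_hom :: "'a mv \<Rightarrow> 'b mv \<Rightarrow> ('a \<Rightarrow> 'b) set" where
  "mv_hom A B = {f. f \<in> carrier A \<rightarrow> carrier B \<and>
     f (mv_zero A) = mv_zero B \<and>
     (\<forall>x\<in>carrier A. f (mv_neg A x) = mv_neg B (f x)) \<and>
     (\<forall>x\<in>carrier A. \<forall>y\<in>carrier A. f (x \<boxplus>\<^bsub>A\<^esub> y) = f x \<boxplus>\<^bsub>B\<^esub> f y)}"

definition mv_embeds :: "'a mv \<Rightarrow> 'b mv \<Rightarrow> bool" where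
  "mv_embeds A B \<longleftrightarrow> (\<exists>f\<in>mv_hom A B. inj_on f (carrier A))"

definition mv_isomorphic :: "'a mv \<Rightarrow> 'b mv \<Rightarrow> bool" where
  "mv_isomorphic A B \<longleftrightarrow> (\<exists>f\<in>mv_hom A B. bij_betw f (carrier A) (carrier B))"

definition real_unit_mv :: "real mv" where
  "real_unit_mv = \<lparr>carrier = {0..1}, mv_plus = (\<lambda>x y. min (x + y) 1),
     mv_neg = (\<lambda>x. 1 - x), mv_zero = 0\<rparr>"

definition mv_simple :: "'a mv \<Rightarrow> bool" where
  "mv_simple A \<longleftrightarrow> mv_embeds A real_unit_mv"

text \<open>Addition modulo \<open>u\<^sub>A\<close> on \<open>A\<close> minus its top element, that is, the addition of the quotient of
  \<open>G\<^sub>A\<close> by the subgroup generated by \<open>u\<^sub>A\<close> read on the representatives \<open>0 \<le> x < u\<^sub>A\<close>: in \<open>G\<^sub>A\<close>,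
  \<open>x \<oplus> y = x + y\<close> if \<open>x + y < u\<^sub>A\<close>, and \<open>x \<odot> y = x + y - u\<^sub>A\<close> if \<open>x + y \<ge> u\<^sub>A\<close>.\<close>

definition mv_cyc_add :: "'a mv \<Rightarrow> 'a \<Rightarrow> 'a \<Rightarrow> 'a" where
  "mv_cyc_add A x y = (if x \<boxplus>\<^bsub>A\<^esub> y = mv_one A then x \<boxdot>\<^bsub>A\<^esub> y else x \<boxplus>\<^bsub>A\<^esub> y)"

primrec mv_cyc_mult :: "'a mv \<Rightarrow> nat \<Rightarrow> 'a \<Rightarrow> 'a" where
  "mv_cyc_mult A 0 x = mv_zero A"
| "mv_cyc_mult A (Suc n) x = mv_cyc_add A (mv_cyc_mult A n x) x"

text \<open>The equations \<open>n.x = 1\<close> and \<open>x\<^sup>n = 0\<close> alone hold (for large \<open>n\<close>) of every element of the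
  open real unit interval, irrational ones included, and do not cut out a subalgebra in general;
  a torsion element is one whose class in the quotient of \<open>G\<^sub>A\<close> by the subgroup generated by
  \<open>u\<^sub>A\<close> has finite order, which is the last conjunct. In terms of \<open>G\<^sub>A\<close>, the definition reads
  \<open>n x = k u\<^sub>A\<close> for some \<open>0 < k < n\<close>, the two equations giving the bounds on \<open>k\<close>.\<close>

definition mv_torsion :: "'a mv \<Rightarrow> 'a set" where
  "mv_torsion A = {x \<in> carrier A. \<exists>n\<ge>1. mv_mult A n x = mv_one A \<and> mv_pow A x n = mv_zero A \<and>
     mv_cyc_mult A n x = mv_zero A}"

definition mv_torsion_part :: "'a mv \<Rightarrow> 'a mv" where
  "mv_torsion_part A = A\<lparr>carrier := mv_torsion A \<union> {mv_zero A, mv_one A}\<rparr>"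

text \<open>First-order formulas with equality over \<open>(\<oplus>, \<not>, 0)\<close>; the order, \<open>\<odot>\<close> and \<open>1\<close> are
  definable from these.\<close>

datatype mv_term = Var nat | Zero | Neg mv_term | Plus mv_term mv_term

datatype mv_fm = Eq mv_term mv_term | FNot mv_fm | FAnd mv_fm mv_fm | FEx nat mv_fm

primrec mv_term_vars :: "mv_term \<Rightarrow> nat set" where
  "mv_term_vars (Var i) = {i}"
| "mv_term_vars Zero = {}"
| "mv_term_vars (Neg t) = mv_term_vars t"
| "mv_term_vars (Plus s t) = mv_term_vars s \<union> mv_term_vars t"

primrec mv_fm_free :: "mv_fm \<Rightarrow> nat set" where
  "mv_fm_free (Eq s t) = mv_term_vars s \<union> mv_term_vars t"
| "mv_fm_free (FNot p) = mv_fm_free p"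
| "mv_fm_free (FAnd p q) = mv_fm_free p \<union> mv_fm_free q"
| "mv_fm_free (FEx i p) = mv_fm_free p - {i}"

primrec mv_term_val :: "'a mv \<Rightarrow> (nat \<Rightarrow> 'a) \<Rightarrow> mv_term \<Rightarrow> 'a" where
  "mv_term_val A e (Var i) = e i"
| "mv_term_val A e Zero = mv_zero A"
| "mv_term_val A e (Neg t) = mv_neg A (mv_term_val A e t)"
| "mv_term_val A e (Plus s t) = mv_term_val A e s \<boxplus>\<^bsub>A\<^esub> mv_term_val A e t"

primrec mv_sat :: "'a mv \<Rightarrow> (nat \<Rightarrow> 'a) \<Rightarrow> mv_fm \<Rightarrow> bool" where
  "mv_sat A e (Eq s t) \<longleftrightarrow> mv_term_val A e s = mv_term_val A e t"
| "mv_sat A e (FNot p) \<longleftrightarrow> \<not> mv_sat A e p"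
| "mv_sat A e (FAnd p q) \<longleftrightarrow> mv_sat A e p \<and> mv_sat A e q"
| "mv_sat A e (FEx i p) \<longleftrightarrow> (\<exists>a\<in>carrier A. mv_sat A (e(i := a)) p)"

definition mv_models :: "'a mv \<Rightarrow> mv_fm \<Rightarrow> bool" where
  "mv_models A p \<longleftrightarrow> (\<forall>e. range e \<subseteq> carrier A \<longrightarrow> mv_sat A e p)"

definition mv_elem_equiv :: "'a mv \<Rightarrow> 'b mv \<Rightarrow> bool" where
  "mv_elem_equiv A B \<longleftrightarrow> (\<forall>p. mv_fm_free p = {} \<longrightarrow> (mv_models A p \<longleftrightarrow> mv_models B p))"

text \<open>As usual in HOL-Algebra, groups are written multiplicatively: \<open>x \<otimes> y\<close>, \<open>\<one>\<close>, \<open>inv x\<close> and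
  \<open>x [^] n\<close> stand for the \<open>x + y\<close>, \<open>0\<close>, \<open>- x\<close> and \<open>n x\<close> of additive notation.\<close>

record 'a ordered_group = "'a monoid" +
  order_rel :: "'a rel"

locale linordered_comm_group = comm_group G for G :: "'a ordered_group" (structure) +
  assumes linear_order: "linear_order_on (carrier G) (order_rel G)"
    and translate: "(x, y) \<in> order_rel G \<Longrightarrow> z \<in> carrier G \<Longrightarrow> (x \<otimes> z, y \<otimes> z) \<in> order_rel G"

definition strong_unit :: "'a ordered_group \<Rightarrow> 'a \<Rightarrow> bool" where
  "strong_unit G u \<longleftrightarrow> (\<one>\<^bsub>G\<^esub>, u) \<in> order_rel G \<and>
     (\<forall>x\<in>carrier G. \<exists>n::nat. (x, u [^]\<^bsub>G\<^esub> n) \<in> order_rel G)"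

text \<open>The interval \<open>[0, u]\<close> with \<open>x \<oplus> y = min (x + y) u\<close> and \<open>\<not> x = u - x\<close>.\<close>

definition interval_mv :: "'a ordered_group \<Rightarrow> 'a \<Rightarrow> 'a mv" where
  "interval_mv G u =
     \<lparr>carrier = {x \<in> carrier G. (\<one>\<^bsub>G\<^esub>, x) \<in> order_rel G \<and> (x, u) \<in> order_rel G},
      mv_plus = (\<lambda>x y. if (x \<otimes>\<^bsub>G\<^esub> y, u) \<in> order_rel G then x \<otimes>\<^bsub>G\<^esub> y else u),
      mv_neg = (\<lambda>x. u \<otimes>\<^bsub>G\<^esub> inv\<^bsub>G\<^esub> x),
      mv_zero = \<one>\<^bsub>G\<^esub>\<rparr>"

text \<open>The Chang group of \<open>A\<close> is determined only up to isomorphism; \<open>chang_group A G u\<close> says that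
  \<open>(G, u)\<close> is (a copy of) it.\<close>

definition chang_group :: "'a mv \<Rightarrow> 'g ordered_group \<Rightarrow> 'g \<Rightarrow> bool" where
  "chang_group A G u \<longleftrightarrow>
     linordered_comm_group G \<and> strong_unit G u \<and> mv_isomorphic A (interval_mv G u)"

definition p_congruent :: "nat \<Rightarrow> ('a, 'c) monoid_scheme \<Rightarrow> 'a \<Rightarrow> 'a \<Rightarrow> bool" where
  "p_congruent p B x y \<longleftrightarrow> (\<exists>z\<in>carrier B. x \<otimes>\<^bsub>B\<^esub> inv\<^bsub>B\<^esub> y = z [^]\<^bsub>B\<^esub> p)"

definition zakon :: "nat \<Rightarrow> ('a, 'c) monoid_scheme \<Rightarrow> enat" where
  "zakon p B = (SUP S \<in> {S. S \<subseteq> carrier B \<and> finite S \<and>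
       (\<forall>x\<in>S. \<forall>y\<in>S. x \<noteq> y \<longrightarrow> \<not> p_congruent p B x y)}. enat (card S))"

end

theory Submission
  imports Defs "HOL-Algebra.FiniteProduct" "HOL-Library.Poly_Mapping" "HOL-Library.Multiset"
    "HOL-Computational_Algebra.Polynomial" "HOL-Analysis.Continuum_Not_Denumerable"
begin

text \<open>The Chang group of an atomless regular chain is regularly dense: every coset of \<open>n G\<close> meets
  every open interval. In such groups the sign and the congruence conditions on an element are
  independent, so a back-and-forth argument on tuples whose integer combinations (with bounded
  coefficients) have the same signs and the same divisors reduces elementary equivalence to the
  cardinalities of \<open>G / p G\<close> and to the set of divisors of the unit, which is what the torsion
  elements encode; both are expressed by sentences. Each choice of these invariants is
  realised inside the reals, by letting the powers of a transcendental number generate a direct sum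
  of suitable groups of rationals, one of which is all of the rationals and ensures density.\<close>

section \<open>Preordered groups\<close>

text \<open>The models compared are arbitrary rather than saturated, so the back-and-forth has to be
  finitary: each quantifier spends some of the precision \<open>N\<close> up to which two tuples
  agree, which is why formulas carry weights. The delicate half is the congruences. Equal sizes of G
  / pG speak of residues modulo a prime only, yet a new element must be matched modulo
  \<open>p ^ e\<close> relative to the span of the old ones. The obstruction is that
  \<open>p ^ (e - 1)\<close> G may lie in this span modulo \<open>p ^ e\<close>. That property makes
  the number of classes modulo p finite, and since both groups have the same number of classes it
  passes from one group to the other. The invariants are not independent either: a unit that some
  power of p does not divide forces G / pG to be nontrivial, so in the real model the coordinate of
  the unit must be counted as one of the dimensions modulo p.\<close>

definition lin_comb :: "nat set \<Rightarrow> (nat \<Rightarrow> 'r::comm_ring_1) \<Rightarrow> (nat \<Rightarrow> int) \<Rightarrow> 'r" where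
  "lin_comb V x c = (\<Sum>i\<in>V. of_int (c i) * x i)"

lemma lin_comb_add: "lin_comb V x (\<lambda>i. c i + d i) = lin_comb V x c + lin_comb V x d"
  by (simp add: lin_comb_def sum.distrib algebra_simps)

lemma lin_comb_scale: "lin_comb V x (\<lambda>i. k * c i) = of_int k * lin_comb V x c"
  by (simp add: lin_comb_def sum_distrib_left algebra_simps)

lemma lin_comb_diff: "lin_comb V x (\<lambda>i. c i - d i) = lin_comb V x c - lin_comb V x d"
  by (simp add: lin_comb_def sum_subtractf algebra_simps)

lemma lin_comb_minus: "lin_comb V x (\<lambda>i. - c i) = - lin_comb V x c"
  by (simp add: lin_comb_def sum_negf)

lemma lin_comb_0 [simp]: "lin_comb V x (\<lambda>i. 0) = 0"
  by (simp add: lin_comb_def)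

lemma lin_comb_cong: "(\<And>i. i \<in> V \<Longrightarrow> c i = d i) \<Longrightarrow> lin_comb V x c = lin_comb V x d"
  unfolding lin_comb_def by (rule sum.cong) auto

lemma lin_comb_single:
  assumes "finite V" "i \<in> V"
  shows "lin_comb V x (\<lambda>j. if j = i then k else 0) = of_int k * x i"
proof -
  have "lin_comb V x (\<lambda>j. if j = i then k else 0) = (\<Sum>j\<in>V. if j = i then of_int k * x i else 0)"
    unfolding lin_comb_def by (rule sum.cong) auto
  with assms show ?thesis by simp
qed

lemma lin_comb_insert:
  assumes "finite V" "i \<notin> V"
  shows "lin_comb (insert i V) (x(i := a)) c = of_int (c i) * a + lin_comb V x c"
proof -
  have "(\<Sum>j\<in>V. of_int (c j) * (x(i := a)) j) = (\<Sum>j\<in>V. of_int (c j) * x j)"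
    using assms by (intro sum.cong) auto
  with assms show ?thesis by (simp add: lin_comb_def)
qed

lemma lin_comb_mod:
  "lin_comb V x c - lin_comb V x (\<lambda>i. c i mod q) = of_int q * lin_comb V x (\<lambda>i. c i div q)"
proof -
  have "lin_comb V x c = lin_comb V x (\<lambda>i. q * (c i div q) + c i mod q)"
    by simp
  then show ?thesis by (simp only: lin_comb_add lin_comb_scale) simp
qed

text \<open>An ordered abelian group is presented as the quotient of the additive group of a ring type by
  the preorder with positive cone \<open>P\<close>: \<open>eq0 x\<close> says that \<open>x\<close> vanishes in the quotient, and \<open>dv n x\<close> that
  it is divisible by \<open>n\<close> there. The ring product only serves to write integer multiples.\<close>

locale preordered_group =
  fixes P :: "'r::comm_ring_1 \<Rightarrow> bool"
  assumes pos_add: "P x \<Longrightarrow> P y \<Longrightarrow> P (x + y)"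
    and pos_total: "P x \<or> P (- x)"
begin

definition eq0 :: "'r \<Rightarrow> bool" where
  "eq0 x \<longleftrightarrow> P x \<and> P (- x)"

definition dv :: "int \<Rightarrow> 'r \<Rightarrow> bool" where
  "dv n x \<longleftrightarrow> (\<exists>y. eq0 (x - of_int n * y))"

definition incongruent_family :: "int \<Rightarrow> nat \<Rightarrow> bool" where
  "incongruent_family p n \<longleftrightarrow>
     (\<exists>x::nat \<Rightarrow> 'r. \<forall>i<n. \<forall>j<n. i \<noteq> j \<longrightarrow> \<not> dv p (x i - x j))"

text \<open>Only the subgroup of multiples of \<open>n\<close> is mentioned; its cosets are reached
  by translating the interval.\<close>

definition regularly_dense :: bool where
  "regularly_dense \<longleftrightarrow> (\<forall>n\<ge>1. \<forall>a b. \<not> P (a - b) \<longrightarrow>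
     (\<exists>x. \<not> P (a - of_int n * x) \<and> \<not> P (of_int n * x - b)))"

definition in_span :: "int \<Rightarrow> nat set \<Rightarrow> (nat \<Rightarrow> 'r) \<Rightarrow> 'r \<Rightarrow> bool" where
  "in_span q V x g \<longleftrightarrow> (\<exists>c. dv q (g - lin_comb V x c))"

lemma pos_0 [simp]: "P 0"
  using pos_total[of 0] by simp

lemma eq0_0 [simp]: "eq0 0"
  by (simp add: eq0_def)

lemma eq0_minus [simp]: "eq0 (- x) \<longleftrightarrow> eq0 x"
  by (auto simp: eq0_def)

lemma eq0_add: "eq0 x \<Longrightarrow> eq0 y \<Longrightarrow> eq0 (x + y)"
  unfolding eq0_def using pos_add[of x y] pos_add[of "-x" "-y"] by simp

lemma eq0_diff: "eq0 x \<Longrightarrow> eq0 y \<Longrightarrow> eq0 (x - y)"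
  using eq0_add[of x "-y"] by simp

lemma eq0_commute: "eq0 (x - y) \<longleftrightarrow> eq0 (y - x)"
  using eq0_minus[of "x - y"] by (simp del: eq0_minus)

lemma eq0_trans: "eq0 (x - y) \<Longrightarrow> eq0 (y - z) \<Longrightarrow> eq0 (x - z)"
  using eq0_add[of "x - y" "y - z"] by simp

lemma pos_cong: assumes "eq0 (x - y)" shows "P x \<longleftrightarrow> P y"
  using pos_add[of x "y - x"] pos_add[of y "x - y"] assms by (auto simp: eq0_def)

lemma eq0_cong: assumes "eq0 (x - y)" shows "eq0 x \<longleftrightarrow> eq0 y"
  using eq0_diff[OF _ assms, of x] eq0_add[OF _ assms, of y] by auto

lemma pos_scale_nat: "P x \<Longrightarrow> P (of_nat n * x)"
  by (induction n) (auto simp: algebra_simps intro: pos_add)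

lemma pos_scale: assumes "P x" "k \<ge> 0" shows "P (of_int k * x)"
  using pos_scale_nat[OF assms(1), of "nat k"] assms(2) by (simp add: of_nat_nat)

lemma pos_scale_iff: assumes "k > 0" shows "P (of_int k * x) \<longleftrightarrow> P x"
proof
  assume *: "P (of_int k * x)"
  show "P x"
  proof (rule ccontr)
    assume n: "\<not> P x"
    then have "P (- x)" using pos_total by blast
    then have "P (of_int (k - 1) * - x)" using assms by (intro pos_scale) auto
    from pos_add[OF * this] n show False by (simp add: algebra_simps)
  qed
qed (use assms pos_scale in auto)

lemma eq0_scale: assumes "eq0 x" shows "eq0 (of_int k * x)"
proof (cases "k \<ge> 0")
  case True
  with assms pos_scale[of x k] pos_scale[of "-x" k] show ?thesis by (simp add: eq0_def)
next
  case False
  with assms pos_scale[of x "-k"] pos_scale[of "-x" "-k"] show ?thesis by (simp add: eq0_def)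
qed

lemma eq0_scale_iff: assumes "k \<noteq> 0" shows "eq0 (of_int k * x) \<longleftrightarrow> eq0 x"
proof (cases "k > 0")
  case True
  with pos_scale_iff[of k x] pos_scale_iff[of k "-x"] show ?thesis by (simp add: eq0_def)
next
  case False
  with assms pos_scale_iff[of "-k" x] pos_scale_iff[of "-k" "-x"] show ?thesis
    by (auto simp: eq0_def)
qed

lemma not_pos: "\<not> P x \<Longrightarrow> P (- x)"
  using pos_total by blast

lemma neg_less: "\<not> P x \<Longrightarrow> P (- y) \<Longrightarrow> \<not> P (x + y)"
  using pos_add[of "x + y" "- y"] by auto

lemma dv_cong: assumes "eq0 (x - y)" shows "dv n x \<longleftrightarrow> dv n y"
proof -
  have "eq0 (x - z) \<longleftrightarrow> eq0 (y - z)" for z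
    using assms by (intro eq0_cong) simp
  then show ?thesis by (simp add: dv_def)
qed

lemma dv_add: assumes "dv n x" "dv n y" shows "dv n (x + y)"
proof -
  obtain z w where "eq0 (x - of_int n * z)" "eq0 (y - of_int n * w)"
    using assms by (auto simp: dv_def)
  from eq0_add[OF this] have "eq0 (x + y - of_int n * (z + w))" by (simp add: algebra_simps)
  then show ?thesis by (auto simp: dv_def)
qed

lemma dv_scale: assumes "dv n x" shows "dv n (of_int k * x)"
proof -
  obtain z where "eq0 (x - of_int n * z)"
    using assms by (auto simp: dv_def)
  from eq0_scale[OF this, of k] have "eq0 (of_int k * x - of_int n * (of_int k * z))"
    by (simp add: algebra_simps)
  then show ?thesis by (auto simp: dv_def)
qed

lemma dv_minus: "dv n (- x) \<longleftrightarrow> dv n x"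
  using dv_scale[of n x "-1"] dv_scale[of n "-x" "-1"] by auto

lemma dv_diff: "dv n x \<Longrightarrow> dv n y \<Longrightarrow> dv n (x - y)"
  using dv_add[of n x "-y"] dv_minus by simp

lemma dv_commute: "dv n (x - y) \<longleftrightarrow> dv n (y - x)"
  using dv_minus[of n "x - y"] by simp

lemma dv_trans: "dv n (x - y) \<Longrightarrow> dv n (y - z) \<Longrightarrow> dv n (x - z)"
  using dv_add[of n "x - y" "y - z"] by simp

lemma dv_add_cancel: assumes "dv n (x - y)" shows "dv n x \<longleftrightarrow> dv n y"
  using dv_diff[OF _ assms, of x] dv_add[OF _ assms, of y] by auto

lemma dv_eq0: "eq0 x \<Longrightarrow> dv n x"
  unfolding dv_def by (rule exI[of _ 0]) simp

lemma dv_0 [simp]: "dv n 0"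
  by (simp add: dv_eq0)

lemma dv_self [simp]: "dv n (of_int n * y)"
  unfolding dv_def by (rule exI[of _ y]) simp

lemma dv_1 [simp]: "dv 1 x"
  using dv_self[of 1 x] by simp

lemma dv_dvd: assumes "m dvd n" "dv n x" shows "dv m x"
proof -
  obtain k where k: "n = m * k" using assms(1) by auto
  obtain z where "eq0 (x - of_int n * z)" using assms(2) by (auto simp: dv_def)
  then have "eq0 (x - of_int m * (of_int k * z))" by (simp add: k algebra_simps)
  then show ?thesis by (auto simp: dv_def)
qed

text \<open>Cancellation is possible because a totally preordered group is torsion-free, which is
  \<open>eq0_scale_iff\<close>.\<close>

lemma dv_mult_iff: assumes "k \<noteq> 0" shows "dv (k * n) (of_int k * x) \<longleftrightarrow> dv n x"
proof -
  have "eq0 (of_int k * x - of_int (k * n) * y) \<longleftrightarrow> eq0 (x - of_int n * y)" for y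
    using eq0_scale_iff[OF assms, of "x - of_int n * y"] by (simp add: algebra_simps)
  then show ?thesis by (simp add: dv_def)
qed

lemma dv_coprime: assumes "coprime m n" "dv m x" "dv n x" shows "dv (m * n) x"
proof -
  obtain y z where yz: "eq0 (x - of_int m * y)" "eq0 (x - of_int n * z)"
    using assms by (auto simp: dv_def)
  obtain s t where st: "s * m + t * n = 1"
    using bezout_int[of m n] assms(1) by auto
  have "of_int (s * m) * (x - of_int n * z) + of_int (t * n) * (x - of_int m * y)
      = of_int (s * m + t * n) * x - of_int (m * n) * (of_int s * z + of_int t * y)"
    by (simp add: algebra_simps)
  also have "\<dots> = x - of_int (m * n) * (of_int s * z + of_int t * y)"
    by (simp only: st of_int_1 mult_1_left)
  finally have "eq0 (x - of_int (m * n) * (of_int s * z + of_int t * y))"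
    using eq0_add[OF eq0_scale[OF yz(2), of "s * m"] eq0_scale[OF yz(1), of "t * n"]] by simp
  then show ?thesis unfolding dv_def by blast
qed

lemma dv_coprime_iff: "coprime m n \<Longrightarrow> dv (m * n) x \<longleftrightarrow> dv m x \<and> dv n x"
  by (meson dv_coprime dv_dvd dvd_triv_left dvd_triv_right)

section \<open>Spans of a finite tuple modulo a number\<close>

lemma in_span_scale: assumes "in_span q V x g" shows "in_span q V x (of_int k * g)"
proof -
  obtain c where "dv q (g - lin_comb V x c)" using assms by (auto simp: in_span_def)
  from dv_scale[OF this, of k] have "dv q (of_int k * g - lin_comb V x (\<lambda>i. k * c i))"
    by (simp add: lin_comb_scale algebra_simps)
  then show ?thesis unfolding in_span_def by blast
qed

lemma in_span_cong: assumes "dv q (g - h)" "in_span q V x g" shows "in_span q V x h"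
proof -
  obtain c where "dv q (g - lin_comb V x c)" using assms by (auto simp: in_span_def)
  from dv_diff[OF this assms(1)] have "dv q (h - lin_comb V x c)" by simp
  then show ?thesis unfolding in_span_def by blast
qed

text \<open>The integers \<open>m\<close> with \<open>m * a\<close> in the span form an ideal that
  contains \<open>p ^ e\<close>. By Bezout it contains the gcd of \<open>m\<close> and
  \<open>p ^ e\<close> along with \<open>m\<close>, so it is generated by the least power of
  \<open>p\<close> in it; the hypotheses say that \<open>j\<close> is the exponent of this
  generator.\<close>

lemma in_span_multiple_iff:
  assumes p: "prime p" and j: "in_span (p ^ e) V x (of_int (p ^ j) * a)"
    and min: "j = 0 \<or> \<not> in_span (p ^ e) V x (of_int (p ^ (j - 1)) * a)"
  shows "in_span (p ^ e) V x (of_int m * a) \<longleftrightarrow> p ^ j dvd m"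
proof
  assume *: "in_span (p ^ e) V x (of_int m * a)"
  obtain i where "normalize (gcd m (p ^ e)) = normalize (p ^ i)"
    using p divides_primepow_weak[of p "gcd m (p ^ e)" e] by auto
  with p have i: "gcd m (p ^ e) = p ^ i"
    by (simp add: prime_ge_0_int)
  obtain s t where st: "s * m + t * p ^ e = p ^ i"
    using bezout_int[of m "p ^ e"] i by auto
  have "of_int (p ^ i) = (of_int s * of_int m + of_int t * of_int (p ^ e) :: 'r)"
    using st by (metis of_int_add of_int_mult)
  then have "of_int s * (of_int m * a) - of_int (p ^ i) * a = of_int (p ^ e) * (- of_int t * a)"
    by (simp only:) (simp add: algebra_simps)
  then have "dv (p ^ e) (of_int s * (of_int m * a) - of_int (p ^ i) * a)"
    using dv_self by metis
  from in_span_cong[OF this in_span_scale[OF *]]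
  have pi: "in_span (p ^ e) V x (of_int (p ^ i) * a)" .
  have "j \<le> i"
  proof (rule ccontr)
    assume "\<not> j \<le> i"
    then have "p ^ (j - 1) = p ^ (j - 1 - i) * p ^ i" "j \<noteq> 0"
      by (auto simp flip: power_add)
    with in_span_scale[OF pi, of "p ^ (j - 1 - i)"] min show False
      by (metis mult.assoc of_int_mult)
  qed
  then have "p ^ j dvd p ^ i" by (rule le_imp_power_dvd)
  also have "p ^ i dvd m" using i by (metis gcd_dvd1)
  finally show "p ^ j dvd m" .
next
  assume "p ^ j dvd m"
  then obtain k where "m = k * p ^ j" by (metis dvd_def mult.commute)
  with in_span_scale[OF j, of k] show "in_span (p ^ e) V x (of_int m * a)"
    by (simp add: mult.assoc)
qed

text \<open>Coefficients modulo \<open>p ^ e\<close> separate classes modulo \<open>p\<close>: if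
  \<open>p ^ (e - 1)\<close> times two elements have the same coefficients, then
  \<open>p ^ e\<close> divides \<open>p ^ (e - 1)\<close> times their difference, and cancelling
  leaves \<open>p\<close>. The bound is the number of coefficient vectors.\<close>

lemma incongruent_family_bounded:
  assumes V: "finite V" and p: "p > 0" and e: "e > 0"
    and span: "\<And>g. in_span (p ^ e) V x (of_int (p ^ (e - 1)) * g)"
  shows "\<not> incongruent_family p (Suc (card (V \<rightarrow>\<^sub>E {0..<p ^ e})))"
proof
  let ?q = "p ^ e"
  let ?F = "V \<rightarrow>\<^sub>E {0..<?q}"
  have fin: "finite ?F" using V by (intro finite_PiE) auto
  assume "incongruent_family p (Suc (card ?F))"
  then obtain y where y: "\<And>i j. i < Suc (card ?F) \<Longrightarrow> j < Suc (card ?F) \<Longrightarrow> i \<noteq> j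
    \<Longrightarrow> \<not> dv p (y i - y j)" unfolding incongruent_family_def by blast
  have "\<forall>i. \<exists>c. dv ?q (of_int (p ^ (e - 1)) * y i - lin_comb V x c)"
    using span by (auto simp: in_span_def)
  then obtain c where c: "\<And>i. dv ?q (of_int (p ^ (e - 1)) * y i - lin_comb V x (c i))"
    by metis
  define d where "d i = restrict (\<lambda>k. c i k mod ?q) V" for i
  have dF: "d i \<in> ?F" for i
    using p by (auto simp: d_def)
  have "\<not> inj_on d {..card ?F}"
    using card_inj_on_le[of d "{..card ?F}" ?F] dF fin by auto
  then obtain i j where ij: "i \<le> card ?F" "j \<le> card ?F" "i \<noteq> j" "d i = d j"
    by (auto simp: inj_on_def)
  have m: "dv ?q (of_int (p ^ (e - 1)) * y i - lin_comb V x (d i))" for i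
  proof -
    have "lin_comb V x (d i) = lin_comb V x (\<lambda>k. c i k mod ?q)"
      by (rule lin_comb_cong) (auto simp: d_def)
    then have "dv ?q (lin_comb V x (c i) - lin_comb V x (d i))"
      by (simp only: lin_comb_mod dv_self)
    from dv_trans[OF c this] show ?thesis .
  qed
  have "dv ?q (of_int (p ^ (e - 1)) * (y i - y j))"
    using dv_diff[OF m[of i] m[of j]] ij(4) by (simp add: algebra_simps)
  moreover have "?q = p ^ (e - 1) * p" using e by (simp add: power_eq_if)
  ultimately have "dv p (y i - y j)"
    using dv_mult_iff[of "p ^ (e - 1)" p] p by simp
  with y[of i j] ij show False by auto
qed

lemma incongruent_family_mono: "incongruent_family p n \<Longrightarrow> m \<le> n \<Longrightarrow> incongruent_family p m"
  unfolding incongruent_family_def by (meson order_less_le_trans)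

text \<open>The positive \<open>w\<close> provides room when a side is empty and nothing bounds the
  cut there. The strict gap between \<open>s\<close> and \<open>t\<close> is what regular density
  will be applied to.\<close>

lemma ex_strict_cut:
  assumes "finite X" "finite Y" and lt: "\<And>x y. x \<in> X \<Longrightarrow> y \<in> Y \<Longrightarrow> \<not> P (x - y)"
    and w: "\<not> P (- w)"
  shows "\<exists>s t. \<not> P (s - t) \<and> (\<forall>x\<in>X. P (s - x)) \<and> (\<forall>y\<in>Y. P (y - t))"
proof -
  have mx: "\<exists>s\<in>X. \<forall>x\<in>X. P (s - x)" if "finite X" "X \<noteq> {}" for X
    using that
  proof (induction rule: finite_ne_induct)
    case (insert a F)
    then obtain s where s: "s \<in> F" "\<And>x. x \<in> F \<Longrightarrow> P (s - x)" by blast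
    show ?case
    proof (cases "P (s - a)")
      case True with s show ?thesis by auto
    next
      case False
      then have a: "P (a - s)" using not_pos by fastforce
      have "P (a - x)" if "x \<in> F" for x
        using pos_add[OF a s(2)[OF that]] by simp
      then show ?thesis by auto
    qed
  qed auto
  have mn: "\<exists>t\<in>Y. \<forall>y\<in>Y. P (y - t)" if Y: "finite Y" "Y \<noteq> {}" for Y
    using mx[of "uminus ` Y"] Y by auto
  consider "X = {}" "Y = {}" | "X \<noteq> {}" "Y = {}" | "X = {}" "Y \<noteq> {}" | "X \<noteq> {}" "Y \<noteq> {}"
    by blast
  then show ?thesis
  proof cases
    case 1
    then show ?thesis using w by (intro exI[of _ 0] exI[of _ w]) auto
  next
    case 2
    then obtain s where "\<forall>x\<in>X. P (s - x)" using mx[OF assms(1)] by blast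
    then show ?thesis using w 2 by (intro exI[of _ s] exI[of _ "s + w"]) auto
  next
    case 3
    then obtain t where "\<forall>y\<in>Y. P (y - t)" using mn[OF assms(2)] by blast
    then show ?thesis using w 3 by (intro exI[of _ "t - w"] exI[of _ t]) auto
  next
    case 4
    then obtain s t where "s \<in> X" "t \<in> Y" "\<forall>x\<in>X. P (s - x)" "\<forall>y\<in>Y. P (y - t)"
      using mx[OF assms(1)] mn[OF assms(2)] by blast
    then show ?thesis using lt by blast
  qed
qed

end

section \<open>Extension of partial equivalences\<close>

locale preordered_group_pair = A: preordered_group P + B: preordered_group Q
  for P :: "'r::comm_ring_1 \<Rightarrow> bool" and Q :: "'s::comm_ring_1 \<Rightarrow> bool"
begin

text \<open>The second clause bounds the divisor but not the coefficients: divisibility by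
  \<open>n\<close> depends on the coefficients modulo \<open>n\<close> only, so this is finite
  information just like the first clause.\<close>

definition similar :: "nat \<Rightarrow> nat set \<Rightarrow> (nat \<Rightarrow> 'r) \<Rightarrow> (nat \<Rightarrow> 's) \<Rightarrow> bool" where
  "similar N V x y \<longleftrightarrow>
     (\<forall>c. (\<forall>i\<in>V. \<bar>c i\<bar> \<le> int N) \<longrightarrow> (P (lin_comb V x c) \<longleftrightarrow> Q (lin_comb V y c))) \<and>
     (\<forall>n\<in>{1..int N}. \<forall>c. A.dv n (lin_comb V x c) \<longleftrightarrow> B.dv n (lin_comb V y c))"

text \<open>If multiplication by \<open>p ^ (e - 1)\<close> maps \<open>B\<close> into the span of \<open>y\<close> modulo \<open>p ^ e\<close>, the same
  holds in \<open>A\<close>: a maximal incongruent family of \<open>B\<close> then transfers to \<open>A\<close> through the common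
  coefficients, and it is maximal there too as the two structures have the same number of classes.\<close>

lemma in_span_transfer:
  assumes V: "finite V" and p: "p > 0" and e: "e > 0"
    and dv: "\<And>i c. i \<le> e \<Longrightarrow> A.dv (p ^ i) (lin_comb V x c) \<longleftrightarrow> B.dv (p ^ i) (lin_comb V y c)"
    and inc: "\<And>n. A.incongruent_family p n \<longleftrightarrow> B.incongruent_family p n"
    and span: "\<And>g. B.in_span (p ^ e) V y (of_int (p ^ (e - 1)) * g)"
  shows "A.in_span (p ^ e) V x (of_int (p ^ (e - 1)) * h)"
proof (rule ccontr)
  assume h: "\<not> ?thesis"
  \<comment> \<open>The number of classes of \<open>B\<close> modulo \<open>p\<close>, finite by
    \<open>incongruent_family_bounded\<close>. As a least index it comes with a family of size
    \<open>r\<close> and none of size \<open>Suc r\<close>.\<close>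
  define r where "r = (LEAST n. \<not> B.incongruent_family p (Suc n))"
  have pe: "p ^ e = p ^ (e - 1) * p" using e by (simp add: power_eq_if)
  obtain n where n: "\<not> B.incongruent_family p n"
    using B.incongruent_family_bounded[OF V p e span] by blast
  then have "\<not> B.incongruent_family p (Suc n)"
    using B.incongruent_family_mono[of p "Suc n" n] by auto
  then have r1: "\<not> B.incongruent_family p (Suc r)"
    unfolding r_def by (rule LeastI)
  have "B.incongruent_family p r"
  proof (cases r)
    case 0
    then show ?thesis by (simp add: B.incongruent_family_def)
  next
    case (Suc k)
    then show ?thesis
      using not_less_Least[of k "\<lambda>n. \<not> B.incongruent_family p (Suc n)"] unfolding r_def by auto
  qed
  then obtain w where w: "\<And>i j. i < r \<Longrightarrow> j < r \<Longrightarrow> i \<noteq> j \<Longrightarrow> \<not> B.dv p (w i - w j)"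
    unfolding B.incongruent_family_def by blast
  obtain c where c: "\<And>i. B.dv (p ^ e) (of_int (p ^ (e - 1)) * w i - lin_comb V y (c i))"
    using choice[of "\<lambda>i c. B.dv (p ^ e) (of_int (p ^ (e - 1)) * w i - lin_comb V y c)"] span
    unfolding B.in_span_def by blast
  \<comment> \<open>In \<open>B\<close> these combinations agree with \<open>p ^ (e - 1)\<close>
    times \<open>w i\<close> modulo \<open>p ^ e\<close>, so \<open>p ^ (e - 1)\<close> divides them
    there and hence in \<open>A\<close>. The quotients \<open>z i\<close> are the copies of the
    \<open>w i\<close>.\<close>
  have "A.dv (p ^ (e - 1)) (lin_comb V x (c i))" for i
  proof -
    have "B.dv (p ^ (e - 1)) (of_int (p ^ (e - 1)) * w i - lin_comb V y (c i))"
      using c by (rule B.dv_dvd[rotated]) (simp add: pe)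
    then have "B.dv (p ^ (e - 1)) (lin_comb V y (c i))"
      using B.dv_add_cancel B.dv_self by blast
    then show ?thesis using dv[of "e - 1"] by simp
  qed
  then obtain z where z: "\<And>i. A.eq0 (lin_comb V x (c i) - of_int (p ^ (e - 1)) * z i)"
    unfolding A.dv_def by metis
  have incong: "\<not> A.dv p (z i - z j)" if ij: "i < r" "j < r" "i \<noteq> j" for i j
  proof
    assume "A.dv p (z i - z j)"
    then have 1: "A.dv (p ^ e) (of_int (p ^ (e - 1)) * (z i - z j))"
      using A.dv_mult_iff[of "p ^ (e - 1)" p] p by (simp add: pe)
    have "A.eq0 (of_int (p ^ (e - 1)) * (z i - z j) - (lin_comb V x (c i) - lin_comb V x (c j)))"
      using A.eq0_diff[OF z[of j] z[of i]] by (simp add: algebra_simps)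
    from A.dv_cong[OF this] 1 have "A.dv (p ^ e) (lin_comb V x (\<lambda>k. c i k - c j k))"
      by (simp add: lin_comb_diff)
    then have "B.dv (p ^ e) (lin_comb V y (c i) - lin_comb V y (c j))"
      unfolding dv[OF order.refl] by (simp add: lin_comb_diff)
    moreover have "B.dv (p ^ e) (of_int (p ^ (e - 1)) * (w i - w j)
        - (lin_comb V y (c i) - lin_comb V y (c j)))"
      using B.dv_diff[OF c[of i] c[of j]] by (simp add: algebra_simps)
    ultimately have "B.dv (p ^ e) (of_int (p ^ (e - 1)) * (w i - w j))"
      using B.dv_add_cancel by blast
    then have "B.dv p (w i - w j)"
      using B.dv_mult_iff[of "p ^ (e - 1)" p] p by (simp add: pe)
    with w ij show False by blast
  qed
  \<comment> \<open>A congruence of \<open>h\<close> with some \<open>z i\<close> would put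
    \<open>p ^ (e - 1)\<close> times \<open>h\<close> into the span; so \<open>h\<close> is one
    class too many.\<close>
  have incong_h: "\<not> A.dv p (h - z i)" for i
  proof
    assume "A.dv p (h - z i)"
    then have 1: "A.dv (p ^ e) (of_int (p ^ (e - 1)) * (h - z i))"
      using A.dv_mult_iff[of "p ^ (e - 1)" p] p by (simp add: pe)
    have "A.eq0 (of_int (p ^ (e - 1)) * (h - z i) - (of_int (p ^ (e - 1)) * h - lin_comb V x (c i)))"
      using z[of i] by (simp add: algebra_simps)
    from A.dv_cong[OF this] 1 have "A.in_span (p ^ e) V x (of_int (p ^ (e - 1)) * h)"
      unfolding A.in_span_def by blast
    with h show False by blast
  qed
  have "A.incongruent_family p (Suc r)"
    unfolding A.incongruent_family_def
    by (rule exI[of _ "z(r := h)"]) (auto simp: less_Suc_eq incong incong_h A.dv_commute[of p "z _" h])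
  with inc r1 show False by blast
qed

text \<open>All congruences of \<open>a\<close> modulo \<open>p ^ e\<close> follow from a single
  relation, \<open>p ^ j\<close> times \<open>a\<close> equals the combination \<open>c0\<close>,
  with \<open>j\<close> minimal. A partner needs the same relation with the same minimal
  \<open>j\<close>. If every solution \<open>b1 + p ^ (e - j) * g\<close> violated minimality, then
  \<open>p ^ (e - 1)\<close> times any element of \<open>B\<close> would lie in the span, by
  \<open>in_span_transfer\<close> the same would hold in \<open>A\<close>, and this would contradict
  the minimality of \<open>j\<close> for \<open>a\<close>.\<close>

lemma prime_power_extension:
  assumes V: "finite V" and p: "prime p"
    and dv: "\<And>i c. i \<le> e \<Longrightarrow> A.dv (p ^ i) (lin_comb V x c) \<longleftrightarrow> B.dv (p ^ i) (lin_comb V y c)"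
    and inc: "\<And>n. A.incongruent_family p n \<longleftrightarrow> B.incongruent_family p n"
  shows "\<exists>b. \<forall>c m. A.dv (p ^ e) (of_int m * a + lin_comb V x c) \<longleftrightarrow>
                  B.dv (p ^ e) (of_int m * b + lin_comb V y c)"
proof -
  have p0: "p > 0" using p by (simp add: prime_gt_0_int)
  define j where "j = (LEAST j. A.in_span (p ^ e) V x (of_int (p ^ j) * a))"
  have "A.dv (p ^ e) (of_int (p ^ e) * a - lin_comb V x (\<lambda>i. 0))"
    using A.dv_self[of "p ^ e" a] by simp
  then have ex: "A.in_span (p ^ e) V x (of_int (p ^ e) * a)"
    unfolding A.in_span_def by blast
  then have je: "j \<le> e" unfolding j_def by (rule Least_le)
  have j: "A.in_span (p ^ e) V x (of_int (p ^ j) * a)"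
    unfolding j_def using ex by (rule LeastI)
  have jmin: "j = 0 \<or> \<not> A.in_span (p ^ e) V x (of_int (p ^ (j - 1)) * a)"
    using not_less_Least[of "j - 1", folded j_def] unfolding j_def[symmetric]
    by (metis (no_types, lifting) diff_less j_def less_numeral_extra(1) not_gr_zero not_less_Least)
  obtain c0 where c0: "A.dv (p ^ e) (of_int (p ^ j) * a - lin_comb V x c0)"
    using j by (auto simp: A.in_span_def)
  have pje: "p ^ j dvd p ^ e" using je by (rule le_imp_power_dvd)
  have "A.dv (p ^ j) (of_int (p ^ j) * a - lin_comb V x c0)"
    using c0 pje A.dv_dvd by blast
  then have "A.dv (p ^ j) (lin_comb V x c0)"
    using A.dv_add_cancel A.dv_self by blast
  then have "B.dv (p ^ j) (lin_comb V y c0)" using dv je by blast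
  then obtain b1 where b1: "B.eq0 (lin_comb V y c0 - of_int (p ^ j) * b1)"
    unfolding B.dv_def by blast
  have "\<exists>b. B.dv (p ^ e) (of_int (p ^ j) * b - lin_comb V y c0) \<and>
          (j = 0 \<or> \<not> B.in_span (p ^ e) V y (of_int (p ^ (j - 1)) * b))"
  proof (cases "j = 0")
    case True
    with b1 show ?thesis
      by (intro exI[of _ b1]) (auto intro!: B.dv_eq0 simp: B.eq0_commute)
  next
    case False
    then have e: "e > 0" using je by simp
    have pj: "p ^ j = p * p ^ (j - 1)" and pe: "p ^ e = p * p ^ (e - 1)"
      using False e by (simp_all add: power_eq_if)
    have pp: "p ^ (j - 1) * p ^ (e - j) = p ^ (e - 1)" "p ^ j * p ^ (e - j) = p ^ e"
      using False je by (simp_all flip: power_add)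
    define b where "b g = b1 + of_int (p ^ (e - j)) * g" for g
    have b: "B.dv (p ^ e) (of_int (p ^ j) * b g - lin_comb V y c0)" for g
    proof -
      have "of_int (p ^ j) * b g - lin_comb V y c0
          = of_int (p ^ e) * g - (lin_comb V y c0 - of_int (p ^ j) * b1)"
        unfolding pp(2)[symmetric] b_def by (simp add: algebra_simps)
      then show ?thesis
        using B.dv_diff[OF B.dv_self B.dv_eq0[OF b1]] by metis
    qed
    have "\<exists>g. \<not> B.in_span (p ^ e) V y (of_int (p ^ (j - 1)) * b g)"
    proof (rule ccontr)
      assume "\<not> ?thesis"
      then have "\<forall>g. \<exists>c. B.dv (p ^ e) (of_int (p ^ (j - 1)) * b g - lin_comb V y c)"
        unfolding B.in_span_def by blast
      then obtain c where c: "\<And>g. B.dv (p ^ e) (of_int (p ^ (j - 1)) * b g - lin_comb V y (c g))"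
        by metis
      \<comment> \<open>In the difference of the relations for \<open>g\<close> and for 0 the
        summand \<open>b1\<close> cancels and \<open>p ^ (j - 1) * p ^ (e - j)\<close> times
        \<open>g\<close> remains.\<close>
      have "B.in_span (p ^ e) V y (of_int (p ^ (e - 1)) * g)" for g
      proof -
        have eq: "of_int (p ^ (j - 1)) * b g - lin_comb V y (c g) - (of_int (p ^ (j - 1)) * b 0 - lin_comb V y (c 0))
           = of_int (p ^ (e - 1)) * g - lin_comb V y (\<lambda>i. c g i - c 0 i)"
          unfolding pp(1)[symmetric] b_def lin_comb_diff by (simp add: algebra_simps)
        show ?thesis using B.dv_diff[OF c[of g] c[of 0]] unfolding eq B.in_span_def by blast
      qed
      then have "A.in_span (p ^ e) V x (of_int (p ^ (e - 1)) * h)" for h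
        using in_span_transfer[OF V p0 e dv inc] by blast
      then obtain d where d: "\<And>h. A.dv (p ^ e) (of_int (p ^ (e - 1)) * h - lin_comb V x (d h))"
        unfolding A.in_span_def by metis
      \<comment> \<open>Multiplying the relation for \<open>b 0\<close> by \<open>p\<close> links
        \<open>c 0\<close> with \<open>c0\<close>, a statement about coefficients that transfers to
        \<open>A\<close>. Cancelling \<open>p\<close> there shows that \<open>p ^ (j - 1)\<close>
        times \<open>a\<close> is in the span up to an error \<open>p ^ (e - 1) * h\<close>, and the
        error is in the span too.\<close>
      have "B.dv (p ^ e) (of_int p * (of_int (p ^ (j - 1)) * b 0 - lin_comb V y (c 0)))"
        using c B.dv_scale by blast
      from B.dv_diff[OF this b[of 0]]
      have "B.dv (p ^ e) (lin_comb V y (\<lambda>i. c0 i - p * c 0 i))"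
        unfolding lin_comb_diff lin_comb_scale pj by (simp add: algebra_simps)
      then have "A.dv (p ^ e) (lin_comb V x (\<lambda>i. c0 i - p * c 0 i))"
        using dv by blast
      from A.dv_add[OF c0 this]
      have "A.dv (p ^ e) (of_int p * (of_int (p ^ (j - 1)) * a - lin_comb V x (c 0)))"
        unfolding lin_comb_diff lin_comb_scale pj by (simp add: algebra_simps)
      then have "A.dv (p ^ (e - 1)) (of_int (p ^ (j - 1)) * a - lin_comb V x (c 0))"
        using A.dv_mult_iff[of p] p0 unfolding pe by simp
      then obtain h where h: "A.eq0 (of_int (p ^ (j - 1)) * a - lin_comb V x (c 0) - of_int (p ^ (e - 1)) * h)"
        unfolding A.dv_def by blast
      have "A.dv (p ^ e) (of_int (p ^ (j - 1)) * a - lin_comb V x (\<lambda>i. c 0 i + d h i))"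
        using A.dv_add[OF A.dv_eq0[OF h] d[of h]] by (simp add: lin_comb_add algebra_simps)
      then show False using jmin False unfolding A.in_span_def by blast
    qed
    then show ?thesis using b by blast
  qed
  then obtain b where b: "B.dv (p ^ e) (of_int (p ^ j) * b - lin_comb V y c0)"
    "j = 0 \<or> \<not> B.in_span (p ^ e) V y (of_int (p ^ (j - 1)) * b)" by blast
  then have bj: "B.in_span (p ^ e) V y (of_int (p ^ j) * b)" unfolding B.in_span_def by blast
  have "A.dv (p ^ e) (of_int m * a + lin_comb V x c) \<longleftrightarrow> B.dv (p ^ e) (of_int m * b + lin_comb V y c)"
    for c m
  proof (cases "p ^ j dvd m")
    case True
    then obtain k where k: "m = k * p ^ j" by (metis dvd_def mult.commute)
    have "A.dv (p ^ e) (of_int m * a + lin_comb V x c - lin_comb V x (\<lambda>i. k * c0 i + c i))"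
      using A.dv_scale[OF c0, of k] by (simp add: k lin_comb_add lin_comb_scale algebra_simps)
    moreover have "B.dv (p ^ e) (of_int m * b + lin_comb V y c - lin_comb V y (\<lambda>i. k * c0 i + c i))"
      using B.dv_scale[OF b(1), of k] by (simp add: k lin_comb_add lin_comb_scale algebra_simps)
    ultimately show ?thesis
      using A.dv_add_cancel B.dv_add_cancel dv[OF order.refl] by blast
  next
    case False
    \<comment> \<open>Both sides are false: \<open>m\<close> lies outside the ideal generated by
      \<open>p ^ j\<close>, which is the same ideal for \<open>a\<close> and
      \<open>b\<close>.\<close>
    have "\<not> A.in_span (p ^ e) V x (of_int m * a)"
      using A.in_span_multiple_iff[OF p j jmin] False by blast
    then have "\<not> A.dv (p ^ e) (of_int m * a - lin_comb V x (\<lambda>i. - c i))"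
      unfolding A.in_span_def by blast
    moreover have "\<not> B.in_span (p ^ e) V y (of_int m * b)"
      using B.in_span_multiple_iff[OF p bj b(2)] False by blast
    then have "\<not> B.dv (p ^ e) (of_int m * b - lin_comb V y (\<lambda>i. - c i))"
      unfolding B.in_span_def by blast
    ultimately show ?thesis by (simp add: lin_comb_minus)
  qed
  then show ?thesis by blast
qed

text \<open>Chinese remaindering: one prime power of \<open>L\<close> is split off, the cofactor is
  left to the induction, and the two partners are glued with Bezout coefficients.\<close>

lemma congruence_extension:
  assumes V: "finite V" and L: "L \<ge> (1::nat)"
    and dv: "\<And>n c. n \<ge> 1 \<Longrightarrow> n \<le> int L \<Longrightarrow> A.dv n (lin_comb V x c) \<longleftrightarrow> B.dv n (lin_comb V y c)"
    and inc: "\<And>p n. prime p \<Longrightarrow> A.incongruent_family p n \<longleftrightarrow> B.incongruent_family p n"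
  shows "\<exists>b. \<forall>c m. A.dv (int L) (of_int m * a + lin_comb V x c) \<longleftrightarrow>
                  B.dv (int L) (of_int m * b + lin_comb V y c)"
  using L dv
proof (induction L rule: less_induct)
  case (less L)
  show ?case
  proof (cases "L = 1")
    case True
    then show ?thesis by simp
  next
    case False
    then obtain p where p: "prime p" "p dvd L" using prime_factor_nat by blast
    define e where "e = multiplicity p L"
    obtain K where K: "L = p ^ e * K" "\<not> p dvd K"
      using multiplicity_decompose'[of L p] p less.prems(1) unfolding e_def
      by (metis not_prime_unit not_one_le_zero)
    have e: "e > 0" using p less.prems(1) unfolding e_def by (simp add: prime_multiplicity_gt_zero_iff)
    have K1: "K \<ge> 1" using K less.prems(1) by (cases K) auto
    have "p ^ e \<ge> 2" using e p(1) prime_ge_2_nat[of p] self_le_power[of p e] by linarith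
    then have KL: "K < L" using K K1 by simp
    have cop: "coprime (int (p ^ e)) (int K)"
      using prime_imp_coprime[OF p(1) K(2)] by (simp del: of_nat_power)
    obtain b1 where b1: "\<And>c m. A.dv (int p ^ e) (of_int m * a + lin_comb V x c) \<longleftrightarrow>
                  B.dv (int p ^ e) (of_int m * b1 + lin_comb V y c)"
    proof -
      have "\<exists>b. \<forall>c m. A.dv (int p ^ e) (of_int m * a + lin_comb V x c) \<longleftrightarrow>
                  B.dv (int p ^ e) (of_int m * b + lin_comb V y c)"
      proof (rule prime_power_extension[OF V])
        show "prime (int p)" using p(1) by simp
        show "A.incongruent_family (int p) n \<longleftrightarrow> B.incongruent_family (int p) n" for n
          using inc p(1) by simp
        fix i c assume "i \<le> e"
        then have "p ^ i dvd L" using K le_imp_power_dvd[of i e p] by auto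
        then have "p ^ i \<le> L" using less.prems(1) by (auto intro: dvd_imp_le)
        then have "int p ^ i \<le> int L" by (metis of_nat_le_iff of_nat_power)
        moreover have "1 \<le> int p ^ i" using prime_gt_0_nat[OF p(1)] by simp
        ultimately show "A.dv (int p ^ i) (lin_comb V x c) \<longleftrightarrow> B.dv (int p ^ i) (lin_comb V y c)"
          using less.prems(2) by blast
      qed
      then show ?thesis using that by blast
    qed
    obtain b2 where b2: "\<And>c m. A.dv (int K) (of_int m * a + lin_comb V x c) \<longleftrightarrow>
                  B.dv (int K) (of_int m * b2 + lin_comb V y c)"
    proof -
      have "\<exists>b. \<forall>c m. A.dv (int K) (of_int m * a + lin_comb V x c) \<longleftrightarrow>
                  B.dv (int K) (of_int m * b + lin_comb V y c)"
        using KL by (intro less.IH[OF KL K1] less.prems(2)) auto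
      then show ?thesis using that by blast
    qed
    obtain s t where st: "s * int (p ^ e) + t * int K = 1"
      using bezout_int[of "int (p ^ e)" "int K"] cop by auto
    \<comment> \<open>Congruent to \<open>b1\<close> modulo \<open>p ^ e\<close> and to
      \<open>b2\<close> modulo \<open>K\<close>.\<close>
    define b where "b = of_int (s * int (p ^ e)) * b2 + of_int (t * int K) * b1"
    have "of_int (s * int (p ^ e)) = (1 - of_int (t * int K) :: 's)"
      using st by (metis add_diff_cancel_right' of_int_1 of_int_diff)
    then have e2: "b - b2 = of_int (int K) * (of_int t * (b1 - b2))"
      unfolding b_def by (simp only:) (simp add: algebra_simps)
    have "of_int (t * int K) = (1 - of_int (s * int (p ^ e)) :: 's)"
      using st by (metis add_diff_cancel_left' of_int_1 of_int_diff)
    then have e1: "b - b1 = of_int (int p ^ e) * (of_int s * (b2 - b1))"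
      unfolding b_def by (simp only:) (simp add: algebra_simps)
    have d1: "B.dv (int p ^ e) (of_int m * b1 + z) \<longleftrightarrow> B.dv (int p ^ e) (of_int m * b + z)" for m z
    proof -
      have "of_int m * b + z - (of_int m * b1 + z) = of_int (int p ^ e) * (of_int m * (of_int s * (b2 - b1)))"
        using arg_cong[OF e1, of "\<lambda>w. of_int m * w"] by (simp add: algebra_simps)
      then show ?thesis using B.dv_add_cancel B.dv_self by metis
    qed
    have d2: "B.dv (int K) (of_int m * b2 + z) \<longleftrightarrow> B.dv (int K) (of_int m * b + z)" for m z
    proof -
      have "of_int m * b + z - (of_int m * b2 + z) = of_int (int K) * (of_int m * (of_int t * (b1 - b2)))"
        using arg_cong[OF e2, of "\<lambda>w. of_int m * w"] by (simp add: algebra_simps)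
      then show ?thesis using B.dv_add_cancel B.dv_self by metis
    qed
    have L: "int L = int p ^ e * int K" using K(1) by simp
    have cop': "coprime (int p ^ e) (int K)" using cop by simp
    show ?thesis
      by (rule exI[of _ b]) (simp only: L A.dv_coprime_iff[OF cop'] B.dv_coprime_iff[OF cop'] b1 b2 d1 d2 simp_thms)
  qed
qed

text \<open>With \<open>L = N!\<close>, the conditions on a new element \<open>a\<close> compare \<open>L a\<close> with combinations of the old
  ones and fix \<open>a\<close> modulo \<open>L\<close>. Either \<open>L a\<close> is such a combination, or regular density finds in the
  corresponding cut of \<open>B\<close> an element of the required congruence class.\<close>

lemma extension_step:
  assumes V: "finite V" and i: "i \<notin> V" and N: "N \<ge> 1"
    and sim: "similar (2 * fact N * fact N * N * N) V x y"
    and inc: "\<And>p n. prime p \<Longrightarrow> A.incongruent_family p n \<longleftrightarrow> B.incongruent_family p n"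
    and dense: "B.regularly_dense" and nontriv: "\<not> Q (- w)"
  shows "\<exists>b. similar N (insert i V) (x(i := a)) (y(i := b))"
proof -
  define L where "L = int (fact N)"
  \<comment> \<open>Several demands meet in this constant. If \<open>L a\<close> is a combination
    \<open>d\<close>, then \<open>L\<close> times a new combination has coefficients
    \<open>m * d k + L * c k\<close>, at most \<open>L N N + L N\<close>, and divisibility by
    \<open>L\<close> turns into divisibility by \<open>L * L\<close>. Otherwise the ends of the cut
    are compared through \<open>d k - d' k\<close>, at most \<open>2 L N\<close>.\<close>
  define M where "M = 2 * fact N * fact N * N * N"
  have L1: "L \<ge> 1" unfolding L_def using fact_ge_1[of N, where 'a = nat] by linarith
  have M: "int M = 2 * L * L * int N * int N" unfolding M_def L_def by simp
  have LL: "L \<le> L * L" using L1 by (simp add: mult_le_cancel_left1)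
  then have LL1: "L * L \<ge> 1" using L1 by linarith
  have N0: "1 \<le> int N" using N by simp
  have NN1: "1 * 1 \<le> int N * int N" using N0 by (intro mult_mono) auto
  have NN: "int N * 1 \<le> int N * int N" using N0 by (intro mult_left_mono) auto
  have bound: "z \<le> int M" if "z \<le> 2 * (L * L) * (int N * int N)" for z
    using that by (simp add: M mult_ac)
  have "(L * L) * 1 \<le> (L * L) * (int N * int N)"
    using LL1 NN1 by (intro mult_left_mono) auto
  moreover have "L * int N \<le> (L * L) * (int N * int N)"
    using LL NN L1 N0 by (intro mult_mono) auto
  moreover have "L * (int N * int N) \<le> (L * L) * (int N * int N)"
    using LL NN1 by (intro mult_right_mono) auto
  moreover have "L * 1 \<le> L * int N" "1 * int N \<le> L * int N"
    using L1 N0 by (auto intro: mult_left_mono mult_right_mono)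
  ultimately have LLNN: "L * L \<le> (L * L) * (int N * int N)" "L * int N \<le> (L * L) * (int N * int N)"
    "L * (int N * int N) \<le> (L * L) * (int N * int N)" "L \<le> L * int N" "int N \<le> L * int N"
    "1 \<le> (L * L) * (int N * int N)"
    using LL1 by linarith+
  have pos: "P (lin_comb V x c) \<longleftrightarrow> Q (lin_comb V y c)" if "\<And>k. k \<in> V \<Longrightarrow> \<bar>c k\<bar> \<le> int M" for c
    using sim that unfolding similar_def M_def by blast
  have dv: "A.dv n (lin_comb V x c) \<longleftrightarrow> B.dv n (lin_comb V y c)" if "1 \<le> n" "n \<le> int M" for n c
    using sim that unfolding similar_def M_def by auto
  \<comment> \<open>The single divisor \<open>L\<close> suffices: each \<open>n\<close> up to
    \<open>N\<close> divides it, and \<open>n\<close> divides an element iff \<open>L\<close>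
    divides its multiple by \<open>L / n\<close>.\<close>
  have suff: "\<exists>b. similar N (insert i V) (x(i := a)) (y(i := b))"
    if s: "\<And>m c. \<bar>m\<bar> \<le> int N \<Longrightarrow> (\<And>k. k \<in> V \<Longrightarrow> \<bar>c k\<bar> \<le> int N) \<Longrightarrow>
        P (of_int m * a + lin_comb V x c) \<longleftrightarrow> Q (of_int m * b + lin_comb V y c)"
      and d: "\<And>m c. A.dv L (of_int m * a + lin_comb V x c) \<longleftrightarrow> B.dv L (of_int m * b + lin_comb V y c)"
    for b
  proof -
    have "A.dv n (of_int m * a + lin_comb V x c) \<longleftrightarrow> B.dv n (of_int m * b + lin_comb V y c)"
      if n: "1 \<le> n" "n \<le> int N" for n m c
    proof -
      have "nat n dvd fact N" using n by (intro dvd_fact) auto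
      then have "int (nat n) dvd L" unfolding L_def by (simp only: int_dvd_int_iff)
      then have "n dvd L" using n by simp
      then obtain k where k: "L = k * n" by (metis dvd_def mult.commute)
      have k0: "k \<noteq> 0" using L1 k by auto
      have "A.dv n (of_int m * a + lin_comb V x c) \<longleftrightarrow>
          A.dv L (of_int (k * m) * a + lin_comb V x (\<lambda>i. k * c i))"
        using A.dv_mult_iff[OF k0, of n "of_int m * a + lin_comb V x c"]
        by (simp add: k lin_comb_scale algebra_simps)
      also have "\<dots> \<longleftrightarrow> B.dv L (of_int (k * m) * b + lin_comb V y (\<lambda>i. k * c i))"
        by (rule d)
      also have "\<dots> \<longleftrightarrow> B.dv n (of_int m * b + lin_comb V y c)"
        using B.dv_mult_iff[OF k0, of n "of_int m * b + lin_comb V y c"]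
        by (simp add: k lin_comb_scale algebra_simps)
      finally show ?thesis .
    qed
    then show ?thesis
      unfolding similar_def
      by (intro exI[of _ b] conjI allI ballI impI)
        (auto simp: lin_comb_insert[OF V i] intro!: s)
  qed
  show ?thesis
  proof (cases "\<exists>d. (\<forall>k\<in>V. \<bar>d k\<bar> \<le> L * int N) \<and> A.eq0 (of_int L * a - lin_comb V x d)")
    case True
    then obtain d where d: "\<And>k. k \<in> V \<Longrightarrow> \<bar>d k\<bar> \<le> L * int N"
      "A.eq0 (of_int L * a - lin_comb V x d)" by blast
    have "A.dv L (lin_comb V x d)"
      using d(2) A.dv_def A.eq0_commute by blast
    then have "B.dv L (lin_comb V y d)"
      using dv[of L d] L1 bound[of L] LL LLNN by linarith
    then obtain b where b: "B.eq0 (of_int L * b - lin_comb V y d)"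
      unfolding B.dv_def using B.eq0_commute by blast
    have ex: "A.eq0 (of_int L * (of_int m * a + lin_comb V x c) - lin_comb V x (\<lambda>i. m * d i + L * c i))"
      for m c
      using A.eq0_scale[OF d(2), of m] by (simp add: lin_comb_add lin_comb_scale algebra_simps)
    have ey: "B.eq0 (of_int L * (of_int m * b + lin_comb V y c) - lin_comb V y (\<lambda>i. m * d i + L * c i))"
      for m c
      using B.eq0_scale[OF b, of m] by (simp add: lin_comb_add lin_comb_scale algebra_simps)
    show ?thesis
    proof (rule suff[of b])
      fix m c assume m: "\<bar>m\<bar> \<le> int N" and c: "\<And>k. k \<in> V \<Longrightarrow> \<bar>c k\<bar> \<le> int N"
      have *: "\<bar>m * d k + L * c k\<bar> \<le> int M" if "k \<in> V" for k
      proof (rule bound)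
        have "\<bar>m * d k + L * c k\<bar> \<le> \<bar>m\<bar> * \<bar>d k\<bar> + L * \<bar>c k\<bar>"
          using L1 abs_triangle_ineq[of "m * d k" "L * c k"] by (simp add: abs_mult)
        also have "\<dots> \<le> int N * (L * int N) + L * int N"
          using m d(1)[OF that] c[OF that] L1 by (intro add_mono mult_mono) auto
        also have "\<dots> \<le> 2 * (L * L) * (int N * int N)"
          using LLNN by (simp add: mult_ac)
        finally show "\<bar>m * d k + L * c k\<bar> \<le> 2 * (L * L) * (int N * int N)" .
      qed
      have "P (of_int m * a + lin_comb V x c) \<longleftrightarrow> P (of_int L * (of_int m * a + lin_comb V x c))"
        using A.pos_scale_iff[of L] L1 by simp
      also have "\<dots> \<longleftrightarrow> P (lin_comb V x (\<lambda>i. m * d i + L * c i))"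
        by (rule A.pos_cong[OF ex])
      also have "\<dots> \<longleftrightarrow> Q (lin_comb V y (\<lambda>i. m * d i + L * c i))"
        by (rule pos[OF *])
      also have "\<dots> \<longleftrightarrow> Q (of_int L * (of_int m * b + lin_comb V y c))"
        by (rule B.pos_cong[OF ey, symmetric])
      also have "\<dots> \<longleftrightarrow> Q (of_int m * b + lin_comb V y c)"
        using B.pos_scale_iff[of L] L1 by simp
      finally show "P (of_int m * a + lin_comb V x c) \<longleftrightarrow> Q (of_int m * b + lin_comb V y c)" .
    next
      fix m c
      have LL': "L * L \<le> int M" "1 \<le> L * L" using bound[of "L * L"] LL1 LLNN by linarith+
      have "A.dv L (of_int m * a + lin_comb V x c) \<longleftrightarrow> A.dv (L * L) (of_int L * (of_int m * a + lin_comb V x c))"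
        using A.dv_mult_iff[of L] L1 by simp
      also have "\<dots> \<longleftrightarrow> A.dv (L * L) (lin_comb V x (\<lambda>i. m * d i + L * c i))"
        by (rule A.dv_cong[OF ex])
      also have "\<dots> \<longleftrightarrow> B.dv (L * L) (lin_comb V y (\<lambda>i. m * d i + L * c i))"
        using LL' by (intro dv)
      also have "\<dots> \<longleftrightarrow> B.dv (L * L) (of_int L * (of_int m * b + lin_comb V y c))"
        by (rule B.dv_cong[OF ey, symmetric])
      also have "\<dots> \<longleftrightarrow> B.dv L (of_int m * b + lin_comb V y c)"
        using B.dv_mult_iff[of L] L1 by simp
      finally show "A.dv L (of_int m * a + lin_comb V x c) \<longleftrightarrow> B.dv L (of_int m * b + lin_comb V y c)" .
    qed
  next
    case False
    define D where "D = V \<rightarrow>\<^sub>E {- (L * int N)..L * int N}"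
    define Lo where "Lo d \<longleftrightarrow> \<not> P (lin_comb V x d - of_int L * a)" for d
    define Up where "Up d \<longleftrightarrow> \<not> P (of_int L * a - lin_comb V x d)" for d
    have finD: "finite D" unfolding D_def using V by (intro finite_PiE) auto
    \<comment> \<open>There are no ties, since equality of \<open>L a\<close> with a bounded
      combination is the other case.\<close>
    have LoUp: "Lo d \<noteq> Up d" if "\<And>k. k \<in> V \<Longrightarrow> \<bar>d k\<bar> \<le> L * int N" for d
    proof -
      have "\<not> A.eq0 (of_int L * a - lin_comb V x d)" using False that by blast
      then show ?thesis unfolding Lo_def Up_def A.eq0_def
        using A.pos_total[of "of_int L * a - lin_comb V x d"] by auto
    qed
    obtain b0 where b0: "\<And>m c. A.dv L (of_int m * a + lin_comb V x c) \<longleftrightarrow>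
                  B.dv L (of_int m * b0 + lin_comb V y c)"
    proof -
      have "L \<le> int M" using bound[of L] LL LLNN by linarith
      then have "\<exists>b. \<forall>c m. A.dv (int (fact N)) (of_int m * a + lin_comb V x c) \<longleftrightarrow>
                  B.dv (int (fact N)) (of_int m * b + lin_comb V y c)"
        using L1 unfolding L_def by (intro congruence_extension[OF V _ _ inc] dv) auto
      then show ?thesis using that unfolding L_def by blast
    qed
    obtain s t where st0: "\<not> Q (s - t) \<and> (\<forall>z\<in>lin_comb V y ` {d\<in>D. Lo d}. Q (s - z)) \<and>
        (\<forall>z\<in>lin_comb V y ` {d\<in>D. Up d}. Q (z - t))"
    proof (atomize_elim, rule B.ex_strict_cut[OF _ _ _ nontriv])
      fix z z' assume "z \<in> lin_comb V y ` {d\<in>D. Lo d}" "z' \<in> lin_comb V y ` {d\<in>D. Up d}"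
      then obtain d d' where d: "d \<in> D" "Lo d" "z = lin_comb V y d"
        and d': "d' \<in> D" "Up d'" "z' = lin_comb V y d'" by blast
      have "P (- (of_int L * a - lin_comb V x d'))"
        using d'(2) A.not_pos unfolding Up_def by blast
      from A.neg_less[OF d(2)[unfolded Lo_def] this]
      have "\<not> P (lin_comb V x (\<lambda>i. d i - d' i))" by (simp add: lin_comb_diff)
      moreover have "\<bar>d k - d' k\<bar> \<le> int M" if "k \<in> V" for k
      proof (rule bound)
        have "d k \<in> {- (L * int N)..L * int N}" "d' k \<in> {- (L * int N)..L * int N}"
          using d(1) d'(1) that unfolding D_def by auto
        then have "\<bar>d k - d' k\<bar> \<le> 2 * (L * int N)" by auto
        then show "\<bar>d k - d' k\<bar> \<le> 2 * (L * L) * (int N * int N)" using LLNN by linarith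
      qed
      ultimately have "\<not> Q (lin_comb V y (\<lambda>i. d i - d' i))" by (simp only: pos simp_thms)
      then show "\<not> Q (z - z')" by (simp add: lin_comb_diff d d')
    qed (use finD in auto)
    have st: "\<not> Q (s - t)"
      "\<And>d. d \<in> D \<Longrightarrow> Lo d \<Longrightarrow> Q (s - lin_comb V y d)"
      "\<And>d. d \<in> D \<Longrightarrow> Up d \<Longrightarrow> Q (lin_comb V y d - t)"
      using st0 by simp_all
    \<comment> \<open>The cut is shifted by \<open>L * b0\<close> and density is used with the
      multiplier \<open>L * L\<close>. This places \<open>L * b\<close> in the cut while
      \<open>b0\<close> changes only by a multiple of \<open>L\<close>, so its congruences
      survive.\<close>
    have "\<not> Q ((s - of_int L * b0) - (t - of_int L * b0))" using st(1) by simp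
    moreover have "L * L \<ge> 1" by (rule LL1)
    ultimately obtain g where g: "\<not> Q (s - of_int L * b0 - of_int (L * L) * g)"
      "\<not> Q (of_int (L * L) * g - (t - of_int L * b0))"
      using dense unfolding B.regularly_dense_def by blast
    define b where "b = b0 + of_int L * g"
    have b: "\<not> Q (s - of_int L * b)" "\<not> Q (of_int L * b - t)"
      using g by (simp_all add: b_def algebra_simps)
    have cut: "(Lo d \<longrightarrow> Q (of_int L * b - lin_comb V y d) \<and> \<not> Q (lin_comb V y d - of_int L * b)) \<and>
      (Up d \<longrightarrow> \<not> Q (of_int L * b - lin_comb V y d) \<and> Q (lin_comb V y d - of_int L * b))"
      if dd: "\<And>k. k \<in> V \<Longrightarrow> \<bar>d k\<bar> \<le> L * int N" for d
    proof -
      define d' where "d' = restrict d V"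
      have eqx: "lin_comb V x d' = lin_comb V x d" by (rule lin_comb_cong) (auto simp: d'_def)
      have eqy: "lin_comb V y d' = lin_comb V y d" by (rule lin_comb_cong) (auto simp: d'_def)
      have "- (L * int N) \<le> d k \<and> d k \<le> L * int N" if "k \<in> V" for k
        using dd[OF that] by linarith
      then have d'D: "d' \<in> D" unfolding D_def d'_def by auto
      show ?thesis
      proof (intro conjI impI)
        assume "Lo d"
        then have 1: "Q (s - lin_comb V y d)"
          using st(2)[OF d'D] unfolding eqx eqy Lo_def by blast
        show 2: "\<not> Q (lin_comb V y d - of_int L * b)"
          using B.neg_less[OF b(1), of "lin_comb V y d - s"] 1 by simp
        show "Q (of_int L * b - lin_comb V y d)" using B.not_pos[OF 2] by simp
      next
        assume "Up d"
        then have 1: "Q (lin_comb V y d - t)"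
          using st(3)[OF d'D] unfolding eqx eqy Up_def by blast
        show 2: "\<not> Q (of_int L * b - lin_comb V y d)"
          using B.neg_less[OF b(2), of "t - lin_comb V y d"] 1 by simp
        show "Q (lin_comb V y d - of_int L * b)" using B.not_pos[OF 2] by simp
      qed
    qed
    have signs: "(P (of_int L * a - lin_comb V x d) \<longleftrightarrow> Q (of_int L * b - lin_comb V y d)) \<and>
        (P (lin_comb V x d - of_int L * a) \<longleftrightarrow> Q (lin_comb V y d - of_int L * b))"
      if dd: "\<And>k. k \<in> V \<Longrightarrow> \<bar>d k\<bar> \<le> L * int N" for d
    proof -
      have "Lo d \<noteq> Up d" by (rule LoUp) (rule dd)
      moreover note cut[of d] dd
      ultimately show ?thesis unfolding Lo_def Up_def
        by (cases "P (of_int L * a - lin_comb V x d)") simp_all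
    qed
    show ?thesis
    proof (rule suff[of b])
      fix m c assume m: "\<bar>m\<bar> \<le> int N" and c: "\<And>k. k \<in> V \<Longrightarrow> \<bar>c k\<bar> \<le> int N"
      show "P (of_int m * a + lin_comb V x c) \<longleftrightarrow> Q (of_int m * b + lin_comb V y c)"
      proof (cases "m = 0")
        case True
        have "\<bar>c k\<bar> \<le> int M" if "k \<in> V" for k
          using c[OF that] bound[of "int N"] LLNN by linarith
        with True show ?thesis using pos[of c] by simp
      next
        case False
        \<comment> \<open>Scaling by \<open>L / \<bar>m\<bar>\<close> turns the coefficient of the
          new element into \<open>L\<close> or \<open>- L\<close>, for which the cut decides the
          sign.\<close>
        then have "nat \<bar>m\<bar> dvd fact N" using m by (intro dvd_fact) auto
        then have "int (nat \<bar>m\<bar>) dvd L" unfolding L_def by (simp only: int_dvd_int_iff)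
        then have "\<bar>m\<bar> dvd L" by (simp del: abs_dvd_iff)
        then obtain k where k: "L = k * \<bar>m\<bar>" by (metis dvd_def mult.commute)
        have k0: "k > 0" using k L1 False by (smt (verit) mult_nonpos_nonneg)
        have kL: "k \<le> L" using k False k0 by (simp add: mult_le_cancel_left1)
        define d where "d i = k * c i" for i
        have dd: "\<bar>d i\<bar> \<le> L * int N" "\<bar>- d i\<bar> \<le> L * int N" if "i \<in> V" for i
          using c[OF that] k0 kL L1 mult_mono[of k L "\<bar>c i\<bar>" "int N"] by (simp_all add: d_def abs_mult)
        have ex: "of_int k * (of_int m * a + lin_comb V x c) = of_int (k * m) * a + lin_comb V x d"
          unfolding d_def lin_comb_scale by (simp add: algebra_simps)
        have ey: "of_int k * (of_int m * b + lin_comb V y c) = of_int (k * m) * b + lin_comb V y d"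
          unfolding d_def lin_comb_scale by (simp add: algebra_simps)
        have "P (of_int (k * m) * a + lin_comb V x d) \<longleftrightarrow> Q (of_int (k * m) * b + lin_comb V y d)"
        proof (cases "m > 0")
          case True
          then have km: "k * m = L" using k by simp
          show ?thesis using signs[of "\<lambda>i. - d i", OF dd(2)] unfolding km lin_comb_minus by simp
        next
          case False
          then have km: "k * m = - L" using k by simp
          show ?thesis using signs[of d, OF dd(1)] unfolding km by simp
        qed
        then show ?thesis
          using A.pos_scale_iff[OF k0, of "of_int m * a + lin_comb V x c"]
            B.pos_scale_iff[OF k0, of "of_int m * b + lin_comb V y c"] unfolding ex ey by blast
      qed
    next
      fix m c
      have "of_int m * b + lin_comb V y c - (of_int m * b0 + lin_comb V y c) = of_int L * (of_int m * g)"
        unfolding b_def by (simp add: algebra_simps)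
      then have "B.dv L (of_int m * b + lin_comb V y c - (of_int m * b0 + lin_comb V y c))"
        by (simp only: B.dv_self)
      from B.dv_add_cancel[OF this] b0
      show "A.dv L (of_int m * a + lin_comb V x c) \<longleftrightarrow> B.dv L (of_int m * b + lin_comb V y c)"
        by blast
    qed
  qed
qed

end

section \<open>Interpretation of formulas in the group\<close>

context preordered_group
begin

lemma eq0_lin_comb:
  assumes "\<And>i. i \<in> V \<Longrightarrow> eq0 (x i - y i)"
  shows "eq0 (lin_comb V x c - lin_comb V y c)"
proof -
  have "eq0 (\<Sum>i\<in>W. of_int (c i) * (x i - y i))" if "W \<subseteq> V" for W
    using that
  proof (induction W rule: infinite_finite_induct)
    case (insert i W)
    then have "eq0 (of_int (c i) * (x i - y i))" using assms by (intro eq0_scale) auto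
    with insert show ?case by (auto intro: eq0_add)
  qed auto
  from this[of V] show ?thesis
    by (simp add: lin_comb_def sum_subtractf algebra_simps)
qed

text \<open>The gcd cancels by torsion-freeness, and what is left of \<open>m\<close> is invertible
  modulo what is left of \<open>n\<close>.\<close>

lemma dv_multiple_iff:
  assumes "n \<noteq> 0"
  shows "dv n (of_int m * x) \<longleftrightarrow> dv (n div gcd n m) x"
proof -
  define g where "g = gcd n m"
  define n' where "n' = n div g"
  define m' where "m' = m div g"
  have g: "g \<noteq> 0" using assms by (simp add: g_def)
  have n: "n = g * n'" and m: "m = g * m'" by (simp_all add: n'_def m'_def g_def)
  have "coprime n' m'"
    unfolding n'_def m'_def g_def using assms by (intro div_gcd_coprime) auto
  then obtain s t where st: "s * n' + t * m' = 1" using bezout_int[of n' m'] by auto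
  have "dv n (of_int m * x) \<longleftrightarrow> dv n' (of_int m' * x)"
    using dv_mult_iff[OF g, of n' "of_int m' * x"] by (simp add: n m mult.assoc)
  also have "\<dots> \<longleftrightarrow> dv n' x"
  proof
    assume *: "dv n' (of_int m' * x)"
    have "of_int t * (of_int m' * x) + of_int n' * (of_int s * x) = of_int (s * n' + t * m') * x"
      by (simp add: algebra_simps)
    also have "\<dots> = x" by (simp only: st of_int_1 mult_1_left)
    finally show "dv n' x" using dv_add[OF dv_scale[OF *, of t] dv_self] by metis
  qed (rule dv_scale)
  finally show ?thesis by (simp add: n'_def g_def)
qed

end

context preordered_group_pair
begin

lemma similar_mono:
  assumes "similar M W x y" "N \<le> M" "V \<subseteq> W" "finite W"
  shows "similar N V x y"
proof -
  have eqx: "lin_comb W x (\<lambda>i. if i \<in> V then c i else 0) = lin_comb V x c" for c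
    unfolding lin_comb_def using assms(3,4)
    by (intro sum.mono_neutral_cong_right) auto
  have eqy: "lin_comb W y (\<lambda>i. if i \<in> V then c i else 0) = lin_comb V y c" for c
    unfolding lin_comb_def using assms(3,4)
    by (intro sum.mono_neutral_cong_right) auto
  show ?thesis
    unfolding similar_def
  proof (intro conjI allI impI ballI)
    fix c :: "nat \<Rightarrow> int" assume c: "\<forall>i\<in>V. \<bar>c i\<bar> \<le> int N"
    have "P (lin_comb W x (\<lambda>i. if i \<in> V then c i else 0)) \<longleftrightarrow>
        Q (lin_comb W y (\<lambda>i. if i \<in> V then c i else 0))"
      using assms(1) unfolding similar_def
      by (elim conjE allE impE) (use c assms(2) in auto)
    then show "P (lin_comb V x c) \<longleftrightarrow> Q (lin_comb V y c)" by (simp only: eqx eqy)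
  next
    fix n c assume n: "n \<in> {1..int N}"
    have "A.dv n (lin_comb W x (\<lambda>i. if i \<in> V then c i else 0)) \<longleftrightarrow>
        B.dv n (lin_comb W y (\<lambda>i. if i \<in> V then c i else 0))"
      using assms(1,2) n unfolding similar_def by auto
    then show "A.dv n (lin_comb V x c) \<longleftrightarrow> B.dv n (lin_comb V y c)" by (simp only: eqx eqy)
  qed
qed

lemma similar_cong:
  assumes "similar N V x y" and "\<And>i. i \<in> V \<Longrightarrow> B.eq0 (y i - z i)"
  shows "similar N V x z"
  using assms(1) B.pos_cong[OF B.eq0_lin_comb, OF assms(2)] B.dv_cong[OF B.eq0_lin_comb, OF assms(2)]
  unfolding similar_def by simp

end

text \<open>All that the model theory uses of the Chang group: \<open>h\<close> identifies the
  algebra with the interval from 0 to \<open>u\<close>. Equations hold up to \<open>eq0\<close>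
  because the group is a quotient of \<open>'r\<close>, and the truncated sum is split by the one
  sign test that it contains.\<close>

locale mv_presentation = preordered_group P + mv_algebra A
  for P :: "'r::comm_ring_1 \<Rightarrow> bool" and A :: "'a mv" (structure) +
  fixes u :: 'r and h :: "'a \<Rightarrow> 'r"
  assumes unit_pos: "\<not> P (- u)"
    and unit_strong: "\<exists>n::nat. P (of_nat n * u - x)"
    and h_nonneg: "a \<in> carrier A \<Longrightarrow> P (h a)"
    and h_le_unit: "a \<in> carrier A \<Longrightarrow> P (u - h a)"
    and h_inj: "a \<in> carrier A \<Longrightarrow> b \<in> carrier A \<Longrightarrow> eq0 (h a - h b) \<Longrightarrow> a = b"
    and h_surj: "P x \<Longrightarrow> P (u - x) \<Longrightarrow> \<exists>a\<in>carrier A. eq0 (h a - x)"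
    and h_zero: "eq0 (h (mv_zero A))"
    and h_neg: "a \<in> carrier A \<Longrightarrow> eq0 (h (mv_neg A a) - (u - h a))"
    and h_plus: "a \<in> carrier A \<Longrightarrow> b \<in> carrier A \<Longrightarrow> P (u - (h a + h b))
      \<Longrightarrow> eq0 (h (a \<boxplus> b) - (h a + h b))"
    and h_plus_trunc: "a \<in> carrier A \<Longrightarrow> b \<in> carrier A \<Longrightarrow> \<not> P (u - (h a + h b))
      \<Longrightarrow> eq0 (h (a \<boxplus> b) - u)"
begin

text \<open>Variable \<open>0\<close> of a valuation in the group stands for the strong unit.\<close>

abbreviation lift :: "(nat \<Rightarrow> 'a) \<Rightarrow> nat \<Rightarrow> 'r" where
  "lift e \<equiv> case_nat u (\<lambda>i. h (e i))"

lemma lift_upd: "lift (e(i := a)) = (lift e)(Suc i := h a)"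
  by (auto simp: fun_eq_iff split: nat.split)

lemma h_eq_iff: "a \<in> carrier A \<Longrightarrow> b \<in> carrier A \<Longrightarrow> a = b \<longleftrightarrow> eq0 (h a - h b)"
  using h_inj by auto

lemma unit_nonneg: "P u"
  using not_pos[OF unit_pos] by simp

end

section \<open>Precision consumed by terms and formulas\<close>

lemma term_val_closed:
  assumes "mv_algebra A" "range e \<subseteq> carrier A"
  shows "mv_term_val A e t \<in> carrier A"
proof -
  interpret mv_algebra A by fact
  show ?thesis using assms(2)
    by (induction t) (auto intro: zero_closed neg_closed plus_closed)
qed

primrec term_weight :: "mv_term \<Rightarrow> nat" where
  "term_weight (Var i) = 1"
| "term_weight Zero = 1"
| "term_weight (Neg t) = term_weight t + 1"
| "term_weight (Plus s t) = term_weight s + term_weight t + 1"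

text \<open>A precision at which similar valuations agree on the formula. The clause for
  \<open>FEx\<close> is what \<open>extension_step\<close> asks for in order to return precision
  \<open>fm_weight p\<close>.\<close>

primrec fm_weight :: "mv_fm \<Rightarrow> nat" where
  "fm_weight (Eq s t) = term_weight s + term_weight t + 1"
| "fm_weight (FNot p) = fm_weight p"
| "fm_weight (FAnd p q) = max (fm_weight p) (fm_weight q)"
| "fm_weight (FEx i p) = 2 * fact (fm_weight p) * fact (fm_weight p) * fm_weight p * fm_weight p"

lemma fm_weight_pos: "fm_weight p \<ge> 1"
  by (induction p) auto

locale mv_presentation_pair = A: mv_presentation P A u h + B: mv_presentation Q B v k
  for P :: "'r::comm_ring_1 \<Rightarrow> bool" and A :: "'a mv" and u h
    and Q :: "'s::comm_ring_1 \<Rightarrow> bool" and B :: "'b mv" and v k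
begin

sublocale preordered_group_pair P Q ..

text \<open>Truncation makes a term piecewise linear only, but similar valuations fall into the same
  piece: each truncation is decided by the sign of a combination whose coefficients
  \<open>term_weight\<close> bounds. Hence one \<open>c\<close> serves both sides.\<close>

lemma term_val_lin_comb:
  assumes V: "finite V" "0 \<in> V" and sim: "similar N V (A.lift e) (B.lift d)"
    and e: "range e \<subseteq> carrier A" and d: "range d \<subseteq> carrier B"
    and t: "term_weight t \<le> N" "Suc ` mv_term_vars t \<subseteq> V"
  shows "\<exists>c. (\<forall>i. \<bar>c i\<bar> \<le> int (term_weight t)) \<and>
     A.eq0 (h (mv_term_val A e t) - lin_comb V (A.lift e) c) \<and>
     B.eq0 (k (mv_term_val B d t) - lin_comb V (B.lift d) c)"
  using t
proof (induction t)
  case (Var i)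
  then have "Suc i \<in> V" by simp
  note single = lin_comb_single[OF V(1) this, where k = 1]
  show ?case
    by (intro exI[of _ "\<lambda>j. if j = Suc i then 1 else 0"] conjI allI) (simp_all add: single)
next
  case Zero
  show ?case by (intro exI[of _ "\<lambda>j. 0"] conjI allI) (simp_all add: A.h_zero B.h_zero)
next
  case (Neg t)
  then obtain c where c: "\<And>i. \<bar>c i\<bar> \<le> int (term_weight t)"
    "A.eq0 (h (mv_term_val A e t) - lin_comb V (A.lift e) c)"
    "B.eq0 (k (mv_term_val B d t) - lin_comb V (B.lift d) c)" by auto
  note clA = term_val_closed[OF A.mv_algebra_axioms e, of t]
  note clB = term_val_closed[OF B.mv_algebra_axioms d, of t]
  show ?case
  proof (intro exI[of _ "\<lambda>j. (if j = 0 then 1 else 0) - c j"] conjI allI)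
    fix i show "\<bar>(if i = 0 then 1 else 0) - c i\<bar> \<le> int (term_weight (Neg t))"
      using c(1)[of i] by auto
  next
    show "A.eq0 (h (mv_term_val A e (Neg t)) - lin_comb V (A.lift e) (\<lambda>j. (if j = 0 then 1 else 0) - c j))"
      using A.eq0_diff[OF A.h_neg[OF clA] c(2)]
      by (simp add: lin_comb_diff lin_comb_single[OF V] algebra_simps)
    show "B.eq0 (k (mv_term_val B d (Neg t)) - lin_comb V (B.lift d) (\<lambda>j. (if j = 0 then 1 else 0) - c j))"
      using B.eq0_diff[OF B.h_neg[OF clB] c(3)]
      by (simp add: lin_comb_diff lin_comb_single[OF V] algebra_simps)
  qed
next
  case (Plus s t)
  obtain c where c: "\<And>i. \<bar>c i\<bar> \<le> int (term_weight s)"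
    "A.eq0 (h (mv_term_val A e s) - lin_comb V (A.lift e) c)"
    "B.eq0 (k (mv_term_val B d s) - lin_comb V (B.lift d) c)"
  proof -
    have "term_weight s \<le> N" "Suc ` mv_term_vars s \<subseteq> V" using Plus.prems by auto
    with Plus.IH(1) that show ?thesis by blast
  qed
  obtain c' where c': "\<And>i. \<bar>c' i\<bar> \<le> int (term_weight t)"
    "A.eq0 (h (mv_term_val A e t) - lin_comb V (A.lift e) c')"
    "B.eq0 (k (mv_term_val B d t) - lin_comb V (B.lift d) c')"
  proof -
    have "term_weight t \<le> N" "Suc ` mv_term_vars t \<subseteq> V" using Plus.prems by auto
    with Plus.IH(2) that show ?thesis by blast
  qed
  note clA = term_val_closed[OF A.mv_algebra_axioms e, of s] term_val_closed[OF A.mv_algebra_axioms e, of t]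
  note clB = term_val_closed[OF B.mv_algebra_axioms d, of s] term_val_closed[OF B.mv_algebra_axioms d, of t]
  \<comment> \<open>Represents the unit minus the untruncated sum. Its extra coefficient at the unit
    accounts for the \<open>+ 1\<close> in the weight of \<open>Plus\<close>.\<close>
  define r where "r = (\<lambda>j. (if j = 0 then 1 else 0) - (c j + c' j))"
  have abs: "\<bar>c i + c' i\<bar> \<le> int (term_weight s + term_weight t)" for i
    using c(1)[of i] c'(1)[of i] by auto
  have rb: "\<bar>r i\<bar> \<le> int N" for i
    using abs[of i] Plus.prems unfolding r_def by auto
  have PQ: "P (lin_comb V (A.lift e) r) \<longleftrightarrow> Q (lin_comb V (B.lift d) r)"
    using sim rb unfolding similar_def by blast
  have rA: "lin_comb V (A.lift e) r = u - (lin_comb V (A.lift e) c + lin_comb V (A.lift e) c')"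
    unfolding r_def by (simp add: lin_comb_diff lin_comb_add lin_comb_single[OF V])
  have rB: "lin_comb V (B.lift d) r = v - (lin_comb V (B.lift d) c + lin_comb V (B.lift d) c')"
    unfolding r_def by (simp add: lin_comb_diff lin_comb_add lin_comb_single[OF V])
  have sA: "A.eq0 (h (mv_term_val A e s) + h (mv_term_val A e t)
      - (lin_comb V (A.lift e) c + lin_comb V (A.lift e) c'))"
    using A.eq0_add[OF c(2) c'(2)] by (simp add: algebra_simps)
  have sB: "B.eq0 (k (mv_term_val B d s) + k (mv_term_val B d t)
      - (lin_comb V (B.lift d) c + lin_comb V (B.lift d) c'))"
    using B.eq0_add[OF c(3) c'(3)] by (simp add: algebra_simps)
  have A1: "P (u - (h (mv_term_val A e s) + h (mv_term_val A e t))) \<longleftrightarrow> P (lin_comb V (A.lift e) r)"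
    unfolding rA by (rule A.pos_cong) (use sA A.eq0_commute in \<open>simp add: algebra_simps\<close>)
  have B1: "Q (v - (k (mv_term_val B d s) + k (mv_term_val B d t))) \<longleftrightarrow> Q (lin_comb V (B.lift d) r)"
    unfolding rB by (rule B.pos_cong) (use sB B.eq0_commute in \<open>simp add: algebra_simps\<close>)
  show ?case
  proof (cases "P (lin_comb V (A.lift e) r)")
    case True
    have "A.eq0 (h (mv_term_val A e (Plus s t)) - lin_comb V (A.lift e) (\<lambda>j. c j + c' j))"
      using A.eq0_trans[OF A.h_plus[OF clA] sA] A1 True by (simp add: lin_comb_add)
    moreover have "B.eq0 (k (mv_term_val B d (Plus s t)) - lin_comb V (B.lift d) (\<lambda>j. c j + c' j))"
      using B.eq0_trans[OF B.h_plus[OF clB] sB] B1 PQ True by (simp add: lin_comb_add)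
    moreover have "\<forall>i. \<bar>c i + c' i\<bar> \<le> int (term_weight (Plus s t))"
    proof
      fix i show "\<bar>c i + c' i\<bar> \<le> int (term_weight (Plus s t))" using abs[of i] by simp
    qed
    ultimately show ?thesis by (intro exI[of _ "\<lambda>j. c j + c' j"] conjI)
  next
    case False
    have "A.eq0 (h (mv_term_val A e (Plus s t)) - u)"
      using A.h_plus_trunc[OF clA] A1 False by simp
    moreover have "B.eq0 (k (mv_term_val B d (Plus s t)) - v)"
      using B.h_plus_trunc[OF clB] B1 PQ False by simp
    ultimately show ?thesis
      by (intro exI[of _ "\<lambda>j. if j = 0 then 1 else 0"] conjI allI)
        (simp_all add: lin_comb_single[OF V] del: mv_term_val.simps)
  qed
qed

end

locale regular_mv_presentation_pair = mv_presentation_pair P A u h Q B v k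
  for P :: "'r::comm_ring_1 \<Rightarrow> bool" and A :: "'a mv" and u h
    and Q :: "'s::comm_ring_1 \<Rightarrow> bool" and B :: "'b mv" and v k +
  assumes dense_A: "A.regularly_dense" and dense_B: "B.regularly_dense"
    and inc: "prime p \<Longrightarrow> A.incongruent_family p n \<longleftrightarrow> B.incongruent_family p n"
begin

text \<open>The partner found in the group is automatically in the interval: its lying above 0 and
  below the unit are sign conditions with coefficients at most 1.\<close>

lemma extension_step_interval:
  assumes V: "finite V" "0 \<in> V" and N: "N \<ge> 1"
    and sim: "similar (2 * fact N * fact N * N * N) V (A.lift e) (B.lift d)"
    and a: "a \<in> carrier A"
  shows "\<exists>b\<in>carrier B. similar N (insert (Suc i) V) (A.lift (e(i := a))) (B.lift (d(i := b)))"
proof -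
  let ?M = "2 * fact N * fact N * N * N" and ?V = "V - {Suc i}"
  \<comment> \<open>The variable may already have a value, which is forgotten before it receives the
    new one.\<close>
  have sim0: "similar ?M ?V (A.lift e) (B.lift d)"
    by (rule similar_mono[OF sim]) (use V in auto)
  define W where "W = insert (Suc i) ?V"
  obtain z where z: "similar N W ((A.lift e)(Suc i := h a)) ((B.lift d)(Suc i := z))"
    using extension_step[OF _ _ N _ inc dense_B B.unit_pos, of ?V "Suc i"] V(1) sim0 unfolding W_def by fastforce
  have 0: "0 \<in> W" "Suc i \<in> W" "finite W" using V by (auto simp: W_def)
  let ?c = "\<lambda>j. if j = Suc i then 1 else (0::int)"
  let ?d = "\<lambda>j. (if j = 0 then 1 else 0) - (if j = Suc i then 1 else (0::int))"
  have "P (lin_comb W ((A.lift e)(Suc i := h a)) ?c) \<longleftrightarrow>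
      Q (lin_comb W ((B.lift d)(Suc i := z)) ?c)"
    using z N unfolding similar_def by auto
  then have 1: "Q z" using A.h_nonneg[OF a] by (simp add: lin_comb_single[OF 0(3,2)])
  have "P (lin_comb W ((A.lift e)(Suc i := h a)) ?d) \<longleftrightarrow>
      Q (lin_comb W ((B.lift d)(Suc i := z)) ?d)"
    using z N unfolding similar_def by auto
  then have 2: "Q (v - z)" using A.h_le_unit[OF a]
    by (simp add: lin_comb_diff lin_comb_single[OF 0(3,2)] lin_comb_single[OF 0(3,1)])
  obtain b where b: "b \<in> carrier B" "B.eq0 (k b - z)" using B.h_surj[OF 1 2] by blast
  have "similar N W ((A.lift e)(Suc i := h a)) ((B.lift d)(Suc i := k b))"
    by (rule similar_cong[OF z]) (use b(2) B.eq0_commute in auto)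
  moreover have "W = insert (Suc i) V" by (auto simp: W_def)
  ultimately show ?thesis using b(1) by (intro bexI[of _ b]) (simp_all only: A.lift_upd B.lift_upd)
qed

lemma sat_transfer:
  assumes "finite V" "0 \<in> V" and "similar N V (A.lift e) (B.lift d)"
    and "range e \<subseteq> carrier A" and "range d \<subseteq> carrier B"
    and "fm_weight f \<le> N" "Suc ` mv_fm_free f \<subseteq> V"
  shows "mv_sat A e f \<longleftrightarrow> mv_sat B d f"
  using assms
proof (induction f arbitrary: N V e d)
  case (Eq s t)
  then have st: "term_weight s \<le> N" "Suc ` mv_term_vars s \<subseteq> V" "term_weight t \<le> N" "Suc ` mv_term_vars t \<subseteq> V"
    by auto
  note V = Eq.prems(1,2) and sim = Eq.prems(3) and e = Eq.prems(4) and d = Eq.prems(5)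
  obtain c where c: "\<And>i. \<bar>c i\<bar> \<le> int (term_weight s)"
    "A.eq0 (h (mv_term_val A e s) - lin_comb V (A.lift e) c)"
    "B.eq0 (k (mv_term_val B d s) - lin_comb V (B.lift d) c)"
    using term_val_lin_comb[OF V sim e d st(1,2)] by blast
  obtain c' where c': "\<And>i. \<bar>c' i\<bar> \<le> int (term_weight t)"
    "A.eq0 (h (mv_term_val A e t) - lin_comb V (A.lift e) c')"
    "B.eq0 (k (mv_term_val B d t) - lin_comb V (B.lift d) c')"
    using term_val_lin_comb[OF V sim e d st(3,4)] by blast
  have b: "\<bar>c i - c' i\<bar> \<le> int N" "\<bar>c' i - c i\<bar> \<le> int N" for i
    using c(1)[of i] c'(1)[of i] Eq.prems(6) by auto
  have pos: "P (lin_comb V (A.lift e) r) \<longleftrightarrow> Q (lin_comb V (B.lift d) r)"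
    if "\<And>i. \<bar>r i\<bar> \<le> int N" for r
    using sim that unfolding similar_def by blast
  have "A.eq0 (lin_comb V (A.lift e) (\<lambda>i. c i - c' i)) \<longleftrightarrow> B.eq0 (lin_comb V (B.lift d) (\<lambda>i. c i - c' i))"
    unfolding A.eq0_def B.eq0_def lin_comb_minus[symmetric] using pos b by simp
  moreover have "A.eq0 (h (mv_term_val A e s) - h (mv_term_val A e t)) \<longleftrightarrow>
      A.eq0 (lin_comb V (A.lift e) (\<lambda>i. c i - c' i))"
    by (rule A.eq0_cong) (use A.eq0_diff[OF c(2) c'(2)] in \<open>simp add: lin_comb_diff algebra_simps\<close>)
  moreover have "B.eq0 (k (mv_term_val B d s) - k (mv_term_val B d t)) \<longleftrightarrow>
      B.eq0 (lin_comb V (B.lift d) (\<lambda>i. c i - c' i))"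
    by (rule B.eq0_cong) (use B.eq0_diff[OF c(3) c'(3)] in \<open>simp add: lin_comb_diff algebra_simps\<close>)
  ultimately show ?case
    using A.h_eq_iff B.h_eq_iff term_val_closed[OF A.mv_algebra_axioms e] term_val_closed[OF B.mv_algebra_axioms d]
    by simp
next
  case (FNot f)
  have "mv_sat A e f \<longleftrightarrow> mv_sat B d f" by (rule FNot.IH[OF FNot.prems(1-5)]) (use FNot.prems in auto)
  then show ?case by simp
next
  case (FAnd f g)
  have "mv_sat A e f \<longleftrightarrow> mv_sat B d f" by (rule FAnd.IH(1)[OF FAnd.prems(1-5)]) (use FAnd.prems in auto)
  moreover have "mv_sat A e g \<longleftrightarrow> mv_sat B d g" by (rule FAnd.IH(2)[OF FAnd.prems(1-5)]) (use FAnd.prems in auto)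
  ultimately show ?case by simp
next
  case (FEx i f)
  \<comment> \<open>For the return direction of the back-and-forth the two algebras exchange their
    roles.\<close>
  interpret flip: preordered_group_pair Q P ..
  interpret flip: mv_presentation_pair Q B v k P A u h ..
  interpret flip: regular_mv_presentation_pair Q B v k P A u h
    by unfold_locales (use dense_A dense_B inc in auto)
  have flip: "flip.similar K W y x \<longleftrightarrow> similar K W x y" for K W x y
    unfolding flip.similar_def similar_def by auto
  let ?N = "fm_weight f"
  let ?M = "2 * fact ?N * fact ?N * ?N * ?N"
  note V = FEx.prems(1,2)
  have sim: "similar ?M V (A.lift e) (B.lift d)"
    by (rule similar_mono[OF FEx.prems(3)]) (use FEx.prems in auto)
  have IH: "mv_sat A (e(i := a)) f \<longleftrightarrow> mv_sat B (d(i := b)) f"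
    if "a \<in> carrier A" "b \<in> carrier B"
      "similar ?N (insert (Suc i) V) (A.lift (e(i := a))) (B.lift (d(i := b)))" for a b
    by (rule FEx.IH[OF _ _ that(3)]) (use FEx.prems that in auto)
  show ?case
  proof
    assume "mv_sat A e (FEx i f)"
    then obtain a where a: "a \<in> carrier A" "mv_sat A (e(i := a)) f" by auto
    obtain b where "b \<in> carrier B" "similar ?N (insert (Suc i) V) (A.lift (e(i := a))) (B.lift (d(i := b)))"
      using extension_step_interval[OF V fm_weight_pos sim a(1)] by blast
    with IH a show "mv_sat B d (FEx i f)" by auto
  next
    assume "mv_sat B d (FEx i f)"
    then obtain b where b: "b \<in> carrier B" "mv_sat B (d(i := b)) f" by auto
    obtain a where "a \<in> carrier A" "similar ?N (insert (Suc i) V) (A.lift (e(i := a))) (B.lift (d(i := b)))"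
      using flip.extension_step_interval[OF V fm_weight_pos sim[folded flip] b(1)] unfolding flip by blast
    with IH b show "mv_sat A e (FEx i f)" by auto
  qed
qed

text \<open>A sentence starts from the tuple that consists of the unit alone. The signs of its
  multiples are forced, and divisibility of \<open>m * u\<close> reduces to divisibility of
  \<open>u\<close> by \<open>dv_multiple_iff\<close>.\<close>

lemma elem_equiv_of_unit:
  assumes div: "\<And>n. n \<ge> 1 \<Longrightarrow> A.dv n u \<longleftrightarrow> B.dv n v"
  shows "mv_elem_equiv A B"
proof -
  have pu: "P (of_int m * u) \<longleftrightarrow> m \<ge> 0" for m
    using A.pos_scale[OF A.unit_nonneg, of m] A.pos_scale_iff[of "-m" "-u"] A.unit_pos by force
  have qv: "Q (of_int m * v) \<longleftrightarrow> m \<ge> 0" for m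
    using B.pos_scale[OF B.unit_nonneg, of m] B.pos_scale_iff[of "-m" "-v"] B.unit_pos by force
  have dvm: "A.dv n (of_int m * u) \<longleftrightarrow> B.dv n (of_int m * v)" if "n \<ge> 1" for n m
  proof -
    have "gcd n m dvd n" "gcd n m > 0" using that by auto
    then have "n div gcd n m \<ge> 1" using that by (metis dvd_div_mult_self linorder_not_less
        mult_nonpos_nonneg order.strict_implies_order order_trans zero_less_one zless_imp_add1_zle
        add_0 linorder_le_less_linear mult_eq_0_iff not_one_le_zero)
    then show ?thesis using A.dv_multiple_iff[of n m u] B.dv_multiple_iff[of n m v] that div by simp
  qed
  have sat: "mv_sat A e f \<longleftrightarrow> mv_sat B d f"
    if "mv_fm_free f = {}" "range e \<subseteq> carrier A" "range d \<subseteq> carrier B" for f e d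
  proof (rule sat_transfer[of "{0}" "fm_weight f"])
    show "similar (fm_weight f) {0} (A.lift e) (B.lift d)"
      unfolding similar_def by (auto simp: lin_comb_def pu qv dvm)
  qed (use that in auto)
  \<comment> \<open>\<open>mv_models\<close> speaks of all valuations; with none at all it would
    hold vacuously.\<close>
  have ne: "range (\<lambda>_. mv_zero A) \<subseteq> carrier A" "range (\<lambda>_. mv_zero B) \<subseteq> carrier B"
    using A.zero_closed B.zero_closed by auto
  show ?thesis
    unfolding mv_elem_equiv_def mv_models_def using sat ne by blast
qed

end

section \<open>Free presentations of groups\<close>

text \<open>Polynomials with integer coefficients whose variables are the elements of the group, evaluated
  on their linear part only: they present a commutative group by a type of a ring class.\<close>

type_synonym 'g free_ring = "'g multiset \<Rightarrow>\<^sub>0 int"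

abbreviation linear_coeff :: "'g free_ring \<Rightarrow> 'g \<Rightarrow> int" where
  "linear_coeff x g \<equiv> Poly_Mapping.lookup x {#g#}"

definition gen :: "'g \<Rightarrow> 'g free_ring" where
  "gen g = Poly_Mapping.single {#g#} 1"

definition eval_linear :: "('g, 'c) monoid_scheme \<Rightarrow> 'g free_ring \<Rightarrow> 'g" where
  "eval_linear G x = finprod G (\<lambda>g. g [^]\<^bsub>G\<^esub> linear_coeff x g) {g \<in> carrier G. linear_coeff x g \<noteq> 0}"

context comm_group
begin

lemma finite_linear_support: "finite {g \<in> carrier G. linear_coeff x g \<noteq> 0}"
proof -
  have "finite ((\<lambda>g. {#g#}) -` {m. Poly_Mapping.lookup x m \<noteq> 0})"
    by (intro finite_vimageI) (auto simp: inj_def)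
  then show ?thesis by (rule rev_finite_subset) auto
qed

lemma eval_linear_superset:
  assumes "finite S" "S \<subseteq> carrier G" "{g \<in> carrier G. linear_coeff x g \<noteq> 0} \<subseteq> S"
  shows "eval_linear G x = finprod G (\<lambda>g. g [^] linear_coeff x g) S"
  unfolding eval_linear_def
  by (rule finprod_mono_neutral_cong_left) (use assms in \<open>auto simp: subset_iff\<close>)

lemma eval_linear_closed [simp]: "eval_linear G x \<in> carrier G"
  unfolding eval_linear_def by (rule finprod_closed) auto

lemma eval_linear_add: "eval_linear G (x + y) = eval_linear G x \<otimes> eval_linear G y"
proof -
  let ?S = "{g \<in> carrier G. linear_coeff x g \<noteq> 0} \<union> {g \<in> carrier G. linear_coeff y g \<noteq> 0}"
  have fin: "finite ?S" using finite_linear_support by blast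
  have "eval_linear G (x + y) = finprod G (\<lambda>g. g [^] linear_coeff (x + y) g) ?S"
    by (rule eval_linear_superset[OF fin]) (auto simp: lookup_add)
  also have "\<dots> = finprod G (\<lambda>g. g [^] linear_coeff x g \<otimes> g [^] linear_coeff y g) ?S"
    by (rule finprod_cong') (auto simp: lookup_add int_pow_mult)
  also have "\<dots> = finprod G (\<lambda>g. g [^] linear_coeff x g) ?S \<otimes> finprod G (\<lambda>g. g [^] linear_coeff y g) ?S"
    by (rule finprod_multf) auto
  also have "\<dots> = eval_linear G x \<otimes> eval_linear G y"
    using eval_linear_superset[OF fin, of x] eval_linear_superset[OF fin, of y] by auto
  finally show ?thesis .
qed

lemma eval_linear_gen: assumes "g \<in> carrier G" shows "eval_linear G (gen g) = g"
proof -
  have "{f \<in> carrier G. linear_coeff (gen g) f \<noteq> 0} = {g}"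
    using assms by (auto simp: gen_def lookup_single when_def)
  then show ?thesis using assms by (simp add: eval_linear_def gen_def)
qed

lemma eval_linear_0 [simp]: "eval_linear G 0 = \<one>"
  by (simp add: eval_linear_def)

lemma eval_linear_minus: "eval_linear G (- x) = inv (eval_linear G x)"
proof -
  have "eval_linear G (- x) \<otimes> eval_linear G x = \<one>"
    by (simp flip: eval_linear_add)
  then show ?thesis using inv_equality by simp
qed

lemma eval_linear_diff: "eval_linear G (x - y) = eval_linear G x \<otimes> inv (eval_linear G y)"
  using eval_linear_add[of x "-y"] by (simp add: eval_linear_minus)

lemma eval_linear_of_nat: "eval_linear G (of_nat n * x) = eval_linear G x [^] n"
  by (induction n) (simp_all add: algebra_simps eval_linear_add m_comm)

end

section \<open>Ordered groups as cones on their free presentations\<close>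

definition group_cone :: "'g ordered_group \<Rightarrow> 'g free_ring \<Rightarrow> bool" where
  "group_cone G x \<longleftrightarrow> (\<one>\<^bsub>G\<^esub>, eval_linear G x) \<in> order_rel G"

context linordered_comm_group
begin

lemma order_refl: "x \<in> carrier G \<Longrightarrow> (x, x) \<in> order_rel G"
  using linear_order by (simp add: order_on_defs refl_on_def)

lemma order_trans: "(x, y) \<in> order_rel G \<Longrightarrow> (y, z) \<in> order_rel G \<Longrightarrow> (x, z) \<in> order_rel G"
  using linear_order by (auto simp: order_on_defs dest: transD)

lemma order_antisym: "(x, y) \<in> order_rel G \<Longrightarrow> (y, x) \<in> order_rel G \<Longrightarrow> x = y"
  using linear_order by (auto simp: order_on_defs dest: antisymD)

lemma order_closed:
  "(x, y) \<in> order_rel G \<Longrightarrow> x \<in> carrier G" "(x, y) \<in> order_rel G \<Longrightarrow> y \<in> carrier G"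
  using linear_order by (auto simp: order_on_defs)

lemma order_total:
  "x \<in> carrier G \<Longrightarrow> y \<in> carrier G \<Longrightarrow> (x, y) \<in> order_rel G \<or> (y, x) \<in> order_rel G"
  using linear_order order_refl by (cases "x = y") (auto simp: order_on_defs total_on_def)

lemma order_iff_diff:
  assumes "x \<in> carrier G" "y \<in> carrier G"
  shows "(x, y) \<in> order_rel G \<longleftrightarrow> (\<one>, y \<otimes> inv x) \<in> order_rel G"
  using translate[of x y "inv x"] translate[of \<one> "y \<otimes> inv x" x] assms by (auto simp: m_assoc)

lemma group_cone_diff:
  "group_cone G (x - y) \<longleftrightarrow> (eval_linear G y, eval_linear G x) \<in> order_rel G"
  using order_iff_diff[of "eval_linear G y" "eval_linear G x"]
  by (simp add: group_cone_def eval_linear_diff)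

lemma preordered_group_cone: "preordered_group (group_cone G)"
proof
  fix x y assume xy: "group_cone G x" "group_cone G y"
  have "(\<one> \<otimes> eval_linear G y, eval_linear G x \<otimes> eval_linear G y) \<in> order_rel G"
    using translate[OF xy(1)[unfolded group_cone_def], of "eval_linear G y"] by simp
  then show "group_cone G (x + y)"
    using xy(2) order_trans by (simp add: group_cone_def eval_linear_add)
next
  fix x show "group_cone G x \<or> group_cone G (- x)"
    using group_cone_diff[of 0 x] group_cone_diff[of x 0] order_total[of \<one> "eval_linear G x"] by auto
qed

lemma eq0_group_cone: "preordered_group.eq0 (group_cone G) x \<longleftrightarrow> eval_linear G x = \<one>"
proof -
  interpret C: preordered_group "group_cone G" by (rule preordered_group_cone)
  show ?thesis
    using group_cone_diff[of 0 x] group_cone_diff[of x 0] order_antisym order_refl[of \<one>]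
    unfolding C.eq0_def by auto
qed

lemma eq0_group_cone_diff:
  "preordered_group.eq0 (group_cone G) (x - y) \<longleftrightarrow> eval_linear G x = eval_linear G y"
  by (simp add: eq0_group_cone eval_linear_diff)
    (metis eval_linear_closed inv_closed inv_equality inv_inv r_inv)

lemma dv_group_cone_diff:
  "preordered_group.dv (group_cone G) (int p) (x - y) \<longleftrightarrow>
     p_congruent p G (eval_linear G x) (eval_linear G y)"
proof -
  interpret C: preordered_group "group_cone G" by (rule preordered_group_cone)
  have "C.dv (int p) (x - y) \<longleftrightarrow> (\<exists>z. eval_linear G (x - y) = eval_linear G z [^] p)"
    unfolding C.dv_def by (simp add: eq0_group_cone_diff eval_linear_of_nat)
  also have "\<dots> \<longleftrightarrow> (\<exists>z\<in>carrier G. eval_linear G (x - y) = z [^] p)"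
    using eval_linear_gen eval_linear_closed by metis
  finally show ?thesis by (simp add: p_congruent_def eval_linear_diff)
qed

lemma p_congruent_refl: assumes "x \<in> carrier G" shows "p_congruent p G x x"
  unfolding p_congruent_def by (rule bexI[of _ \<one>]) (use assms in auto)

text \<open>The supremum need not be attained. However, without a family of size \<open>n\<close>
  monotonicity bounds every family, and thus the supremum, by \<open>n - 1\<close>.\<close>

lemma incongruent_family_iff_zakon:
  "preordered_group.incongruent_family (group_cone G) (int p) n \<longleftrightarrow> enat n \<le> zakon p G"
proof -
  interpret C: preordered_group "group_cone G" by (rule preordered_group_cone)
  define W where "W = {S. S \<subseteq> carrier G \<and> finite S \<and>
       (\<forall>x\<in>S. \<forall>y\<in>S. x \<noteq> y \<longrightarrow> \<not> p_congruent p G x y)}"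
  have zakon: "zakon p G = (SUP S\<in>W. enat (card S))" unfolding zakon_def W_def ..
  have card: "C.incongruent_family (int p) (card S)" if S: "S \<in> W" for S
  proof -
    have "finite S" using S unfolding W_def by auto
    then obtain f where f: "bij_betw f {..<card S} S"
      using ex_bij_betw_nat_finite[of S] by (auto simp: atLeast0LessThan)
    have cl: "f i \<in> carrier G" "f i \<in> S" if "i < card S" for i
      using f S that unfolding W_def bij_betw_def by auto
    have "\<not> C.dv (int p) (gen (f i) - gen (f j))" if "i < card S" "j < card S" "i \<noteq> j" for i j
    proof -
      have "f i \<noteq> f j" using f that by (auto simp: bij_betw_def inj_on_def)
      then have "\<not> p_congruent p G (f i) (f j)" using S cl that unfolding W_def by auto
      then show ?thesis by (simp add: dv_group_cone_diff eval_linear_gen cl that)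
    qed
    then show ?thesis unfolding C.incongruent_family_def
      by (intro exI[of _ "\<lambda>i. gen (f i)"]) blast
  qed
  have family: "\<exists>S\<in>W. card S = n" if "C.incongruent_family (int p) n" for n
  proof -
    obtain x where x: "\<And>i j. i < n \<Longrightarrow> j < n \<Longrightarrow> i \<noteq> j \<Longrightarrow> \<not> C.dv (int p) (x i - x j)"
      using \<open>C.incongruent_family (int p) n\<close> unfolding C.incongruent_family_def by blast
    let ?y = "\<lambda>i. eval_linear G (x i)"
    have y: "\<not> p_congruent p G (?y i) (?y j)" if "i < n" "j < n" "i \<noteq> j" for i j
      using x[OF that] by (simp add: dv_group_cone_diff)
    then have "inj_on ?y {..<n}"
      by (intro inj_onI) (metis eval_linear_closed lessThan_iff p_congruent_refl)
    then have "card (?y ` {..<n}) = n" by (simp add: card_image)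
    moreover have "?y ` {..<n} \<in> W" unfolding W_def using y by auto
    ultimately show ?thesis by blast
  qed
  show ?thesis
  proof
    assume "C.incongruent_family (int p) n"
    then obtain S where "S \<in> W" "card S = n" using family by blast
    then show "enat n \<le> zakon p G" unfolding zakon by (metis SUP_upper)
  next
    assume n: "enat n \<le> zakon p G"
    show "C.incongruent_family (int p) n"
    proof (rule ccontr)
      assume not: "\<not> ?thesis"
      then have "n > 0" by (cases n) (auto simp: C.incongruent_family_def)
      have "card S \<le> n - 1" if "S \<in> W" for S
        using card[OF that] C.incongruent_family_mono[of "int p" "card S" n] not by force
      then have "zakon p G \<le> enat (n - 1)" unfolding zakon by (intro SUP_least) simp
      with n have "enat n \<le> enat (n - 1)" by (rule order.trans)
      with \<open>n > 0\<close> show False by simp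
    qed
  qed
qed

end

text \<open>An extended natural number is determined by the natural numbers below it.\<close>

lemma zakon_eq_iff:
  assumes "linordered_comm_group G" "linordered_comm_group H"
  shows "zakon p G = zakon p H \<longleftrightarrow> (\<forall>n. preordered_group.incongruent_family (group_cone G) (int p) n \<longleftrightarrow>
     preordered_group.incongruent_family (group_cone H) (int p) n)"
proof -
  have le: "w \<le> w'" if "\<forall>n. enat n \<le> w \<longrightarrow> enat n \<le> w'" for w w' :: enat
  proof (cases w)
    case (enat m) then show ?thesis using that by auto
  next
    case infinity
    then have "enat n \<le> w'" for n using that by simp
    then show ?thesis by (cases w') (use not_less_eq_eq in auto)
  qed
  have "zakon p G = zakon p H \<longleftrightarrow> (\<forall>n. enat n \<le> zakon p G \<longleftrightarrow> enat n \<le> zakon p H)"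
    using le[of "zakon p G" "zakon p H"] le[of "zakon p H" "zakon p G"] by (auto intro: order.antisym)
  then show ?thesis
    by (simp only: linordered_comm_group.incongruent_family_iff_zakon[OF assms(1)]
        linordered_comm_group.incongruent_family_iff_zakon[OF assms(2)])
qed

text \<open>Any copy of the Chang group will do, so this serves the groups given in the
  classification, the concrete group \<open>chang\<close> and the real models alike.\<close>

lemma mv_presentation_of_chang_group:
  assumes A: "mv_chain A" and ch: "chang_group A G u"
  shows "\<exists>h. mv_presentation (group_cone G) A (gen u) h"
proof -
  interpret A: mv_chain A by fact
  interpret G: linordered_comm_group G using ch by (simp add: chang_group_def)
  interpret C: preordered_group "group_cone G" by (rule G.preordered_group_cone)
  have su: "(\<one>\<^bsub>G\<^esub>, u) \<in> order_rel G" "\<And>x. x \<in> carrier G \<Longrightarrow> \<exists>n::nat. (x, u [^]\<^bsub>G\<^esub> n) \<in> order_rel G"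
    using ch by (auto simp: chang_group_def strong_unit_def)
  have u: "u \<in> carrier G" using su(1) by (rule G.order_closed)
  obtain f where f: "f \<in> mv_hom A (interval_mv G u)" "bij_betw f (carrier A) (carrier (interval_mv G u))"
    using ch by (auto simp: chang_group_def mv_isomorphic_def)
  have fc: "f a \<in> carrier G" "(\<one>\<^bsub>G\<^esub>, f a) \<in> order_rel G" "(f a, u) \<in> order_rel G" if "a \<in> carrier A" for a
    using f(2) that unfolding bij_betw_def interval_mv_def by auto
  have f0: "f (mv_zero A) = \<one>\<^bsub>G\<^esub>"
    and fneg: "\<And>a. a \<in> carrier A \<Longrightarrow> f (mv_neg A a) = u \<otimes>\<^bsub>G\<^esub> inv\<^bsub>G\<^esub> f a"
    and fplus: "\<And>a b. a \<in> carrier A \<Longrightarrow> b \<in> carrier A \<Longrightarrow> f (a \<boxplus>\<^bsub>A\<^esub> b) =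
      (if (f a \<otimes>\<^bsub>G\<^esub> f b, u) \<in> order_rel G then f a \<otimes>\<^bsub>G\<^esub> f b else u)"
    using f(1) by (auto simp: mv_hom_def interval_mv_def)
  have inj: "inj_on f (carrier A)" using f(2) by (simp add: bij_betw_def)
  have "u \<noteq> \<one>\<^bsub>G\<^esub>"
  proof
    assume "u = \<one>\<^bsub>G\<^esub>"
    then have "f (mv_one A) = f (mv_zero A)"
      unfolding mv_one_def by (simp add: fneg A.zero_closed f0)
    then show False using inj A.nontrivial A.zero_closed A.neg_closed
      by (metis inj_onD mv_one_def)
  qed
  note ev = G.eval_linear_gen G.eval_linear_minus G.eval_linear_diff G.eval_linear_add G.eval_linear_of_nat
  have trunc: "group_cone G (gen u - (gen (f a) + gen (f b))) \<longleftrightarrow> (f a \<otimes>\<^bsub>G\<^esub> f b, u) \<in> order_rel G"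
    if "a \<in> carrier A" "b \<in> carrier A" for a b
    unfolding G.group_cone_diff by (simp add: ev fc that u)
  have "mv_presentation (group_cone G) A (gen u) (\<lambda>a. gen (f a))"
  proof
    show "\<not> group_cone G (- gen u)"
      using G.group_cone_diff[of 0 "gen u"] G.order_antisym[OF su(1)] \<open>u \<noteq> \<one>\<^bsub>G\<^esub>\<close> by (auto simp: ev u)
    show "\<exists>n::nat. group_cone G (of_nat n * gen u - x)" for x
      unfolding G.group_cone_diff using su(2)[of "eval_linear G x"] by (simp add: ev u)
    show "group_cone G (gen (f a))" if "a \<in> carrier A" for a
      using fc[OF that] by (simp add: group_cone_def ev)
    show "group_cone G (gen u - gen (f a))" if "a \<in> carrier A" for a
      unfolding G.group_cone_diff using fc[OF that] u by (simp add: ev)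
    show "a = b" if "a \<in> carrier A" "b \<in> carrier A" "C.eq0 (gen (f a) - gen (f b))" for a b
      using that inj fc unfolding G.eq0_group_cone_diff by (simp add: ev inj_on_def)
    show "\<exists>a\<in>carrier A. C.eq0 (gen (f a) - x)" if x: "group_cone G x" "group_cone G (gen u - x)" for x
    proof -
      have "eval_linear G x \<in> carrier (interval_mv G u)"
        using x u unfolding G.group_cone_diff by (simp add: group_cone_def interval_mv_def ev)
      then obtain a where "a \<in> carrier A" "f a = eval_linear G x"
        using f(2) unfolding bij_betw_def by (metis imageE)
      then show ?thesis by (intro bexI[of _ a]) (auto simp: G.eq0_group_cone_diff ev)
    qed
    show "C.eq0 (gen (f (mv_zero A)))" by (simp add: f0 G.eq0_group_cone ev)
    show "C.eq0 (gen (f (mv_neg A a)) - (gen u - gen (f a)))" if "a \<in> carrier A" for a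
      unfolding G.eq0_group_cone_diff using fc[OF that] u that by (simp add: ev fneg)
    show "C.eq0 (gen (f (a \<boxplus>\<^bsub>A\<^esub> b)) - (gen (f a) + gen (f b)))"
      if "a \<in> carrier A" "b \<in> carrier A" "group_cone G (gen u - (gen (f a) + gen (f b)))" for a b
      using that(3) unfolding G.eq0_group_cone_diff trunc[OF that(1,2)] fplus[OF that(1,2)]
      by (simp add: ev fc that)
    show "C.eq0 (gen (f (a \<boxplus>\<^bsub>A\<^esub> b)) - gen u)"
      if "a \<in> carrier A" "b \<in> carrier A" "\<not> group_cone G (gen u - (gen (f a) + gen (f b)))" for a b
      using that(3) unfolding G.eq0_group_cone_diff trunc[OF that(1,2)] fplus[OF that(1,2)] by simp
  qed
  then show ?thesis by blast
qed

section \<open>The Chang group of a chain\<close>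

context mv_algebra
begin

abbreviation zro ("\<zero>\<^sub>m") where "\<zero>\<^sub>m \<equiv> mv_zero A"
abbreviation uno ("\<one>\<^sub>m") where "\<one>\<^sub>m \<equiv> mv_one A"
abbreviation neg ("\<sim>_" [90] 90) where "\<sim>x \<equiv> mv_neg A x"
abbreviation le (infix "\<preceq>" 50) where "x \<preceq> y \<equiv> mv_le A x y"

lemma one_closed: "\<one>\<^sub>m \<in> carrier A"
  by (simp add: mv_one_def neg_closed zero_closed)

lemma odot_closed: "x \<in> carrier A \<Longrightarrow> y \<in> carrier A \<Longrightarrow> x \<boxdot> y \<in> carrier A"
  by (simp add: mv_odot_def neg_closed plus_closed)

lemmas closed = zero_closed one_closed neg_closed plus_closed odot_closed

lemma neg_zero: "\<sim>\<zero>\<^sub>m = \<one>\<^sub>m" and neg_one: "\<sim>\<one>\<^sub>m = \<zero>\<^sub>m"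
  by (simp_all add: mv_one_def neg_neg zero_closed)

lemma plus_one_right: "x \<in> carrier A \<Longrightarrow> x \<boxplus> \<one>\<^sub>m = \<one>\<^sub>m"
  using plus_one by (simp add: mv_one_def)

lemma plus_one_left: "x \<in> carrier A \<Longrightarrow> \<one>\<^sub>m \<boxplus> x = \<one>\<^sub>m"
  using plus_one_right plus_commute[OF one_closed] by simp

lemma plus_zero_left: "x \<in> carrier A \<Longrightarrow> \<zero>\<^sub>m \<boxplus> x = x"
  using plus_zero plus_commute[OF zero_closed] by simp

text \<open>The axiom \<open>lukasiewicz\<close> with \<open>y = 1\<close>: one side collapses to 1,
  the other to \<open>\<sim>x \<boxplus> x\<close>.\<close>

lemma neg_plus: assumes "x \<in> carrier A" shows "\<sim>x \<boxplus> x = \<one>\<^sub>m"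
  using lukasiewicz[OF assms one_closed] assms
  by (simp add: plus_one_right closed neg_one plus_zero_left)

lemma le_iff: assumes "x \<in> carrier A" "y \<in> carrier A"
  shows "x \<preceq> y \<longleftrightarrow> (\<exists>z\<in>carrier A. y = x \<boxplus> z)"
proof
  assume "x \<preceq> y"
  then have "\<sim>(\<sim>y \<boxplus> x) \<boxplus> x = y"
    using lukasiewicz[OF assms] assms by (simp add: mv_le_def neg_one plus_zero_left)
  moreover have c: "\<sim>(\<sim>y \<boxplus> x) \<in> carrier A" by (intro closed assms)
  ultimately have "y = x \<boxplus> \<sim>(\<sim>y \<boxplus> x)" using plus_commute[OF c assms(1)] by (simp only:)
  with c show "\<exists>z\<in>carrier A. y = x \<boxplus> z" by blast
next
  assume "\<exists>z\<in>carrier A. y = x \<boxplus> z"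
  then obtain z where z: "z \<in> carrier A" "y = x \<boxplus> z" by blast
  then have "\<sim>x \<boxplus> y = (\<sim>x \<boxplus> x) \<boxplus> z" using assms by (simp add: plus_assoc closed)
  then show "x \<preceq> y" using assms z by (simp add: mv_le_def neg_plus plus_one_left)
qed

lemma le_refl: "x \<in> carrier A \<Longrightarrow> x \<preceq> x"
  by (simp add: mv_le_def neg_plus)

lemma le_antisym: "x \<in> carrier A \<Longrightarrow> y \<in> carrier A \<Longrightarrow> x \<preceq> y \<Longrightarrow> y \<preceq> x \<Longrightarrow> x = y"
  using lukasiewicz[of x y] by (simp add: mv_le_def neg_one plus_zero_left)

lemma le_trans: assumes "x \<in> carrier A" "y \<in> carrier A" "z \<in> carrier A" "x \<preceq> y" "y \<preceq> z"
  shows "x \<preceq> z"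
proof -
  obtain v w where "v \<in> carrier A" "y = x \<boxplus> v" "w \<in> carrier A" "z = y \<boxplus> w"
    using assms le_iff by blast
  then show ?thesis using assms le_iff[of x z] plus_assoc[of x v w] plus_closed[of v w] by blast
qed

lemma le_one: "x \<in> carrier A \<Longrightarrow> x \<preceq> \<one>\<^sub>m"
  by (simp add: mv_le_def plus_one_right closed)

lemma zero_le: "x \<in> carrier A \<Longrightarrow> \<zero>\<^sub>m \<preceq> x"
  by (simp add: mv_le_def neg_zero plus_one_left closed)

lemma one_le: "x \<in> carrier A \<Longrightarrow> \<one>\<^sub>m \<preceq> x \<Longrightarrow> x = \<one>\<^sub>m"
  using le_antisym le_one closed by blast

lemma le_plus: "x \<in> carrier A \<Longrightarrow> y \<in> carrier A \<Longrightarrow> x \<preceq> x \<boxplus> y"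
  by (auto simp: le_iff closed)

lemma le_plus_left: "x \<in> carrier A \<Longrightarrow> y \<in> carrier A \<Longrightarrow> y \<preceq> x \<boxplus> y"
  using le_plus[of y x] by (simp add: plus_commute)

lemma plus_mono: assumes "x \<in> carrier A" "y \<in> carrier A" "z \<in> carrier A" "x \<preceq> y"
  shows "x \<boxplus> z \<preceq> y \<boxplus> z"
proof -
  obtain w where w: "w \<in> carrier A" "y = x \<boxplus> w" using assms by (auto simp: le_iff)
  then have "y \<boxplus> z = (x \<boxplus> z) \<boxplus> w" using assms by (metis plus_assoc plus_commute)
  then show ?thesis using w assms by (simp add: le_plus closed)
qed

lemma neg_mono: "x \<in> carrier A \<Longrightarrow> y \<in> carrier A \<Longrightarrow> x \<preceq> y \<Longrightarrow> \<sim>y \<preceq> \<sim>x"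
  by (simp add: mv_le_def neg_neg plus_commute closed)

lemma odot_mono: "x \<in> carrier A \<Longrightarrow> y \<in> carrier A \<Longrightarrow> z \<in> carrier A \<Longrightarrow> x \<preceq> y
    \<Longrightarrow> x \<boxdot> z \<preceq> y \<boxdot> z"
  unfolding mv_odot_def by (intro neg_mono plus_mono closed)

lemma odot_commute: "x \<in> carrier A \<Longrightarrow> y \<in> carrier A \<Longrightarrow> x \<boxdot> y = y \<boxdot> x"
  by (simp add: mv_odot_def plus_commute closed)

lemma odot_assoc: "x \<in> carrier A \<Longrightarrow> y \<in> carrier A \<Longrightarrow> z \<in> carrier A
    \<Longrightarrow> (x \<boxdot> y) \<boxdot> z = x \<boxdot> (y \<boxdot> z)"
  by (simp add: mv_odot_def plus_assoc neg_neg closed)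

lemma odot_le: assumes "x \<in> carrier A" "z \<in> carrier A" shows "x \<boxdot> z \<preceq> z"
  using neg_mono[OF _ _ le_plus_left[of "\<sim>x" "\<sim>z"]] assms by (simp add: mv_odot_def neg_neg closed)

lemma odot_neg: "x \<in> carrier A \<Longrightarrow> x \<boxdot> \<sim>x = \<zero>\<^sub>m"
  by (simp add: mv_odot_def neg_neg neg_plus neg_one closed)

lemma le_neg_iff: "x \<in> carrier A \<Longrightarrow> y \<in> carrier A \<Longrightarrow> \<sim>x \<preceq> y \<longleftrightarrow> x \<boxplus> y = \<one>\<^sub>m"
  by (simp add: mv_le_def neg_neg)

lemma odot_plus_neg: assumes "x \<in> carrier A" "y \<in> carrier A" "x \<boxplus> y = \<one>\<^sub>m"
  shows "x \<boxdot> y \<boxplus> \<sim>x = y"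
  using lukasiewicz[of y "\<sim>x"] assms
  by (simp add: mv_odot_def neg_neg neg_one plus_zero_left plus_zero plus_commute closed)

lemma odot_plus_neg': assumes "x \<in> carrier A" "y \<in> carrier A" "x \<boxplus> y = \<one>\<^sub>m"
  shows "x \<boxdot> y \<boxplus> \<sim>y = x"
  using odot_plus_neg[of y x] assms by (simp add: odot_commute plus_commute)

end

section \<open>Addition with carry on a chain\<close>

context mv_chain
begin

lemma le_neg_if_plus_less: assumes "x \<in> carrier A" "y \<in> carrier A" "x \<boxplus> y \<noteq> \<one>\<^sub>m"
  shows "x \<preceq> \<sim>y"
proof -
  have "\<sim>y \<preceq> x \<or> x \<preceq> \<sim>y" using linear assms closed by blast
  then show ?thesis using assms le_neg_iff[of y x] by (auto simp: plus_commute)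
qed

lemma plus_neg_plus: assumes "y \<in> carrier A" "z \<in> carrier A" "y \<boxplus> z \<noteq> \<one>\<^sub>m"
  shows "y \<boxplus> \<sim>(y \<boxplus> z) = \<sim>z"
proof -
  have "\<sim>y \<boxplus> \<sim>z = \<one>\<^sub>m" using le_neg_if_plus_less[OF assms] by (simp add: mv_le_def)
  then show ?thesis
    using lukasiewicz[of "\<sim>z" y] assms
    by (simp add: neg_neg neg_one plus_zero_left plus_commute closed)
qed

lemma plus_odot_neg: assumes "x \<in> carrier A" "y \<in> carrier A" "x \<boxplus> y \<noteq> \<one>\<^sub>m"
  shows "(x \<boxplus> y) \<boxdot> \<sim>y = x"
  using plus_neg_plus[of y x] assms by (simp add: mv_odot_def neg_neg plus_commute closed)

text \<open>No inner sum overflows, and in the group both sides are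
  \<open>max 0 (x + y + z - u)\<close>.\<close>

lemma odot_plus_commute:
  assumes "x \<in> carrier A" "y \<in> carrier A" "z \<in> carrier A" "x \<boxplus> y \<noteq> \<one>\<^sub>m" "y \<boxplus> z \<noteq> \<one>\<^sub>m"
  shows "(x \<boxplus> y) \<boxdot> z = x \<boxdot> (y \<boxplus> z)"
proof -
  have 1: "y \<boxplus> \<sim>(y \<boxplus> z) = \<sim>z" using plus_neg_plus assms by blast
  have 2: "y \<boxplus> \<sim>(x \<boxplus> y) = \<sim>x" using plus_neg_plus[of y x] assms by (simp add: plus_commute)
  have "\<sim>(x \<boxplus> y) \<boxplus> \<sim>z = \<sim>(x \<boxplus> y) \<boxplus> (y \<boxplus> \<sim>(y \<boxplus> z))" by (simp only: 1)
  also have "\<dots> = (y \<boxplus> \<sim>(x \<boxplus> y)) \<boxplus> \<sim>(y \<boxplus> z)"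
    using assms by (metis plus_assoc plus_commute closed(3,4))
  also have "\<dots> = \<sim>x \<boxplus> \<sim>(y \<boxplus> z)" by (simp only: 2)
  finally show ?thesis by (simp add: mv_odot_def)
qed

text \<open>In the group everything equals \<open>x + y + z - u\<close>, which is below
  \<open>u\<close> because \<open>x + y < u\<close> and \<open>z \<le> u\<close>.\<close>

lemma plus_odot_carry:
  assumes "x \<in> carrier A" "y \<in> carrier A" "z \<in> carrier A" "x \<boxplus> y \<noteq> \<one>\<^sub>m" "y \<boxplus> z = \<one>\<^sub>m"
  shows "(x \<boxplus> y) \<boxdot> z = x \<boxplus> (y \<boxdot> z)" "x \<boxplus> (y \<boxdot> z) \<noteq> \<one>\<^sub>m"
proof -
  have "(x \<boxplus> (y \<boxdot> z)) \<boxplus> \<sim>z = x \<boxplus> y"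
    using odot_plus_neg'[of y z] assms by (simp add: plus_assoc closed)
  then show "(x \<boxplus> y) \<boxdot> z = x \<boxplus> (y \<boxdot> z)" "x \<boxplus> (y \<boxdot> z) \<noteq> \<one>\<^sub>m"
    using plus_odot_neg[of "x \<boxplus> (y \<boxdot> z)" "\<sim>z"] assms
    by (auto simp: closed neg_neg plus_one_left)
qed

text \<open>Both inner sums overflow, and in the group both sides are
  \<open>min (x + y + z - u) u\<close>.\<close>

lemma plus_odot_shift:
  assumes "x \<in> carrier A" "y \<in> carrier A" "z \<in> carrier A" "x \<boxplus> y = \<one>\<^sub>m" "y \<boxplus> z = \<one>\<^sub>m"
  shows "(x \<boxdot> y) \<boxplus> z = x \<boxplus> (y \<boxdot> z)"
proof -
  have 1: "(y \<boxdot> z) \<boxplus> \<sim>y = z" using odot_plus_neg[of y z] assms by simp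
  have 2: "(x \<boxdot> y) \<boxplus> \<sim>y = x" using odot_plus_neg'[of x y] assms by simp
  have "(x \<boxdot> y) \<boxplus> z = (x \<boxdot> y) \<boxplus> ((y \<boxdot> z) \<boxplus> \<sim>y)" by (simp only: 1)
  also have "\<dots> = ((x \<boxdot> y) \<boxplus> \<sim>y) \<boxplus> (y \<boxdot> z)"
    using assms by (metis plus_assoc plus_commute closed(3,5))
  finally show ?thesis by (simp only: 2)
qed

lemma odot_neq_one: assumes "x \<in> carrier A" "y \<in> carrier A" "y \<noteq> \<one>\<^sub>m" shows "x \<boxdot> y \<noteq> \<one>\<^sub>m"
  using odot_le[of x y] one_le assms by metis

lemma cyc_add_closed: "x \<in> carrier A \<Longrightarrow> y \<in> carrier A \<Longrightarrow> mv_cyc_add A x y \<in> carrier A"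
  by (simp add: mv_cyc_add_def closed)

lemma cyc_add_neq_one: "x \<in> carrier A \<Longrightarrow> y \<in> carrier A \<Longrightarrow> y \<noteq> \<one>\<^sub>m \<Longrightarrow> mv_cyc_add A x y \<noteq> \<one>\<^sub>m"
  by (simp add: mv_cyc_add_def odot_neq_one)

lemma cyc_add_commute: "x \<in> carrier A \<Longrightarrow> y \<in> carrier A \<Longrightarrow> mv_cyc_add A x y = mv_cyc_add A y x"
  by (simp add: mv_cyc_add_def plus_commute odot_commute)

text \<open>The number of units that overflow from a sum of two remainders; it is the cocycle of the
  Chang group as an extension of its quotient by the unit.\<close>

definition carry :: "'a \<Rightarrow> 'a \<Rightarrow> int" where
  "carry x y = (if x \<boxplus> y = \<one>\<^sub>m then 1 else 0)"

text \<open>The second conjunct is the cocycle identity, which associativity of the integer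
  component amounts to. The two conjuncts share the four overflow cases.\<close>

lemma cyc_add_assoc:
  assumes "x \<in> carrier A" "y \<in> carrier A" "z \<in> carrier A"
  shows "mv_cyc_add A (mv_cyc_add A x y) z = mv_cyc_add A x (mv_cyc_add A y z) \<and>
     carry x y + carry (mv_cyc_add A x y) z = carry y z + carry x (mv_cyc_add A y z)"
proof (cases "x \<boxplus> y = \<one>\<^sub>m"; cases "y \<boxplus> z = \<one>\<^sub>m")
  assume *: "x \<boxplus> y = \<one>\<^sub>m" "y \<boxplus> z = \<one>\<^sub>m"
  show ?thesis using plus_odot_shift[OF assms *] odot_assoc[OF assms] *
    by (simp add: mv_cyc_add_def carry_def)
next
  assume *: "x \<boxplus> y = \<one>\<^sub>m" "y \<boxplus> z \<noteq> \<one>\<^sub>m"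
  have "(z \<boxplus> y) \<boxdot> x = z \<boxplus> (y \<boxdot> x)" "z \<boxplus> (y \<boxdot> x) \<noteq> \<one>\<^sub>m"
    using plus_odot_carry[of z y x] * assms by (simp_all add: plus_commute)
  then have "x \<boxdot> (y \<boxplus> z) = (x \<boxdot> y) \<boxplus> z" "(x \<boxdot> y) \<boxplus> z \<noteq> \<one>\<^sub>m"
    using assms by (simp_all add: plus_commute odot_commute closed)
  moreover have "x \<boxplus> (y \<boxplus> z) = \<one>\<^sub>m"
    using * assms by (simp add: plus_one_left flip: plus_assoc)
  ultimately show ?thesis using * by (simp add: mv_cyc_add_def carry_def)
next
  assume *: "x \<boxplus> y \<noteq> \<one>\<^sub>m" "y \<boxplus> z = \<one>\<^sub>m"
  have "(x \<boxplus> y) \<boxplus> z = \<one>\<^sub>m" using * assms by (simp add: plus_assoc plus_one_right)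
  with plus_odot_carry[OF assms *] * show ?thesis by (simp add: mv_cyc_add_def carry_def)
next
  assume *: "x \<boxplus> y \<noteq> \<one>\<^sub>m" "y \<boxplus> z \<noteq> \<one>\<^sub>m"
  with odot_plus_commute[OF assms *] show ?thesis
    by (simp add: mv_cyc_add_def carry_def plus_assoc assms)
qed

text \<open>A pair \<open>(k, x)\<close> stands for \<open>k u + x\<close>, where \<open>0 \<le> x < u\<close>.\<close>

definition chang :: "(int \<times> 'a) ordered_group" where
  "chang = \<lparr>carrier = UNIV \<times> (carrier A - {\<one>\<^sub>m}),
     monoid.mult = (\<lambda>(k, x) (l, y). (k + l + carry x y, mv_cyc_add A x y)),
     one = (0, \<zero>\<^sub>m),
     order_rel = {((k, x), (l, y)). x \<in> carrier A - {\<one>\<^sub>m} \<and> y \<in> carrier A - {\<one>\<^sub>m} \<and>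
        (k < l \<or> k = l \<and> x \<preceq> y)}\<rparr>"

lemma chang_mult: "(k, x) \<otimes>\<^bsub>chang\<^esub> (l, y) = (k + l + carry x y, mv_cyc_add A x y)"
  and chang_one: "\<one>\<^bsub>chang\<^esub> = (0, \<zero>\<^sub>m)"
  and chang_carrier: "(k, x) \<in> carrier chang \<longleftrightarrow> x \<in> carrier A \<and> x \<noteq> \<one>\<^sub>m"
  and chang_order: "((k, x), (l, y)) \<in> order_rel chang \<longleftrightarrow> x \<in> carrier A \<and> x \<noteq> \<one>\<^sub>m \<and>
     y \<in> carrier A \<and> y \<noteq> \<one>\<^sub>m \<and> (k < l \<or> k = l \<and> x \<preceq> y)"
  by (auto simp: chang_def)

lemma cyc_add_zero: "x \<in> carrier A \<Longrightarrow> x \<noteq> \<one>\<^sub>m \<Longrightarrow> mv_cyc_add A \<zero>\<^sub>m x = x"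
  and carry_zero: "x \<in> carrier A \<Longrightarrow> x \<noteq> \<one>\<^sub>m \<Longrightarrow> carry \<zero>\<^sub>m x = 0"
  by (simp_all add: mv_cyc_add_def carry_def plus_zero_left)

lemma comm_group_chang: "comm_group chang"
proof (rule comm_groupI)
  fix a b assume "a \<in> carrier chang" "b \<in> carrier chang"
  then show "a \<otimes>\<^bsub>chang\<^esub> b \<in> carrier chang" "a \<otimes>\<^bsub>chang\<^esub> b = b \<otimes>\<^bsub>chang\<^esub> a"
    by (cases a; cases b; simp add: chang_mult chang_carrier cyc_add_closed cyc_add_neq_one
        cyc_add_commute carry_def plus_commute)+
next
  show "\<one>\<^bsub>chang\<^esub> \<in> carrier chang" using nontrivial by (simp add: chang_one chang_carrier closed)
next
  fix a b c assume "a \<in> carrier chang" "b \<in> carrier chang" "c \<in> carrier chang"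
  then show "a \<otimes>\<^bsub>chang\<^esub> b \<otimes>\<^bsub>chang\<^esub> c = a \<otimes>\<^bsub>chang\<^esub> (b \<otimes>\<^bsub>chang\<^esub> c)"
    using cyc_add_assoc[of "snd a" "snd b" "snd c"]
    by (cases a; cases b; cases c; simp add: chang_mult chang_carrier)
next
  fix a assume a: "a \<in> carrier chang"
  then show "\<one>\<^bsub>chang\<^esub> \<otimes>\<^bsub>chang\<^esub> a = a"
    by (cases a; simp add: chang_one chang_mult chang_carrier cyc_add_zero carry_zero)
  obtain k x where kx: "a = (k, x)" by (cases a)
  with a have x: "x \<in> carrier A" "x \<noteq> \<one>\<^sub>m" by (simp_all add: chang_carrier)
  \<comment> \<open>The inverse of \<open>k u + x\<close> is \<open>(- k - 1) u + (u - x)\<close>,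
    but \<open>u - x\<close> is a remainder only for \<open>x \<noteq> 0\<close>.\<close>
  show "\<exists>b\<in>carrier chang. b \<otimes>\<^bsub>chang\<^esub> a = \<one>\<^bsub>chang\<^esub>"
  proof (cases "x = \<zero>\<^sub>m")
    case True
    then show ?thesis using x kx
      by (intro bexI[of _ "(- k, \<zero>\<^sub>m)"]) (simp_all add: chang_one chang_mult chang_carrier cyc_add_zero carry_zero)
  next
    case False
    then have "\<sim>x \<noteq> \<one>\<^sub>m" using x neg_neg neg_one by metis
    then show ?thesis using x kx
      by (intro bexI[of _ "(- k - 1, \<sim>x)"])
        (simp_all add: chang_one chang_mult chang_carrier mv_cyc_add_def carry_def neg_plus closed
          odot_neg odot_commute[of "\<sim>x" x])
  qed
qed

lemma linordered_comm_group_chang: "linordered_comm_group chang"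
proof -
  interpret C: comm_group chang by (rule comm_group_chang)
  show ?thesis
  proof
    have "order_rel chang \<subseteq> carrier chang \<times> carrier chang"
      by (auto simp: chang_order chang_carrier)
    moreover have "refl_on (carrier chang) (order_rel chang)"
      by (auto simp: refl_on_def chang_order chang_carrier le_refl)
    moreover have "trans (order_rel chang)"
      by (rule transI) (auto simp: chang_order intro: le_trans)
    moreover have "antisym (order_rel chang)"
      by (rule antisymI) (auto simp: chang_order intro: le_antisym)
    moreover have "total_on (carrier chang) (order_rel chang)"
      using linear by (fastforce simp: total_on_def chang_order chang_carrier)
    ultimately show "linear_order_on (carrier chang) (order_rel chang)"
      by (simp add: order_on_defs)
  next
    fix a b c assume ab: "(a, b) \<in> order_rel chang" and c: "c \<in> carrier chang"
    obtain k x l y m z where eq: "a = (k, x)" "b = (l, y)" "c = (m, z)" by (cases a; cases b; cases c)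
    have x: "x \<in> carrier A" "x \<noteq> \<one>\<^sub>m" and y: "y \<in> carrier A" "y \<noteq> \<one>\<^sub>m"
      and z: "z \<in> carrier A" "z \<noteq> \<one>\<^sub>m" and le: "k < l \<or> k = l \<and> x \<preceq> y"
      using ab c by (auto simp: eq chang_order chang_carrier)
    have "k + m + carry x z < l + m + carry y z \<or>
        k + m + carry x z = l + m + carry y z \<and> mv_cyc_add A x z \<preceq> mv_cyc_add A y z"
    proof (cases "k < l")
      case True
      \<comment> \<open>If \<open>l = k + 1\<close>, a carry on the smaller side alone makes the
        integer parts equal, and then the remainders decide; \<open>z\<close> lies between
        them.\<close>
      have "x \<boxdot> z \<preceq> y \<boxplus> z"
        by (rule le_trans[OF _ z(1) _ odot_le le_plus_left]) (intro closed x y z)+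
      with True show ?thesis by (auto simp: carry_def mv_cyc_add_def)
    next
      case False
      then have *: "x \<preceq> y" "k = l" using le by auto
      have m: "x \<boxplus> z \<preceq> y \<boxplus> z" using * x y z plus_mono by blast
      then have "x \<boxplus> z = \<one>\<^sub>m \<Longrightarrow> y \<boxplus> z = \<one>\<^sub>m" using one_le y z closed by metis
      with * m odot_mono[OF x(1) y(1) z(1) *(1)] show ?thesis
        by (auto simp: carry_def mv_cyc_add_def)
    qed
    then show "(a \<otimes>\<^bsub>chang\<^esub> c, b \<otimes>\<^bsub>chang\<^esub> c) \<in> order_rel chang"
      using x y z by (simp add: eq chang_mult chang_order cyc_add_closed cyc_add_neq_one)
  qed
qed

lemma chang_group_chang: "chang_group A chang (1, \<zero>\<^sub>m)"
proof -
  interpret C: linordered_comm_group chang by (rule linordered_comm_group_chang)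
  have zero: "\<zero>\<^sub>m \<in> carrier A" "\<zero>\<^sub>m \<noteq> \<one>\<^sub>m" using nontrivial by (simp_all add: closed)
  have pow: "(1, \<zero>\<^sub>m) [^]\<^bsub>chang\<^esub> (n::nat) = (int n, \<zero>\<^sub>m)" for n
    by (induction n) (simp_all add: chang_one chang_mult cyc_add_zero carry_zero zero)
  have su: "strong_unit chang (1, \<zero>\<^sub>m)"
    unfolding strong_unit_def
  proof (intro conjI ballI)
    show "(\<one>\<^bsub>chang\<^esub>, (1, \<zero>\<^sub>m)) \<in> order_rel chang" using zero by (simp add: chang_one chang_order)
    fix a assume "a \<in> carrier chang"
    then show "\<exists>n::nat. (a, (1, \<zero>\<^sub>m) [^]\<^bsub>chang\<^esub> n) \<in> order_rel chang"
      using zero by (intro exI[of _ "nat (fst a + 1)"]) (cases a; auto simp: pow chang_order chang_carrier)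
  qed
  \<comment> \<open>The top element is the unit and not a remainder, hence the separate
    value.\<close>
  define f where "f x = (if x = \<one>\<^sub>m then (1, \<zero>\<^sub>m) else (0::int, x))" for x
  let ?I = "interval_mv chang (1, \<zero>\<^sub>m)"
  have inv: "inv\<^bsub>chang\<^esub> (0, x) = (-1, \<sim>x)" if "x \<in> carrier A" "x \<noteq> \<one>\<^sub>m" "x \<noteq> \<zero>\<^sub>m" for x
  proof -
    have "\<sim>x \<noteq> \<one>\<^sub>m" using that neg_neg neg_one by metis
    then show ?thesis using that
      by (intro C.inv_equality) (simp_all add: chang_one chang_mult chang_carrier mv_cyc_add_def
          carry_def neg_plus closed odot_neg odot_commute[of "\<sim>x" x])
  qed
  have le_zero: "x = \<zero>\<^sub>m" if "x \<in> carrier A" "x \<preceq> \<zero>\<^sub>m" for x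
    using le_antisym zero_le that closed by blast
  have "f \<in> mv_hom A ?I"
    unfolding mv_hom_def mem_Collect_eq
  proof (intro conjI ballI)
    show "f \<in> carrier A \<rightarrow> carrier ?I"
      using zero by (auto simp: interval_mv_def f_def chang_one chang_order chang_carrier le_refl zero_le)
    show "f (mv_zero A) = mv_zero ?I" using zero by (simp add: f_def interval_mv_def chang_one)
  next
    fix x assume x: "x \<in> carrier A"
    consider "x = \<zero>\<^sub>m" | "x = \<one>\<^sub>m" | "x \<noteq> \<zero>\<^sub>m" "x \<noteq> \<one>\<^sub>m" by blast
    then show "f (mv_neg A x) = mv_neg ?I (f x)"
    proof cases
      case 1
      have "inv\<^bsub>chang\<^esub> (0, \<zero>\<^sub>m) = (0, \<zero>\<^sub>m)" using C.inv_one by (simp add: chang_one)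
      then show ?thesis using 1 zero
        by (simp add: f_def interval_mv_def neg_zero chang_mult cyc_add_zero carry_zero)
    next
      case 2
      have "(1, \<zero>\<^sub>m) \<otimes>\<^bsub>chang\<^esub> inv\<^bsub>chang\<^esub> (1, \<zero>\<^sub>m) = \<one>\<^bsub>chang\<^esub>"
        using zero by (intro C.r_inv) (simp add: chang_carrier)
      then show ?thesis using 2 zero by (simp add: f_def interval_mv_def neg_one chang_one)
    next
      case 3
      then have "\<sim>x \<noteq> \<one>\<^sub>m" using x neg_neg neg_one by metis
      then show ?thesis using 3 x zero
        by (simp add: f_def interval_mv_def inv chang_mult cyc_add_zero carry_zero closed)
    qed
  next
    fix x y assume x: "x \<in> carrier A" and y: "y \<in> carrier A"
    consider "x = \<one>\<^sub>m" "y = \<one>\<^sub>m" | "x = \<one>\<^sub>m" "y \<noteq> \<one>\<^sub>m" | "x \<noteq> \<one>\<^sub>m" "y = \<one>\<^sub>m" |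
      "x \<noteq> \<one>\<^sub>m" "y \<noteq> \<one>\<^sub>m" by blast
    then show "f (x \<boxplus> y) = f x \<boxplus>\<^bsub>?I\<^esub> f y"
    proof cases
      case 1
      then show ?thesis
        using zero by (simp add: f_def interval_mv_def chang_mult chang_order plus_one_left closed cyc_add_zero carry_zero)
    next
      case 2
      then show ?thesis using zero y le_zero[OF y]
        by (auto simp: f_def interval_mv_def chang_mult chang_order plus_one_left cyc_add_zero carry_zero)
    next
      case 3
      then show ?thesis using zero x le_zero[OF x] cyc_add_zero[of x] carry_zero[of x] cyc_add_commute[of x "\<zero>\<^sub>m"]
        by (auto simp: f_def interval_mv_def chang_mult chang_order plus_one_right carry_def plus_zero closed)
    next
      case 4
      then show ?thesis using zero x y le_zero[of "x \<boxdot> y"]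
        by (auto simp: f_def interval_mv_def chang_mult chang_order mv_cyc_add_def carry_def closed odot_neq_one)
    qed
  qed
  moreover have "bij_betw f (carrier A) (carrier ?I)"
  proof (rule bij_betw_imageI)
    show "inj_on f (carrier A)" by (auto simp: inj_on_def f_def)
    have "a \<in> f ` carrier A" if a: "a \<in> carrier ?I" for a
    proof -
      obtain k x where kx: "a = (k, x)" by (cases a)
      with a have x: "x \<in> carrier A" "x \<noteq> \<one>\<^sub>m" "0 \<le> k" "k = 0 \<or> k = 1 \<and> x \<preceq> \<zero>\<^sub>m"
        by (auto simp: interval_mv_def chang_order chang_one)
      then consider "k = 0" | "k = 1" "x = \<zero>\<^sub>m" using le_zero by auto
      then show ?thesis
      proof cases
        case 1
        then show ?thesis using x kx by (intro image_eqI[of _ _ x]) (simp_all add: f_def)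
      next
        case 2
        then show ?thesis using kx by (intro image_eqI[of _ _ "\<one>\<^sub>m"]) (simp_all add: f_def closed)
      qed
    qed
    then show "f ` carrier A = carrier ?I"
      using zero by (auto simp: interval_mv_def f_def chang_one chang_order chang_carrier le_refl zero_le)
  qed
  ultimately show ?thesis
    using su linordered_comm_group_chang unfolding chang_group_def mv_isomorphic_def by blast
qed

end

section \<open>Regular density\<close>

context preordered_group
begin

abbreviation strict :: "'r \<Rightarrow> bool" where "strict x \<equiv> \<not> P (- x)"

lemma strict_pos: "strict x \<Longrightarrow> P x"
  using not_pos by fastforce

lemma strict_add: "strict x \<Longrightarrow> P y \<Longrightarrow> strict (x + y)"
  using pos_add[of "- (x + y)" y] by auto

lemma strict_scale: "strict x \<Longrightarrow> n > 0 \<Longrightarrow> strict (of_nat n * x)"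
  using pos_scale_iff[of "int n" "- x"] by simp

lemma strict_min: assumes "strict x" "strict y" shows "\<exists>z. strict z \<and> P (x - z) \<and> P (y - z)"
  using assms pos_total[of "x - y"] by (metis diff_self minus_diff_eq pos_0)

end

context mv_presentation
begin

lemma h_one: "eq0 (h (mv_one A) - u)"
  using eq0_diff[OF h_neg[OF zero_closed] h_zero] by (simp add: mv_one_def)

lemma eq_one_iff: "a \<in> carrier A \<Longrightarrow> a = mv_one A \<longleftrightarrow> eq0 (h a - u)"
  using h_eq_iff[OF _ one_closed] h_one eq0_trans eq0_commute by metis

lemma eq_zero_iff: "a \<in> carrier A \<Longrightarrow> a = mv_zero A \<longleftrightarrow> eq0 (h a)"
  using h_eq_iff[OF _ zero_closed, of a] h_zero eq0_cong[of "h a - h (mv_zero A)" "h a"] by simp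

lemma plus_eq_one_iff:
  assumes "a \<in> carrier A" "b \<in> carrier A"
  shows "a \<boxplus> b = mv_one A \<longleftrightarrow> P (h a + h b - u)"
proof (cases "P (u - (h a + h b))")
  case True
  have "a \<boxplus> b = mv_one A \<longleftrightarrow> eq0 (h (a \<boxplus> b) - u)" by (simp add: eq_one_iff assms closed)
  also have "\<dots> \<longleftrightarrow> eq0 (h a + h b - u)"
    by (rule eq0_cong) (use h_plus[OF assms True] in \<open>simp add: algebra_simps\<close>)
  also have "\<dots> \<longleftrightarrow> P (h a + h b - u)" using True by (simp add: eq0_def algebra_simps)
  finally show ?thesis .
next
  case False
  then show ?thesis
    using h_plus_trunc[OF assms False] not_pos[OF False] eq_one_iff[of "a \<boxplus> b"] assms
    by (simp add: closed algebra_simps)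
qed

lemma mv_le_iff:
  assumes "a \<in> carrier A" "b \<in> carrier A"
  shows "mv_le A a b \<longleftrightarrow> P (h b - h a)"
proof -
  have "mv_le A a b \<longleftrightarrow> P (h (mv_neg A a) + h b - u)"
    using assms by (simp add: mv_le_def plus_eq_one_iff closed)
  also have "\<dots> \<longleftrightarrow> P (h b - h a)"
    by (rule pos_cong) (use h_neg[OF assms(1)] in \<open>simp add: algebra_simps\<close>)
  finally show ?thesis .
qed

lemma mv_less_iff:
  assumes "a \<in> carrier A" "b \<in> carrier A"
  shows "mv_less A a b \<longleftrightarrow> \<not> P (h a - h b)"
  using mv_le_iff[OF assms] h_eq_iff[OF assms] not_pos[of "h a - h b"]
  by (auto simp: mv_less_def eq0_def)

lemma zero_less_iff:
  assumes "a \<in> carrier A"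
  shows "mv_less A (mv_zero A) a \<longleftrightarrow> strict (h a)"
proof -
  have "P (h (mv_zero A) - h a) \<longleftrightarrow> P (- h a)"
    by (rule pos_cong) (use h_zero in simp)
  then show ?thesis using mv_less_iff[OF zero_closed assms] by simp
qed

lemma mult_closed: "a \<in> carrier A \<Longrightarrow> mv_mult A n a \<in> carrier A"
  by (induction n) (auto simp: closed)

lemma h_mult:
  assumes a: "a \<in> carrier A"
  shows "(P (u - of_nat n * h a) \<longrightarrow> eq0 (h (mv_mult A n a) - of_nat n * h a)) \<and>
    (\<not> P (u - of_nat n * h a) \<longrightarrow> eq0 (h (mv_mult A n a) - u))"
proof (induction n)
  case 0
  then show ?case using h_zero unit_nonneg by simp
next
  case (Suc n)
  let ?b = "mv_mult A n a"
  have b: "?b \<in> carrier A" by (rule mult_closed[OF a])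
  have ha: "P (h a)" by (rule h_nonneg[OF a])
  show ?case
  proof (cases "P (u - of_nat n * h a)")
    case True
    then have e: "eq0 (h ?b - of_nat n * h a)" using Suc by blast
    have c: "P (u - (h ?b + h a)) \<longleftrightarrow> P (u - of_nat (Suc n) * h a)"
      by (rule pos_cong) (use e in \<open>simp add: algebra_simps eq0_commute\<close>)
    show ?thesis
    proof (cases "P (u - of_nat (Suc n) * h a)")
      case True
      then have "eq0 (h (?b \<boxplus> a) - (h ?b + h a))" using h_plus[OF b a] c by blast
      from eq0_add[OF this e] True show ?thesis by (simp add: algebra_simps)
    next
      case False
      then show ?thesis using h_plus_trunc[OF b a] c by simp
    qed
  next
    case False
    then have e: "eq0 (h ?b - u)" using Suc by blast
    have s: "\<not> P (u - of_nat (Suc n) * h a)"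
      using False pos_add[OF _ ha, of "u - of_nat (Suc n) * h a"] by (auto simp: algebra_simps)
    have "\<not> P (- h a)"
    proof
      assume "P (- h a)"
      from pos_add[OF pos_scale_nat[OF this, of n] unit_nonneg] False show False
        by (simp add: algebra_simps)
    qed
    moreover have "P (u - (h ?b + h a)) \<longleftrightarrow> P (- h a)"
      by (rule pos_cong) (use e in \<open>simp add: algebra_simps eq0_commute\<close>)
    ultimately show ?thesis using h_plus_trunc[OF b a] s by simp
  qed
qed

end

locale regular_mv_presentation = mv_presentation +
  assumes atomless: "mv_atomless A" and regular: "mv_regular A"
begin

text \<open>For \<open>d\<close> up to \<open>u\<close> this is atomlessness read through
  \<open>h\<close>; for larger \<open>d\<close>, an element strictly between 0 and \<open>u\<close>
  serves.\<close>

lemma dense: assumes d: "strict d" shows "\<exists>z. strict z \<and> strict (d - z)"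
proof -
  have small: "\<exists>z. strict z \<and> strict (d - z)" if d: "strict d" "P (u - d)" for d
  proof -
    obtain a where a: "a \<in> carrier A" "eq0 (h a - d)"
      using h_surj[of d] strict_pos d by blast
    have ad: "P (- h a) \<longleftrightarrow> P (- d)" by (rule pos_cong) (use a(2) in \<open>simp add: eq0_commute\<close>)
    then have "mv_less A (mv_zero A) a" using zero_less_iff[OF a(1)] d by simp
    moreover have "{mv_zero A, a} \<subseteq> {y \<in> carrier A. mv_le A y a}"
      using a(1) by (auto simp: closed zero_le le_refl)
    ultimately obtain y where y: "y \<in> carrier A" "mv_le A y a" "y \<noteq> mv_zero A" "y \<noteq> a"
      using atomless a(1) unfolding mv_atomless_def by blast
    then have "mv_less A (mv_zero A) y" "mv_less A y a"
      using zero_le by (auto simp: mv_less_def)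
    then have "strict (h y)" "\<not> P (h y - h a)"
      using zero_less_iff mv_less_iff a(1) y(1) by blast+
    moreover have "P (h y - h a) \<longleftrightarrow> P (- (d - h y))"
      by (rule pos_cong) (use a(2) in \<open>simp add: eq0_commute\<close>)
    ultimately show ?thesis by blast
  qed
  show ?thesis
  proof (cases "P (u - d)")
    case True
    with small d show ?thesis by blast
  next
    case False
    obtain z where z: "strict z" "strict (u - z)" using small[of u] unit_pos by auto
    have "P (d - u)" using not_pos[OF False] by simp
    from strict_add[OF z(2) this] z(1) show ?thesis by (intro exI[of _ z]) simp
  qed
qed

lemma divide: assumes d: "strict d" shows "\<exists>z. strict z \<and> strict (d - of_nat n * z)"
proof (induction n)
  case 0
  then show ?case using d by auto
next
  case (Suc n)
  then obtain z where z: "strict z" "strict (d - of_nat n * z)" by blast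
  \<comment> \<open>Any \<open>v < w\<close> leaves room for one more copy:
    \<open>d - (n + 1) v\<close> is the sum of \<open>w - v\<close>, \<open>d - n z - w\<close>,
    \<open>n (z - w)\<close> and \<open>n (w - v)\<close>.\<close>
  obtain w where w: "strict w" "P (z - w)" "P (d - of_nat n * z - w)"
    using strict_min[OF z] by blast
  obtain v where v: "strict v" "strict (w - v)" using dense[OF w(1)] by blast
  have 1: "P (of_nat n * (z - w) + of_nat n * (w - v))"
    by (intro pos_add pos_scale_nat w(2) strict_pos v(2))
  have "strict ((w - v) + (d - of_nat n * z - w) + (of_nat n * (z - w) + of_nat n * (w - v)))"
    by (rule strict_add[OF strict_add[OF v(2) w(3)] 1])
  then have "strict (d - of_nat (Suc n) * v)" by (simp add: algebra_simps)
  with v show ?case by blast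
qed

text \<open>Keeping \<open>b\<close> below \<open>u\<close> excludes truncation: a multiple cut off
  at the top could not lie below \<open>b\<close>, so the multiple in the algebra is the multiple in
  the group.\<close>

lemma regular_interval:
  assumes n: "n \<ge> 2" and a: "strict a" and ab: "strict (b - a)" and bu: "strict (u - b)"
  shows "\<exists>x. P (of_nat n * x - a) \<and> P (b - of_nat n * x)"
proof -
  obtain \<delta> where \<delta>: "strict \<delta>" "strict (b - a - of_nat n * \<delta>)" using divide[OF ab] by blast
  \<comment> \<open>Regularity is about chains of \<open>n\<close> elements. The interval is filled
    with steps of size \<delta> from \<open>a\<close> at index 1, except that index \<open>n\<close>
    is \<open>b\<close> itself.\<close>
  define p where "p i = (if i < n then a + of_nat (i - 1) * \<delta> else b)" for i
  have pb: "strict (b - p i)" if "i < n" for i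
  proof -
    have "strict (b - a - of_nat n * \<delta> + of_nat (n - (i - 1)) * \<delta>)"
      by (intro strict_add \<delta> pos_scale_nat strict_pos)
    moreover have "of_nat n * \<delta> = of_nat (n - (i - 1)) * \<delta> + of_nat (i - 1) * \<delta>"
    proof -
      have "n = (n - (i - 1)) + (i - 1)" using that by simp
      then show ?thesis by (metis distrib_right of_nat_add)
    qed
    ultimately show ?thesis using that by (simp add: p_def algebra_simps)
  qed
  have bpos: "P b" using strict_pos[OF strict_add[OF a strict_pos[OF ab]]] by simp
  have ex: "\<exists>c. c \<in> carrier A \<and> eq0 (h c - p i)" for i
  proof -
    have "P (p i)" using bpos strict_pos[OF a] strict_pos[OF \<delta>(1)]
      by (auto simp: p_def intro!: pos_add pos_scale_nat)
    moreover have "P (b - p i)" using pb[of i] strict_pos by (cases "i < n") (auto simp: p_def)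
    then have "P (u - p i)" using pos_add[OF strict_pos[OF bu], of "b - p i"] by simp
    ultimately show ?thesis using h_surj by blast
  qed
  obtain xs where xs: "\<And>i. xs i \<in> carrier A" "\<And>i. eq0 (h (xs i) - p i)" using ex by metis
  have less: "mv_less A (xs i) (xs (Suc i))" if i: "i \<in> {1..<n}" for i
  proof -
    have "P (h (xs i) - h (xs (Suc i))) \<longleftrightarrow> P (p i - p (Suc i))"
      by (rule pos_cong) (use eq0_diff[OF xs(2)[of i] xs(2)[of "Suc i"]] in \<open>simp add: algebra_simps\<close>)
    moreover have "strict (p (Suc i) - p i)"
    proof (cases "Suc i < n")
      case True
      have "of_nat i = (of_nat (i - 1) + 1 :: 'a)" using i by (cases i) auto
      then have "p (Suc i) - p i = \<delta>" using True i by (simp add: p_def algebra_simps)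
      then show ?thesis using \<delta>(1) by simp
    next
      case False
      then have "p (Suc i) = b" by (simp add: p_def)
      with pb[of i] i show ?thesis by simp
    qed
    ultimately show ?thesis using mv_less_iff xs(1) by simp
  qed
  have p1: "p 1 = a" and pn: "p n = b" using n by (simp_all add: p_def)
  have "P (- h (xs 1)) \<longleftrightarrow> P (- a)"
    by (rule pos_cong) (use xs(2)[of 1] p1 in \<open>simp add: eq0_commute\<close>)
  then have "mv_less A (mv_zero A) (xs 1)" using a by (simp add: zero_less_iff xs(1))
  then obtain x where x: "x \<in> carrier A" "mv_le A (xs 1) (mv_mult A n x)" "mv_le A (mv_mult A n x) (xs n)"
    using regular n xs(1) less unfolding mv_regular_def by meson
  let ?y = "mv_mult A n x"
  have y: "?y \<in> carrier A" by (rule mult_closed[OF x(1)])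
  have "P (h ?y - h (xs 1))" "P (h (xs n) - h ?y)" using x y xs(1) by (simp_all add: mv_le_iff)
  moreover have "P (h ?y - h (xs 1)) \<longleftrightarrow> P (h ?y - a)"
    by (rule pos_cong) (use xs(2)[of 1] p1 in \<open>simp add: eq0_commute\<close>)
  moreover have "P (h (xs n) - h ?y) \<longleftrightarrow> P (b - h ?y)"
    by (rule pos_cong) (use xs(2)[of n] pn in simp)
  ultimately have y1: "P (h ?y - a)" "P (b - h ?y)" by blast+
  have "P (u - of_nat n * h x)"
  proof (rule ccontr)
    assume "\<not> ?thesis"
    then have "eq0 (h ?y - u)" using h_mult[OF x(1)] by blast
    then have "P (b - h ?y) \<longleftrightarrow> P (- (u - b))"
      by (intro pos_cong) (simp add: eq0_commute)
    with y1 bu show False by simp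
  qed
  then have e: "eq0 (h ?y - of_nat n * h x)" using h_mult[OF x(1)] by blast
  have "P (h ?y - a) \<longleftrightarrow> P (of_nat n * h x - a)"
    by (rule pos_cong) (use e in simp)
  moreover have "P (b - h ?y) \<longleftrightarrow> P (b - of_nat n * h x)"
    by (rule pos_cong) (use e in \<open>simp add: eq0_commute\<close>)
  ultimately show ?thesis using y1 by blast
qed

text \<open>With \<open>\<alpha> = k u + \<alpha>0\<close>, the multiple \<open>k u\<close> is approximated by \<open>n (k v)\<close> where \<open>n v\<close> is
  slightly below \<open>u\<close>, and the remainder by a multiple of \<open>n\<close> inside the unit interval.\<close>

lemma regular_nonneg:
  assumes n: "n \<ge> 2" and \<alpha>: "P \<alpha>" and \<alpha>\<beta>: "strict (\<beta> - \<alpha>)"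
  shows "\<exists>x. strict (of_nat n * x - \<alpha>) \<and> strict (\<beta> - of_nat n * x)"
proof -
  obtain N where "P (of_nat N * u - \<alpha>)" using unit_strong by blast
  from strict_add[OF unit_pos this] have N: "strict (of_nat (Suc N) * u - \<alpha>)" by (simp add: algebra_simps)
  \<comment> \<open>The least \<open>K\<close> with \<open>\<alpha> < K u\<close> is positive, and
    its predecessor \<open>k\<close> leaves a remainder \<alpha>0 from 0 to below
    \<open>u\<close>.\<close>
  define K where "K = (LEAST K. strict (of_nat K * u - \<alpha>))"
  have K: "strict (of_nat K * u - \<alpha>)" unfolding K_def using N by (rule LeastI)
  have "K \<noteq> 0" using K \<alpha> by (cases K) auto
  then obtain k where k: "K = Suc k" by (cases K) auto
  have "\<not> strict (of_nat k * u - \<alpha>)"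
    using not_less_Least[of k "\<lambda>K. strict (of_nat K * u - \<alpha>)"] k unfolding K_def by auto
  then have a0: "P (\<alpha> - of_nat k * u)" by simp
  define \<alpha>0 where "\<alpha>0 = \<alpha> - of_nat k * u"
  have a0u: "strict (u - \<alpha>0)" using K by (simp add: k \<alpha>0_def algebra_simps)
  obtain \<gamma> where \<gamma>: "strict \<gamma>" "P (\<beta> - \<alpha> - \<gamma>)" "P (u - \<alpha>0 - \<gamma>)"
    using strict_min[OF \<alpha>\<beta> a0u] by blast
  \<comment> \<open>The error \<open>k w\<close> will be at most \<open>k d\<close>, and
    \<open>n y\<close> will exceed \<alpha>' by an amount between \<open>d\<close> and
    \<open>2 d\<close>. So \<open>k + 4\<close> copies of \<open>d\<close> cover everything, with
    room to spare, below both gaps \<open>\<beta> - \<alpha>\<close> and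
    \<open>u - \<alpha>0\<close>.\<close>
  obtain d where d: "strict d" "strict (\<gamma> - of_nat (k + 4) * d)" using divide[OF \<gamma>(1)] by blast
  obtain d' where d': "strict d'" "strict (d - d')" using dense[OF d(1)] by blast
  have b1: "strict (\<beta> - \<alpha> - of_nat (k + 4) * d)" "strict (u - \<alpha>0 - of_nat (k + 4) * d)"
    using strict_add[OF d(2) \<gamma>(2)] strict_add[OF d(2) \<gamma>(3)] by (simp_all add: algebra_simps)
  have dk: "P (of_nat m * d)" for m by (intro pos_scale_nat strict_pos d)
  have "strict (u - d)"
    using strict_add[OF strict_add[OF b1(2) dk[of "k + 3"]] a0]
    by (simp add: \<alpha>0_def algebra_simps)
  then obtain v where v: "P (of_nat n * v - (u - d))" "P ((u - d') - of_nat n * v)"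
    using regular_interval[OF n, of "u - d" "u - d'"] d' by auto
  define w where "w = u - of_nat n * v"
  have w: "P w" "P (d - w)"
    using pos_add[OF v(2) strict_pos[OF d'(1)]] v(1) by (simp_all add: w_def algebra_simps)
  define \<alpha>' where "\<alpha>' = \<alpha>0 + of_nat k * w"
  have a': "P \<alpha>'" unfolding \<alpha>'_def \<alpha>0_def by (intro pos_add a0 pos_scale_nat w)
  have 1: "strict (\<alpha>' + d)" using strict_add[OF d(1) a'] by (simp add: algebra_simps)
  have "P (of_nat k * (d - w) + of_nat 2 * d)" by (intro pos_add pos_scale_nat w dk)
  from strict_add[OF b1(2) this] have 2: "strict (u - (\<alpha>' + of_nat 2 * d))"
    by (simp add: \<alpha>'_def algebra_simps)
  obtain y where y: "P (of_nat n * y - (\<alpha>' + d))" "P ((\<alpha>' + of_nat 2 * d) - of_nat n * y)"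
    using regular_interval[OF n 1 _ 2] d(1) by (auto simp: algebra_simps)
  define x where "x = of_nat k * v + y"
  have nx: "of_nat n * x = \<alpha> + (of_nat n * y - \<alpha>')"
  proof -
    have "of_nat k * (of_nat n * v) = of_nat k * u - of_nat k * w" by (simp add: w_def algebra_simps)
    moreover have "of_nat n * x = of_nat k * (of_nat n * v) + of_nat n * y" by (simp add: x_def algebra_simps)
    ultimately show ?thesis by (simp add: \<alpha>'_def \<alpha>0_def)
  qed
  have "strict (of_nat n * x - \<alpha>)"
    using strict_add[OF d(1) y(1)] unfolding nx by (simp add: algebra_simps)
  moreover have "strict (\<beta> - of_nat n * x)"
    using strict_add[OF strict_add[OF b1(1) y(2)] dk[of "k + 2"]]
    unfolding nx by (simp add: algebra_simps)
  ultimately show ?thesis by blast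
qed

lemma regularly_dense: "regularly_dense"
  unfolding regularly_dense_def
proof (intro allI impI)
  fix n :: int and a b assume n: "n \<ge> 1" and "\<not> P (a - b)"
  then have ab: "strict (b - a)" by simp
  have "\<exists>x. strict (of_nat (nat n) * x - a) \<and> strict (b - of_nat (nat n) * x)"
  proof (cases "n = 1")
    case True
    \<comment> \<open>Regularity starts at 2, so density takes care of \<open>n = 1\<close>.\<close>
    obtain d where "strict d" "strict (b - a - d)" using dense[OF ab] by blast
    with True show ?thesis by (intro exI[of _ "a + d"]) (simp add: algebra_simps)
  next
    case False
    then have n2: "nat n \<ge> 2" using n by simp
    obtain m where m: "P (of_nat m * u - (- a))" using unit_strong by blast
    \<comment> \<open>With \<open>m u\<close> at least \<open>- a\<close>, the shift by
      \<open>n m u\<close> makes the left end nonnegative and maps multiples of \<open>n\<close> to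
      multiples of \<open>n\<close>.\<close>
    let ?s = "of_nat (nat n) * (of_nat m * u)"
    have "nat n * m = m + (nat n - 1) * m" using n2 by (cases "nat n") auto
    then have "of_nat (nat n) * (of_nat m * u) = of_nat m * u + of_nat ((nat n - 1) * m) * u"
      by (metis distrib_right mult.assoc of_nat_add of_nat_mult)
    then have "a + ?s = (of_nat m * u - (- a)) + of_nat ((nat n - 1) * m) * u" by simp
    moreover have "P ((of_nat m * u - (- a)) + of_nat ((nat n - 1) * m) * u)"
      by (intro pos_add m pos_scale_nat unit_nonneg)
    ultimately have "P (a + ?s)" by (simp only:)
    moreover have "strict (b + ?s - (a + ?s))" using ab by simp
    ultimately obtain x where "strict (of_nat (nat n) * x - (a + ?s))" "strict (b + ?s - of_nat (nat n) * x)"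
      using regular_nonneg[OF n2] by blast
    then show ?thesis by (intro exI[of _ "x - of_nat m * u"]) (simp add: algebra_simps)
  qed
  then show "\<exists>x. \<not> P (a - of_int n * x) \<and> \<not> P (of_int n * x - b)" using n by auto
qed

end

section \<open>Sentences for the invariants\<close>

primrec mult_term :: "nat \<Rightarrow> mv_term \<Rightarrow> mv_term" where
  "mult_term 0 t = Zero"
| "mult_term (Suc n) t = Plus (mult_term n t) t"

lemma mult_term_val: "mv_term_val A e (mult_term n t) = mv_mult A n (mv_term_val A e t)"
  by (induction n) auto

lemma mult_term_vars: "mv_term_vars (mult_term n t) \<subseteq> mv_term_vars t"
  by (induction n) auto

lemma term_val_cong:
  "(\<And>i. i \<in> mv_term_vars t \<Longrightarrow> e i = d i) \<Longrightarrow> mv_term_val A e t = mv_term_val A d t"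
  by (induction t) auto

lemma sat_cong: "(\<And>i. i \<in> mv_fm_free f \<Longrightarrow> e i = d i) \<Longrightarrow> mv_sat A e f \<longleftrightarrow> mv_sat A d f"
proof (induction f arbitrary: e d)
  case (Eq s t)
  have "mv_term_val A e s = mv_term_val A d s" "mv_term_val A e t = mv_term_val A d t"
    by (rule term_val_cong; use Eq in simp)+
  then show ?case by simp
next
  case (FNot f)
  have "mv_sat A e f \<longleftrightarrow> mv_sat A d f" by (rule FNot.IH) (use FNot.prems in simp)
  then show ?case by simp
next
  case (FAnd f g)
  have "mv_sat A e f \<longleftrightarrow> mv_sat A d f" "mv_sat A e g \<longleftrightarrow> mv_sat A d g"
    by (rule FAnd.IH; use FAnd.prems in simp)+
  then show ?case by simp
next
  case (FEx i f)
  have "mv_sat A (e(i := a)) f \<longleftrightarrow> mv_sat A (d(i := a)) f" for a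
    by (rule FEx.IH) (use FEx.prems in auto)
  then show ?case by simp
qed

lemma elem_equiv_sat:
  assumes "mv_elem_equiv A B" "mv_fm_free f = {}"
    and "range e \<subseteq> carrier A" "range d \<subseteq> carrier B"
  shows "mv_sat A e f \<longleftrightarrow> mv_sat B d f"
proof -
  have "mv_models A f \<longleftrightarrow> mv_sat A e f"
    unfolding mv_models_def using sat_cong[of f _ e A] assms(2,3) by auto
  moreover have "mv_models B f \<longleftrightarrow> mv_sat B d f"
    unfolding mv_models_def using sat_cong[of f _ d B] assms(2,4) by auto
  ultimately show ?thesis using assms(1,2) unfolding mv_elem_equiv_def by blast
qed

text \<open>The equation \<open>n a = u\<close> is written as \<open>(n - 1) a = u - a\<close>,
  because the truncated multiple \<open>n.a\<close> equals 1 for every large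
  \<open>a\<close>.\<close>

definition fm_unit_divisible :: "nat \<Rightarrow> mv_fm" where
  "fm_unit_divisible n = FEx 0 (Eq (mult_term (n - 1) (Var 0)) (Neg (Var 0)))"

primrec fm_exs :: "nat \<Rightarrow> mv_fm \<Rightarrow> mv_fm" where
  "fm_exs 0 f = f"
| "fm_exs (Suc n) f = fm_exs n (FEx n f)"

primrec fm_conj :: "mv_fm list \<Rightarrow> mv_fm" where
  "fm_conj [] = Eq Zero Zero"
| "fm_conj (f # fs) = FAnd f (fm_conj fs)"

text \<open>Only differences that are nonnegative multiples of \<open>p\<close> are excluded;
  \<open>fm_incongruent_family\<close> runs through all ordered pairs and so covers both signs. The
  bound variable \<open>n\<close> is fresh there, as the family occupies the variables below
  \<open>n\<close>.\<close>

definition fm_incongruent :: "nat \<Rightarrow> nat \<Rightarrow> nat \<Rightarrow> nat \<Rightarrow> mv_fm" where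
  "fm_incongruent p n i j = FNot (FEx n (Eq (Var i) (Plus (Var j) (mult_term p (Var n)))))"

definition fm_incongruent_family :: "nat \<Rightarrow> nat \<Rightarrow> mv_fm" where
  "fm_incongruent_family p n =
     fm_exs n (fm_conj [fm_incongruent p n i j. i \<leftarrow> [0..<n], j \<leftarrow> [0..<n], i \<noteq> j])"

lemma free_fm_exs: "mv_fm_free (fm_exs n f) = mv_fm_free f - {..<n}"
  by (induction n arbitrary: f) (auto simp: less_Suc_eq)

lemma sat_fm_exs:
  "mv_sat A e (fm_exs n f) \<longleftrightarrow>
     (\<exists>a. (\<forall>i<n. a i \<in> carrier A) \<and> mv_sat A (\<lambda>i. if i < n then a i else e i) f)"
proof (induction n arbitrary: f)
  case 0
  then show ?case by simp
next
  case (Suc n)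
  have upd: "(\<lambda>i. if i < n then a i else e i)(n := b) = (\<lambda>i. if i < Suc n then (a(n := b)) i else e i)"
    for a b by (auto simp: fun_eq_iff)
  have upd': "(\<lambda>i. if i < n then a i else e i)(n := a n) = (\<lambda>i. if i < Suc n then a i else e i)" for a
    by (auto simp: fun_eq_iff)
  show ?case
  proof
    assume "mv_sat A e (fm_exs (Suc n) f)"
    then obtain a b where ab: "\<forall>i<n. a i \<in> carrier A" "b \<in> carrier A"
      "mv_sat A ((\<lambda>i. if i < n then a i else e i)(n := b)) f"
      by (auto simp: Suc)
    then show "\<exists>a. (\<forall>i<Suc n. a i \<in> carrier A) \<and> mv_sat A (\<lambda>i. if i < Suc n then a i else e i) f"
      unfolding upd by (intro exI[of _ "a(n := b)"]) (auto simp: less_Suc_eq)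
  next
    assume "\<exists>a. (\<forall>i<Suc n. a i \<in> carrier A) \<and> mv_sat A (\<lambda>i. if i < Suc n then a i else e i) f"
    then obtain a where a: "\<forall>i<Suc n. a i \<in> carrier A" "mv_sat A (\<lambda>i. if i < Suc n then a i else e i) f"
      by blast
    have "(\<forall>i<n. a i \<in> carrier A) \<and> (\<exists>b\<in>carrier A. mv_sat A ((\<lambda>i. if i < n then a i else e i)(n := b)) f)"
      using a(2)[folded upd'] a(1) by (intro conjI bexI[of _ "a n"]) auto
    then show "mv_sat A e (fm_exs (Suc n) f)"
      unfolding fm_exs.simps Suc mv_sat.simps by blast
  qed
qed

lemma sat_fm_conj: "mv_sat A e (fm_conj fs) \<longleftrightarrow> (\<forall>f\<in>set fs. mv_sat A e f)"
  by (induction fs) auto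

lemma free_fm_conj: "mv_fm_free (fm_conj fs) = (\<Union>f\<in>set fs. mv_fm_free f)"
  by (induction fs) auto

lemma free_fm_unit_divisible: "mv_fm_free (fm_unit_divisible n) = {}"
  using mult_term_vars[of "n - 1" "Var 0"] by (auto simp: fm_unit_divisible_def)

lemma free_fm_incongruent_family: "mv_fm_free (fm_incongruent_family p n) = {}"
  using mult_term_vars[of p "Var n"]
  by (auto simp: fm_incongruent_family_def free_fm_exs free_fm_conj fm_incongruent_def)

lemma sat_fm_unit_divisible:
  "mv_sat A e (fm_unit_divisible n) \<longleftrightarrow> (\<exists>a\<in>carrier A. mv_mult A (n - 1) a = mv_neg A a)"
  by (simp add: fm_unit_divisible_def mult_term_val)

lemma sat_fm_incongruent_family:
  "mv_sat A e (fm_incongruent_family p n) \<longleftrightarrow>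
     (\<exists>a. (\<forall>i<n. a i \<in> carrier A) \<and>
        (\<forall>i<n. \<forall>j<n. i \<noteq> j \<longrightarrow> \<not> (\<exists>b\<in>carrier A. a i = a j \<boxplus>\<^bsub>A\<^esub> mv_mult A p b)))"
  unfolding fm_incongruent_family_def sat_fm_exs sat_fm_conj
  by (intro arg_cong[of _ _ Ex] ext conj_cong refl)
    (auto simp: fm_incongruent_def mult_term_val)

section \<open>What the sentences say about the group\<close>

context mv_presentation
begin

lemma eq0_of_nat_scale_iff: "n \<ge> 1 \<Longrightarrow> eq0 (of_nat n * x) \<longleftrightarrow> eq0 x"
  using eq0_scale_iff[of "int n" x] by simp

lemma eq0_of_nat_scale: "eq0 x \<Longrightarrow> eq0 (of_nat n * x)"
  using eq0_scale[of x "int n"] by simp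

lemma dv_unit_iff:
  assumes n: "n \<ge> 1"
  shows "dv (int n) u \<longleftrightarrow> (\<exists>a\<in>carrier A. mv_mult A (n - 1) a = mv_neg A a)"
proof
  assume "dv (int n) u"
  then obtain y where y: "eq0 (u - of_nat n * y)" by (auto simp: dv_def)
  have nn: "of_nat n * y = y + of_nat (n - 1) * y"
    using n by (cases n) (simp_all add: algebra_simps)
  have "P (of_int (int n) * y)"
    using pos_cong[OF y] unit_nonneg by simp
  then have py: "P y" using pos_scale_iff[of "int n" y] n by simp
  have "P (u - y) \<longleftrightarrow> P (of_nat (n - 1) * y)"
    by (rule pos_cong) (use y in \<open>simp add: nn diff_diff_eq\<close>)
  then have "P (u - y)" using pos_scale_nat[OF py] by blast
  then obtain a where a: "a \<in> carrier A" "eq0 (h a - y)" using h_surj py by blast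
  have e: "eq0 (of_nat (n - 1) * h a - (u - h a))"
  proof -
    have "of_nat (n - 1) * h a - (u - h a) = of_nat n * (h a - y) - (u - of_nat n * y)"
      using n by (cases n) (simp_all add: algebra_simps)
    then show ?thesis using eq0_diff[OF eq0_of_nat_scale[OF a(2)] y] by metis
  qed
  have "P (u - of_nat (n - 1) * h a) \<longleftrightarrow> P (h a)"
    by (rule pos_cong) (use e eq0_commute in \<open>simp add: algebra_simps\<close>)
  then have "eq0 (h (mv_mult A (n - 1) a) - of_nat (n - 1) * h a)"
    using h_mult[OF a(1)] h_nonneg[OF a(1)] by blast
  from eq0_trans[OF eq0_trans[OF this e]] h_neg[OF a(1)]
  have "eq0 (h (mv_mult A (n - 1) a) - h (mv_neg A a))" using eq0_commute by blast
  then have "mv_mult A (n - 1) a = mv_neg A a"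
    using h_inj mult_closed a(1) closed by blast
  then show "\<exists>a\<in>carrier A. mv_mult A (n - 1) a = mv_neg A a" using a(1) by blast
next
  assume "\<exists>a\<in>carrier A. mv_mult A (n - 1) a = mv_neg A a"
  then obtain a where a: "a \<in> carrier A" "mv_mult A (n - 1) a = mv_neg A a" by blast
  have hn: "eq0 (h (mv_mult A (n - 1) a) - (u - h a))" using h_neg a by simp
  show "dv (int n) u"
  proof (cases "P (u - of_nat (n - 1) * h a)")
    case True
    then have "eq0 (h (mv_mult A (n - 1) a) - of_nat (n - 1) * h a)" using h_mult a(1) by blast
    from eq0_diff[OF this hn] have "eq0 (u - of_nat n * h a)"
      using n by (cases n) (simp_all add: algebra_simps)
    then show ?thesis unfolding dv_def by auto
  next
    case False
    \<comment> \<open>Truncation would give \<open>u = u - a\<close>, so \<open>a\<close> would be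
      0, whose multiples are never truncated.\<close>
    then have "eq0 (h (mv_mult A (n - 1) a) - u)" using h_mult a(1) by blast
    from eq0_diff[OF hn this] have "eq0 (h a)" by simp
    then have "eq0 (of_nat (n - 1) * h a)" by (rule eq0_of_nat_scale)
    then have "P (u - of_nat (n - 1) * h a) \<longleftrightarrow> P u" by (intro pos_cong) simp
    with False unit_nonneg show ?thesis by blast
  qed
qed

text \<open>The multiple \<open>p y\<close> is a nonnegative difference of two elements of the
  interval, hence at most \<open>u\<close>; so \<open>y\<close> is in the interval as well and no
  sum is truncated.\<close>

lemma congruent_witness:
  assumes a: "a \<in> carrier A" and b: "b \<in> carrier A" and p: "p \<ge> 1"
    and e: "eq0 (h a - h b - of_nat p * y)" and y: "P y"
  shows "\<exists>c\<in>carrier A. a = b \<boxplus> mv_mult A p c"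
proof -
  have "P (u - of_nat p * y)"
  proof -
    have "P ((u - h a) + h b)" by (intro pos_add h_le_unit h_nonneg a b)
    moreover have "P ((u - h a) + h b) \<longleftrightarrow> P (u - of_nat p * y)"
      by (rule pos_cong) (use e eq0_commute[of "h a - h b" "of_nat p * y"] in \<open>simp add: algebra_simps\<close>)
    ultimately show ?thesis by blast
  qed
  from pos_add[OF this pos_scale_nat[OF y, of "p - 1"]] p have "P (u - y)"
    by (cases p) (simp_all add: algebra_simps)
  then obtain c where c: "c \<in> carrier A" "eq0 (h c - y)" using h_surj y by blast
  have e1: "eq0 (of_nat p * h c - of_nat p * y)"
    using eq0_of_nat_scale[OF c(2), of p] by (simp add: algebra_simps)
  have "P (u - of_nat p * h c) \<longleftrightarrow> P (u - of_nat p * y)"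
    by (rule pos_cong) (use e1 eq0_commute in \<open>simp add: algebra_simps\<close>)
  then have e2: "eq0 (h (mv_mult A p c) - of_nat p * h c)"
    using h_mult[OF c(1)] \<open>P (u - of_nat p * y)\<close> by blast
  let ?d = "mv_mult A p c"
  have d: "?d \<in> carrier A" by (rule mult_closed[OF c(1)])
  have s: "eq0 (h b + h ?d - h a)"
    using eq0_diff[OF eq0_trans[OF e2 e1] e] by (simp add: algebra_simps)
  have "P (u - (h b + h ?d)) \<longleftrightarrow> P (u - h a)"
    by (rule pos_cong) (use s eq0_commute[of "h a" "h b + h ?d"] in \<open>simp add: algebra_simps\<close>)
  then have "eq0 (h (b \<boxplus> ?d) - (h b + h ?d))" using h_plus[OF b d] h_le_unit[OF a] by blast
  from eq0_trans[OF this s] have "b \<boxplus> ?d = a" by (rule h_inj[OF plus_closed[OF b d] a])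
  with c(1) show ?thesis by blast
qed

text \<open>For \<open>a = 1\<close> the equation could be due to truncation and would prove
  nothing; \<open>strict (u - h a)\<close> rules this out.\<close>

lemma congruent_if_witness:
  assumes a: "a \<in> carrier A" and b: "b \<in> carrier A" and c: "c \<in> carrier A" and p: "p \<ge> 1"
    and eq: "a = b \<boxplus> mv_mult A p c" and less: "strict (u - h a)"
  shows "dv (int p) (h a - h b)"
proof -
  let ?d = "mv_mult A p c"
  have d: "?d \<in> carrier A" by (rule mult_closed[OF c])
  have nu: "\<not> eq0 (h a - u)" using less by (auto simp: eq0_def)
  then have s: "eq0 (h a - (h b + h ?d))"
    using h_plus[OF b d] h_plus_trunc[OF b d] eq by metis
  have "P (u - of_nat p * h c)"
  proof (rule ccontr)
    assume "\<not> ?thesis"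
    then have e: "eq0 (h ?d - u)" using h_mult[OF c] by blast
    have "eq0 (h a - u - h b)" using eq0_add[OF s e] by (simp add: algebra_simps)
    then have "P (h a - u) \<longleftrightarrow> P (h b)" by (rule pos_cong)
    then show False using less h_nonneg[OF b] by simp
  qed
  then have "eq0 (h ?d - of_nat p * h c)" using h_mult[OF c] by blast
  from eq0_add[OF s this] have "eq0 (h a - h b - of_int (int p) * h c)" by (simp add: algebra_simps)
  then show ?thesis unfolding dv_def by blast
qed

text \<open>From a family in the group, representatives strictly below \<open>u\<close> have to be
  chosen, because for them the truncated equation does mean congruence. Conversely a congruence of
  either sign yields a witness, so incongruence in the algebra carries over as it is.\<close>

lemma incongruent_family_iff:
  assumes p: "p \<ge> 1" and dense: "regularly_dense"
  shows "incongruent_family (int p) n \<longleftrightarrow>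
    (\<exists>a. (\<forall>i<n. a i \<in> carrier A) \<and>
        (\<forall>i<n. \<forall>j<n. i \<noteq> j \<longrightarrow> \<not> (\<exists>b\<in>carrier A. a i = a j \<boxplus> mv_mult A p b)))"
proof
  assume "incongruent_family (int p) n"
  then obtain x where x: "\<And>i j. i < n \<Longrightarrow> j < n \<Longrightarrow> i \<noteq> j \<Longrightarrow> \<not> dv (int p) (x i - x j)"
    unfolding incongruent_family_def by blast
  have "\<exists>a. a \<in> carrier A \<and> dv (int p) (h a - x i) \<and> strict (u - h a)" for i
  proof -
    \<comment> \<open>Adding a multiple of \<open>p\<close> from the interval between
      \<open>- x i\<close> and \<open>u - x i\<close> moves \<open>x i\<close> strictly between 0
      and \<open>u\<close>.\<close>
    have "\<not> P (- x i - (u - x i))" using unit_pos by simp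
    moreover have "int p \<ge> 1" using p by simp
    ultimately obtain y where y: "\<not> P (- x i - of_int (int p) * y)" "\<not> P (of_int (int p) * y - (u - x i))"
      using dense unfolding regularly_dense_def by blast
    let ?z = "x i + of_nat p * y"
    have z: "strict ?z" "strict (u - ?z)" using y by (simp_all add: algebra_simps)
    then obtain a where a: "a \<in> carrier A" "eq0 (h a - ?z)" using h_surj[of ?z] strict_pos by blast
    have "- (u - h a) - - (u - ?z) = h a - ?z" by simp
    then have "P (- (u - h a)) \<longleftrightarrow> P (- (u - ?z))" using a(2) by (intro pos_cong) (simp only:)
    moreover have "dv (int p) (h a - x i) \<longleftrightarrow> dv (int p) (of_int (int p) * y)"
      by (rule dv_cong) (use a(2) in \<open>simp add: diff_diff_eq\<close>)
    ultimately show ?thesis using a z(2) dv_self[of "int p" y] by blast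
  qed
  then obtain a where a: "\<And>i. a i \<in> carrier A" "\<And>i. dv (int p) (h (a i) - x i)"
    "\<And>i. strict (u - h (a i))" by metis
  show "\<exists>a. (\<forall>i<n. a i \<in> carrier A) \<and>
        (\<forall>i<n. \<forall>j<n. i \<noteq> j \<longrightarrow> \<not> (\<exists>b\<in>carrier A. a i = a j \<boxplus> mv_mult A p b))"
  proof (intro exI[of _ a] conjI allI impI notI)
    fix i j assume ij: "i < n" "j < n" "i \<noteq> j" and "\<exists>b\<in>carrier A. a i = a j \<boxplus> mv_mult A p b"
    then have 1: "dv (int p) (h (a i) - h (a j))" using congruent_if_witness a p by metis
    have "dv (int p) (x i - x j)"
      using dv_trans[OF dv_trans[OF _ 1] a(2)[of j]] a(2)[of i] dv_commute by blast
    with x ij show False by blast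
  qed (use a in auto)
next
  assume "\<exists>a. (\<forall>i<n. a i \<in> carrier A) \<and>
        (\<forall>i<n. \<forall>j<n. i \<noteq> j \<longrightarrow> \<not> (\<exists>b\<in>carrier A. a i = a j \<boxplus> mv_mult A p b))"
  then obtain a where a: "\<And>i. i < n \<Longrightarrow> a i \<in> carrier A"
    "\<And>i j. i < n \<Longrightarrow> j < n \<Longrightarrow> i \<noteq> j \<Longrightarrow> \<not> (\<exists>b\<in>carrier A. a i = a j \<boxplus> mv_mult A p b)" by blast
  have "\<not> dv (int p) (h (a i) - h (a j))" if ij: "i < n" "j < n" "i \<noteq> j" for i j
  proof
    assume "dv (int p) (h (a i) - h (a j))"
    then obtain y where y: "eq0 (h (a i) - h (a j) - of_nat p * y)" by (auto simp: dv_def)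
    have y': "eq0 (h (a j) - h (a i) - of_nat p * (- y))"
      using eq0_minus[of "h (a i) - h (a j) - of_nat p * y"] y by (simp add: algebra_simps del: eq0_minus)
    consider "P y" | "P (- y)" using pos_total by blast
    then show False
    proof cases
      case 1
      from congruent_witness[OF a(1)[OF ij(1)] a(1)[OF ij(2)] p y this] a(2)[OF ij] show False by blast
    next
      case 2
      from congruent_witness[OF a(1)[OF ij(2)] a(1)[OF ij(1)] p y' this] a(2)[of j i] ij show False by blast
    qed
  qed
  then show "incongruent_family (int p) n"
    unfolding incongruent_family_def by (intro exI[of _ "\<lambda>i. h (a i)"]) simp
qed

end

locale dense_mv_presentation_pair = mv_presentation_pair +
  assumes dense_A: "A.regularly_dense" and dense_B: "B.regularly_dense"
begin

lemma elem_equiv_invariants: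
  assumes "mv_elem_equiv A B"
  shows "n \<ge> 1 \<Longrightarrow> A.dv (int n) u \<longleftrightarrow> B.dv (int n) v"
    and "p \<ge> 1 \<Longrightarrow> A.incongruent_family (int p) n \<longleftrightarrow> B.incongruent_family (int p) n"
proof -
  have eA: "range (\<lambda>_. mv_zero A) \<subseteq> carrier A" and eB: "range (\<lambda>_. mv_zero B) \<subseteq> carrier B"
    using A.zero_closed B.zero_closed by auto
  note sat = elem_equiv_sat[OF assms _ eA eB]
  show "A.dv (int n) u \<longleftrightarrow> B.dv (int n) v" if "n \<ge> 1"
    using sat[OF free_fm_unit_divisible, of n]
    unfolding A.dv_unit_iff[OF that] B.dv_unit_iff[OF that] sat_fm_unit_divisible .
  show "A.incongruent_family (int p) n \<longleftrightarrow> B.incongruent_family (int p) n" if "p \<ge> 1"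
    using sat[OF free_fm_incongruent_family, of p n]
    unfolding A.incongruent_family_iff[OF that dense_A] B.incongruent_family_iff[OF that dense_B]
      sat_fm_incongruent_family .
qed

end

section \<open>Torsion elements\<close>

context mv_presentation
begin

lemma h_odot:
  assumes a: "a \<in> carrier A" and b: "b \<in> carrier A" and ab: "P (h a + h b - u)"
  shows "eq0 (h (a \<boxdot> b) - (h a + h b - u))"
proof -
  let ?x = "mv_neg A a" and ?y = "mv_neg A b"
  have x: "?x \<in> carrier A" "?y \<in> carrier A" using a b closed by auto
  have s: "eq0 (h ?x + h ?y - (u - (h a + h b - u)))"
    using eq0_add[OF h_neg[OF a] h_neg[OF b]] by (simp add: algebra_simps)
  have "u - (h ?x + h ?y) - (h a + h b - u) = - (h ?x + h ?y - (u - (h a + h b - u)))" by simp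
  then have "P (u - (h ?x + h ?y)) \<longleftrightarrow> P (h a + h b - u)"
    using s by (intro pos_cong) (simp only: eq0_minus)
  then have "eq0 (h (?x \<boxplus> ?y) - (h ?x + h ?y))" using h_plus[OF x] ab by blast
  from eq0_diff[OF h_neg[OF plus_closed[OF x]] eq0_trans[OF this s]]
  show ?thesis unfolding mv_odot_def by (simp add: algebra_simps)
qed

text \<open>The rational value \<open>k / n\<close> of \<open>a\<close> in units of
  \<open>u\<close>. The pair need not be reduced, so that values can be brought to a common
  denominator.\<close>

definition fraction :: "'a \<Rightarrow> nat \<Rightarrow> nat \<Rightarrow> bool" where
  "fraction a k n \<longleftrightarrow> n \<ge> 1 \<and> eq0 (of_nat n * h a - of_nat k * u)"

lemma eq0_unit_multiple: assumes "eq0 (of_nat j * u - of_nat k * u)" shows "j = k"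
proof (rule ccontr)
  assume "j \<noteq> k"
  moreover have "eq0 (of_int (int j - int k) * u)" using assms by (simp add: algebra_simps)
  ultimately have "eq0 u" using eq0_scale_iff[of "int j - int k" u] by simp
  with unit_pos show False by (simp add: eq0_def)
qed

lemma pos_unit_multiple: "P (of_nat j * u - of_nat k * u) \<longleftrightarrow> k \<le> j"
proof (cases "k \<le> j")
  case True
  then have "of_nat j * u - of_nat k * u = of_nat (j - k) * u" by (simp add: algebra_simps)
  with True pos_scale_nat[OF unit_nonneg] show ?thesis by metis
next
  case False
  then have "of_nat j * u - of_nat k * u = - (of_nat (k - j) * u)" by (simp add: algebra_simps)
  with False strict_scale[OF unit_pos, of "k - j"] show ?thesis by simp
qed

lemma fraction_scale: assumes "fraction a k n" shows "eq0 (of_nat (m * n) * h a - of_nat (m * k) * u)"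
  using eq0_of_nat_scale[of "of_nat n * h a - of_nat k * u" m] assms
  by (simp add: fraction_def algebra_simps)

lemma fraction_mult: "fraction a k n \<Longrightarrow> m \<ge> 1 \<Longrightarrow> fraction a (m * k) (m * n)"
  using fraction_scale[of a k n m] by (simp add: fraction_def)

lemma fraction_unique: assumes "fraction a k n" "fraction a k' n'" shows "n' * k = n * k'"
proof -
  have "eq0 (of_nat (n' * k) * u - of_nat (n * k') * u)"
    using eq0_diff[OF fraction_scale[OF assms(2), of n] fraction_scale[OF assms(1), of n']]
    by (simp add: algebra_simps)
  then show ?thesis by (rule eq0_unit_multiple)
qed

lemma fraction_cong:
  assumes "fraction a j m" "n \<ge> 1" "n * j = m * k"
  shows "fraction a k n"
proof -
  have "of_nat n * of_nat j = (of_nat m * of_nat k :: 'r)" using assms(3) by (metis of_nat_mult)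
  then have "of_nat m * (of_nat n * h a - of_nat k * u) = of_nat n * (of_nat m * h a - of_nat j * u)"
    by (simp add: algebra_simps)
  moreover have "eq0 (of_nat n * (of_nat m * h a - of_nat j * u))"
    using assms(1) eq0_of_nat_scale by (simp add: fraction_def)
  ultimately have "eq0 (of_nat m * (of_nat n * h a - of_nat k * u))" by (simp only:)
  with assms(1,2) show ?thesis using eq0_of_nat_scale_iff by (simp add: fraction_def)
qed

lemma fraction_inj:
  assumes "a \<in> carrier A" "b \<in> carrier A" "fraction a k n" "fraction b k n"
  shows "a = b"
proof -
  have "eq0 (of_nat n * (h a - h b))"
    using eq0_diff[of "of_nat n * h a - of_nat k * u" "of_nat n * h b - of_nat k * u"] assms
    by (simp add: fraction_def algebra_simps)
  then show ?thesis using eq0_of_nat_scale_iff[of n "h a - h b"] assms h_inj by (simp add: fraction_def)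
qed

lemma fraction_zero: "fraction (mv_zero A) 0 1" and fraction_one: "fraction (mv_one A) 1 1"
  using h_zero h_one by (simp_all add: fraction_def)

lemma fraction_le: assumes "a \<in> carrier A" "fraction a k n" shows "k \<le> n"
proof -
  have "P (of_nat n * u - of_nat k * u) \<longleftrightarrow> P (of_nat n * (u - h a))"
    by (rule pos_cong) (use assms(2) in \<open>simp add: fraction_def algebra_simps\<close>)
  then show ?thesis using pos_scale_nat[OF h_le_unit[OF assms(1)]] pos_unit_multiple by blast
qed

lemma fraction_neg:
  assumes "a \<in> carrier A" "fraction a k n"
  shows "fraction (mv_neg A a) (n - k) n"
proof -
  have "of_nat n * h (mv_neg A a) - of_nat (n - k) * u =
      of_nat n * (h (mv_neg A a) - (u - h a)) - (of_nat n * h a - of_nat k * u)"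
    using fraction_le[OF assms] by (simp add: of_nat_diff algebra_simps)
  then show ?thesis
    using eq0_diff[OF eq0_of_nat_scale[OF h_neg[OF assms(1)], of n]] assms(2)
    by (simp add: fraction_def)
qed

lemma fraction_plus:
  assumes a: "a \<in> carrier A" and b: "b \<in> carrier A" and f: "fraction a j n" "fraction b k n"
  shows "fraction (a \<boxplus> b) (min (j + k) n) n"
proof -
  have n: "n \<ge> 1" using f by (simp add: fraction_def)
  have s: "eq0 (of_nat n * (h a + h b) - of_nat (j + k) * u)"
    using eq0_add[of "of_nat n * h a - of_nat j * u" "of_nat n * h b - of_nat k * u"] f
    by (simp add: fraction_def algebra_simps)
  have "P (u - (h a + h b)) \<longleftrightarrow> P (of_nat n * (u - (h a + h b)))"
    using pos_scale_iff[of "int n"] n by simp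
  also have "\<dots> \<longleftrightarrow> P (of_nat n * u - of_nat (j + k) * u)"
    by (rule pos_cong) (use s eq0_commute in \<open>simp add: algebra_simps\<close>)
  also have "\<dots> \<longleftrightarrow> j + k \<le> n" by (rule pos_unit_multiple)
  finally have c: "P (u - (h a + h b)) \<longleftrightarrow> j + k \<le> n" .
  show ?thesis
  proof (cases "j + k \<le> n")
    case True
    then have "eq0 (of_nat n * (h (a \<boxplus> b) - (h a + h b)))"
      using h_plus[OF a b] c eq0_of_nat_scale by blast
    from eq0_add[OF this s] True n show ?thesis by (simp add: fraction_def algebra_simps)
  next
    case False
    then have "eq0 (of_nat n * (h (a \<boxplus> b) - u))"
      using h_plus_trunc[OF a b] c eq0_of_nat_scale by blast
    with False n show ?thesis by (simp add: fraction_def algebra_simps)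
  qed
qed

lemma mult_eq_one_if_fraction:
  assumes a: "a \<in> carrier A" and f: "fraction a k n" and k: "k \<ge> 1"
  shows "mv_mult A n a = mv_one A"
proof -
  have "eq0 (h (mv_mult A n a) - u)"
  proof (cases "P (u - of_nat n * h a)")
    case True
    have e: "eq0 (of_nat n * h a - of_nat k * u)" using f by (simp add: fraction_def)
    have "P (of_nat n * h a - u) \<longleftrightarrow> P (of_nat k * u - of_nat 1 * u)"
      by (rule pos_cong) (use e in simp)
    then have "P (of_nat n * h a - u)" using k pos_unit_multiple by blast
    with True have "eq0 (of_nat n * h a - u)" by (simp add: eq0_def)
    with True h_mult[OF a] eq0_trans show ?thesis by blast
  qed (use h_mult[OF a] in blast)
  then show ?thesis using eq_one_iff mult_closed[OF a] by blast
qed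

lemma pow_eq_neg_mult: assumes "a \<in> carrier A" shows "mv_pow A a n = mv_neg A (mv_mult A n (mv_neg A a))"
proof (induction n)
  case (Suc n)
  then show ?case
    using assms by (simp add: mv_odot_def neg_neg mult_closed closed)
qed (simp add: mv_one_def)

text \<open>Cyclic addition keeps the representative below \<open>u\<close>, and \<open>k\<close>
  counts the units dropped so far.\<close>

lemma cyc_mult_fraction:
  assumes a: "a \<in> carrier A" and a1: "strict (u - h a)"
  shows "mv_cyc_mult A n a \<in> carrier A \<and> strict (u - h (mv_cyc_mult A n a)) \<and>
    (\<exists>k. eq0 (of_nat n * h a - h (mv_cyc_mult A n a) - of_nat k * u))"
proof (induction n)
  case 0
  have "P (- (u - h (mv_zero A))) \<longleftrightarrow> P (- u)" by (rule pos_cong) (use h_zero in simp)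
  then show ?case using h_zero unit_pos by (auto simp: closed intro!: exI[of _ 0])
next
  case (Suc n)
  let ?b = "mv_cyc_mult A n a"
  obtain k where b: "?b \<in> carrier A" "strict (u - h ?b)" "eq0 (of_nat n * h a - h ?b - of_nat k * u)"
    using Suc by blast
  show ?case
  proof (cases "?b \<boxplus> a = mv_one A")
    case True
    then have e: "eq0 (h (?b \<boxdot> a) - (h ?b + h a - u))"
      using h_odot[OF b(1) a] plus_eq_one_iff[OF b(1) a] by blast
    have "P (- (u - h (?b \<boxdot> a))) \<longleftrightarrow> P (- ((u - h ?b) + (u - h a)))"
      by (rule pos_cong) (use e in \<open>simp add: algebra_simps\<close>)
    moreover have "strict ((u - h ?b) + (u - h a))" by (rule strict_add[OF b(2) strict_pos[OF a1]])
    moreover have "eq0 (of_nat (Suc n) * h a - h (?b \<boxdot> a) - of_nat (Suc k) * u)"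
      using eq0_diff[OF b(3) e] by (simp add: algebra_simps)
    moreover have "mv_cyc_mult A (Suc n) a = ?b \<boxdot> a" using True by (simp add: mv_cyc_add_def)
    ultimately show ?thesis using odot_closed[OF b(1) a] by metis
  next
    case False
    then have "\<not> P (h ?b + h a - u)" using plus_eq_one_iff[OF b(1) a] by blast
    then have lt: "strict (u - (h ?b + h a))" by simp
    have e: "eq0 (h (?b \<boxplus> a) - (h ?b + h a))"
      using h_plus[OF b(1) a strict_pos[OF lt]] .
    have "P (- (u - h (?b \<boxplus> a))) \<longleftrightarrow> P (- (u - (h ?b + h a)))"
      by (rule pos_cong) (use e in \<open>simp add: algebra_simps\<close>)
    moreover have "eq0 (of_nat (Suc n) * h a - h (?b \<boxplus> a) - of_nat k * u)"
      using eq0_diff[OF b(3) e] by (simp add: algebra_simps)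
    ultimately show ?thesis using False b a lt by (auto simp: mv_cyc_add_def closed)
  qed
qed

text \<open>A vanishing cyclic multiple says that \<open>n a\<close> consists exactly of the units
  dropped. Conversely let \<open>n a = k u\<close> with \<open>0 < k < n\<close>. Then
  \<open>k \<ge> 1\<close> gives the equation for the multiple, duality gives the one for the power,
  and the cyclic multiple is a multiple of \<open>u\<close> from 0 to below \<open>u\<close>, hence
  0.\<close>

lemma torsion_part_carrier:
  "carrier (mv_torsion_part A) = {a \<in> carrier A. \<exists>k n. fraction a k n}"
proof -
  have "a \<in> mv_torsion A \<union> {mv_zero A, mv_one A} \<longleftrightarrow> a \<in> carrier A \<and> (\<exists>k n. fraction a k n)" for a
  proof
    assume "a \<in> mv_torsion A \<union> {mv_zero A, mv_one A}"
    then consider "a = mv_zero A" | "a = mv_one A" | "a \<in> mv_torsion A" "a \<noteq> mv_one A" by blast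
    then show "a \<in> carrier A \<and> (\<exists>k n. fraction a k n)"
    proof cases
      case 3
      then obtain n where n: "a \<in> carrier A" "n \<ge> 1" "mv_cyc_mult A n a = mv_zero A"
        by (auto simp: mv_torsion_def)
      have "strict (u - h a)"
        using mv_less_iff[OF n(1) one_closed] le_one[OF n(1)] 3 eq_one_iff[OF n(1)] h_le_unit[OF n(1)]
        by (auto simp: eq0_def)
      then obtain k where "eq0 (of_nat n * h a - h (mv_zero A) - of_nat k * u)"
        using cyc_mult_fraction[OF n(1), of n] n(3) by auto
      from eq0_add[OF this h_zero] n show ?thesis by (auto simp: fraction_def algebra_simps)
    qed (use fraction_zero fraction_one closed in blast)+
  next
    assume "a \<in> carrier A \<and> (\<exists>k n. fraction a k n)"
    then obtain k n where a: "a \<in> carrier A" "fraction a k n" by blast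
    then have n: "n \<ge> 1" by (simp add: fraction_def)
    show "a \<in> mv_torsion A \<union> {mv_zero A, mv_one A}"
    proof (cases "a = mv_zero A \<or> a = mv_one A")
      case False
      have "k \<noteq> 0"
      proof
        assume "k = 0"
        then have "fraction a 0 1" using a(2) eq0_of_nat_scale_iff[of n "h a"] by (simp add: fraction_def)
        then show False using fraction_inj[OF a(1) zero_closed _ fraction_zero] False by blast
      qed
      then have 1: "mv_mult A n a = mv_one A" using mult_eq_one_if_fraction[OF a] by simp
      have kn: "k \<le> n" by (rule fraction_le[OF a])
      have "k \<noteq> n"
      proof
        assume "k = n"
        then have "fraction a 1 1" using a(2) eq0_of_nat_scale_iff[of n "h a - u"] n
          by (simp add: fraction_def algebra_simps)
        then show False using fraction_inj[OF a(1) one_closed _ fraction_one] False by blast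
      qed
      then have "mv_mult A n (mv_neg A a) = mv_one A"
        using mult_eq_one_if_fraction[OF _ fraction_neg[OF a]] kn a(1) closed by simp
      then have 2: "mv_pow A a n = mv_zero A" by (simp add: pow_eq_neg_mult a(1) neg_one)
      have "strict (u - h a)"
        using False eq_one_iff[OF a(1)] h_le_unit[OF a(1)] by (auto simp: eq0_def)
      then obtain j where c: "mv_cyc_mult A n a \<in> carrier A" "strict (u - h (mv_cyc_mult A n a))"
        "eq0 (of_nat n * h a - h (mv_cyc_mult A n a) - of_nat j * u)"
        using cyc_mult_fraction[OF a(1)] by blast
      have e: "eq0 (h (mv_cyc_mult A n a) - (of_nat k * u - of_nat j * u))"
        using eq0_diff[of "of_nat n * h a - of_nat k * u", OF _ c(3)] a(2)
        by (simp add: fraction_def algebra_simps)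
      have "P (h (mv_cyc_mult A n a)) \<longleftrightarrow> P (of_nat k * u - of_nat j * u)"
        by (rule pos_cong[OF e])
      then have "j \<le> k" using h_nonneg[OF c(1)] pos_unit_multiple by blast
      have "P (- (u - h (mv_cyc_mult A n a))) \<longleftrightarrow> P (of_nat k * u - of_nat (Suc j) * u)"
        by (rule pos_cong) (use e in \<open>simp add: algebra_simps\<close>)
      then have "k \<le> j" using c(2) pos_unit_multiple[of k "Suc j"] by simp
      with \<open>j \<le> k\<close> e have "eq0 (h (mv_cyc_mult A n a))" by simp
      then have "mv_cyc_mult A n a = mv_zero A" using eq_zero_iff c(1) by blast
      with 1 2 n a(1) show ?thesis by (auto simp: mv_torsion_def)
    qed auto
  qed
  then show ?thesis by (auto simp: mv_torsion_part_def)
qed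

lemma common_fraction:
  assumes "fraction a j m" "fraction b k n"
  shows "fraction a (n * j) (n * m)" "fraction b (m * k) (n * m)"
  using fraction_mult[OF assms(1), of n] fraction_mult[OF assms(2), of m] assms
  by (simp_all add: fraction_def mult.commute)

lemma fraction_exists_iff:
  assumes "n \<ge> 1"
  shows "(\<exists>a\<in>carrier A. fraction a k n) \<longleftrightarrow> k \<le> n \<and> dv (int n) (of_nat k * u)"
proof
  assume "\<exists>a\<in>carrier A. fraction a k n"
  then obtain a where a: "a \<in> carrier A" "fraction a k n" by blast
  have "eq0 (of_nat k * u - of_int (int n) * h a)"
    using a(2) eq0_commute by (simp add: fraction_def)
  with fraction_le[OF a] show "k \<le> n \<and> dv (int n) (of_nat k * u)" unfolding dv_def by blast
next
  assume k: "k \<le> n \<and> dv (int n) (of_nat k * u)"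
  then obtain y where y: "eq0 (of_nat k * u - of_nat n * y)" by (auto simp: dv_def)
  have "P (of_int (int n) * y)" using pos_cong[OF y] pos_scale_nat[OF unit_nonneg] by simp
  then have 1: "P y" using pos_scale_iff[of "int n" y] assms by simp
  have "P (of_nat n * u - of_nat k * u) \<longleftrightarrow> P (of_int (int n) * (u - y))"
    by (rule pos_cong) (use y eq0_commute in \<open>simp add: algebra_simps\<close>)
  then have 2: "P (u - y)" using pos_scale_iff[of "int n" "u - y"] assms pos_unit_multiple k by simp
  obtain a where a: "a \<in> carrier A" "eq0 (h a - y)" using h_surj[OF 1 2] by blast
  have "eq0 (of_nat n * h a - of_nat k * u)"
    using eq0_diff[OF eq0_of_nat_scale[OF a(2), of n] y] by (simp add: algebra_simps)
  with a(1) assms show "\<exists>a\<in>carrier A. fraction a k n" by (auto simp: fraction_def)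
qed

text \<open>A witness for divisibility has the value \<open>1 / n\<close> and so lies in the torsion
  part, from which the divisors of the unit can therefore be read off.\<close>

lemma dv_unit_iff_fraction:
  assumes n: "n \<ge> 1"
  shows "dv (int n) u \<longleftrightarrow> (\<exists>a\<in>carrier (mv_torsion_part A). mv_mult A (n - 1) a = mv_neg A a)"
proof
  assume "dv (int n) u"
  then obtain a where a: "a \<in> carrier A" "fraction a 1 n" using fraction_exists_iff[OF n, of 1] n by auto
  have mult: "fraction (mv_mult A m a) m n" if "m \<le> n" for m
    using that
  proof (induction m)
    case 0
    then show ?case using fraction_mult[OF fraction_zero n] by simp
  next
    case (Suc m)
    then have "fraction (mv_mult A m a) m n" by simp
    from fraction_plus[OF mult_closed[OF a(1)] a(1) this a(2)] Suc.prems show ?case by (simp add: min_def)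
  qed
  have "mv_mult A (n - 1) a = mv_neg A a"
    by (rule fraction_inj[OF mult_closed[OF a(1)] neg_closed[OF a(1)] mult fraction_neg[OF a]]) simp
  then show "\<exists>a\<in>carrier (mv_torsion_part A). mv_mult A (n - 1) a = mv_neg A a"
    using a unfolding torsion_part_carrier by blast
next
  assume "\<exists>a\<in>carrier (mv_torsion_part A). mv_mult A (n - 1) a = mv_neg A a"
  then show "dv (int n) u" using dv_unit_iff[OF n] unfolding torsion_part_carrier by blast
qed

lemma torsion_part_closed:
  "mv_zero A \<in> carrier (mv_torsion_part A)"
  "a \<in> carrier (mv_torsion_part A) \<Longrightarrow> mv_neg A a \<in> carrier (mv_torsion_part A)"
  "a \<in> carrier (mv_torsion_part A) \<Longrightarrow> b \<in> carrier (mv_torsion_part A) \<Longrightarrow> a \<boxplus> b \<in> carrier (mv_torsion_part A)"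
proof -
  show "mv_zero A \<in> carrier (mv_torsion_part A)"
    using fraction_zero zero_closed by (auto simp: torsion_part_carrier)
  show "mv_neg A a \<in> carrier (mv_torsion_part A)" if "a \<in> carrier (mv_torsion_part A)"
    using that fraction_neg neg_closed by (fastforce simp: torsion_part_carrier)
  assume ab: "a \<in> carrier (mv_torsion_part A)" "b \<in> carrier (mv_torsion_part A)"
  then obtain j m k n where "a \<in> carrier A" "b \<in> carrier A" "fraction a j m" "fraction b k n"
    by (auto simp: torsion_part_carrier)
  with fraction_plus[OF _ _ common_fraction[of a j m b k n]] plus_closed
  show "a \<boxplus> b \<in> carrier (mv_torsion_part A)" by (auto simp: torsion_part_carrier)
qed

end

lemma torsion_part_simps [simp]:
  "mv_zero (mv_torsion_part A) = mv_zero A" "mv_neg (mv_torsion_part A) = mv_neg A"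
  "mv_plus (mv_torsion_part A) = mv_plus A"
  by (simp_all add: mv_torsion_part_def)

context mv_presentation_pair
begin

text \<open>Divisibility is expressed by an equation with a witness in the torsion part, and
  homomorphisms preserve equations.\<close>

lemma unit_divisible_if_torsion_part_embeds:
  assumes f: "f \<in> mv_hom (mv_torsion_part A) (mv_torsion_part B)" and n: "n \<ge> 1" and dv: "A.dv (int n) u"
  shows "B.dv (int n) v"
proof -
  obtain a where a: "a \<in> carrier (mv_torsion_part A)" "mv_mult A (n - 1) a = mv_neg A a"
    using dv A.dv_unit_iff_fraction[OF n] by blast
  have f: "\<And>a. a \<in> carrier (mv_torsion_part A) \<Longrightarrow> f a \<in> carrier (mv_torsion_part B)"
    "f (mv_zero A) = mv_zero B"
    "\<And>a. a \<in> carrier (mv_torsion_part A) \<Longrightarrow> f (mv_neg A a) = mv_neg B (f a)"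
    "\<And>a b. a \<in> carrier (mv_torsion_part A) \<Longrightarrow> b \<in> carrier (mv_torsion_part A) \<Longrightarrow>
       f (a \<boxplus>\<^bsub>A\<^esub> b) = f a \<boxplus>\<^bsub>B\<^esub> f b"
    using f by (auto simp: mv_hom_def)
  have "mv_mult A m a \<in> carrier (mv_torsion_part A) \<and> f (mv_mult A m a) = mv_mult B m (f a)" for m
    by (induction m) (auto simp: A.torsion_part_closed f a)
  then have "mv_mult B (n - 1) (f a) = mv_neg B (f a)" using a f(3) by metis
  then show ?thesis using B.dv_unit_iff_fraction[OF n] f(1)[OF a(1)] by blast
qed

text \<open>Torsion elements are determined by their rational values, and \<open>k / n\<close>
  occurs iff \<open>k \<le> n\<close> and \<open>n\<close> divides \<open>k u\<close>. The
  isomorphism matches equal values.\<close>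

lemma torsion_part_isomorphic:
  assumes dv: "\<And>n. n \<ge> 1 \<Longrightarrow> A.dv (int n) u \<longleftrightarrow> B.dv (int n) v"
  shows "mv_isomorphic (mv_torsion_part A) (mv_torsion_part B)"
proof -
  have dvk: "A.dv (int n) (of_nat k * u) \<longleftrightarrow> B.dv (int n) (of_nat k * v)" if "n \<ge> 1" for n k
  proof -
    have "int n div gcd (int n) (int k) = int (n div gcd n k)" by (simp add: zdiv_int)
    moreover have "n div gcd n k \<ge> 1" using that by (simp add: Suc_le_eq div_greater_zero_iff dvd_imp_le)
    ultimately show ?thesis
      using A.dv_multiple_iff[of "int n" "int k" u] B.dv_multiple_iff[of "int n" "int k" v] dv that by simp
  qed
  have ex: "(\<exists>a\<in>carrier A. A.fraction a k n) \<longleftrightarrow> (\<exists>b\<in>carrier B. B.fraction b k n)" if "n \<ge> 1" for k n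
    using A.fraction_exists_iff[OF that] B.fraction_exists_iff[OF that] dvk[OF that] by blast
  have "\<exists>b. b \<in> carrier B \<and> (\<forall>k n. A.fraction a k n \<longleftrightarrow> B.fraction b k n)"
    if "a \<in> carrier (mv_torsion_part A)" for a
  proof -
    obtain j m where a: "a \<in> carrier A" "A.fraction a j m"
      using \<open>a \<in> carrier (mv_torsion_part A)\<close> by (auto simp: A.torsion_part_carrier)
    then obtain b where b: "b \<in> carrier B" "B.fraction b j m"
      using ex[of m j] by (auto simp: A.fraction_def)
    have "A.fraction a k n \<longleftrightarrow> B.fraction b k n" for k n
    proof
      assume f: "A.fraction a k n"
      then have "n \<ge> 1" by (simp add: A.fraction_def)
      then show "B.fraction b k n" using B.fraction_cong[OF b(2)] A.fraction_unique[OF a(2) f] by blast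
    next
      assume f: "B.fraction b k n"
      then have "n \<ge> 1" by (simp add: B.fraction_def)
      then show "A.fraction a k n" using A.fraction_cong[OF a(2)] B.fraction_unique[OF b(2) f] by blast
    qed
    with b show ?thesis by blast
  qed
  then obtain f where f: "\<And>a. a \<in> carrier (mv_torsion_part A) \<Longrightarrow> f a \<in> carrier B"
    and ff: "\<And>a k n. a \<in> carrier (mv_torsion_part A) \<Longrightarrow> A.fraction a k n \<longleftrightarrow> B.fraction (f a) k n"
    by metis
  have fT: "f a \<in> carrier (mv_torsion_part B)" if a: "a \<in> carrier (mv_torsion_part A)" for a
  proof -
    obtain k n where "A.fraction a k n" using a by (auto simp: A.torsion_part_carrier)
    with f[OF a] ff[OF a] show ?thesis by (auto simp: B.torsion_part_carrier)
  qed
  have tA: "a \<in> carrier A" if "a \<in> carrier (mv_torsion_part A)" for a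
    using that by (simp add: A.torsion_part_carrier)
  have "f \<in> mv_hom (mv_torsion_part A) (mv_torsion_part B)"
    unfolding mv_hom_def mem_Collect_eq torsion_part_simps
  proof (intro conjI ballI)
    show "f \<in> carrier (mv_torsion_part A) \<rightarrow> carrier (mv_torsion_part B)" using fT by blast
    have z: "mv_zero A \<in> carrier (mv_torsion_part A)" by (rule A.torsion_part_closed)
    show "f (mv_zero A) = mv_zero B"
      using B.fraction_inj[OF f[OF z] B.zero_closed _ B.fraction_zero] ff[OF z] A.fraction_zero by blast
  next
    fix a assume a: "a \<in> carrier (mv_torsion_part A)"
    then obtain k n where k: "A.fraction a k n" by (auto simp: A.torsion_part_carrier)
    note na = A.torsion_part_closed(2)[OF a]
    have "B.fraction (f (mv_neg A a)) (n - k) n"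
      using A.fraction_neg[OF tA[OF a] k] ff[OF na] by blast
    moreover have "B.fraction (mv_neg B (f a)) (n - k) n"
      using B.fraction_neg[OF f[OF a]] ff[OF a] k by blast
    ultimately show "f (mv_neg A a) = mv_neg B (f a)"
      using B.fraction_inj[OF f[OF na] B.neg_closed[OF f[OF a]]] by blast
  next
    fix a b assume a: "a \<in> carrier (mv_torsion_part A)" and b: "b \<in> carrier (mv_torsion_part A)"
    obtain j m k n where "A.fraction a j m" "A.fraction b k n"
      using a b by (auto simp: A.torsion_part_carrier)
    note fr = A.common_fraction[OF this]
    note ab = A.torsion_part_closed(3)[OF a b]
    let ?s = "min (n * j + m * k) (n * m)"
    have "B.fraction (f (a \<boxplus>\<^bsub>A\<^esub> b)) ?s (n * m)"
      using A.fraction_plus[OF tA[OF a] tA[OF b] fr] ff[OF ab] by blast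
    moreover have "B.fraction (f a \<boxplus>\<^bsub>B\<^esub> f b) ?s (n * m)"
      using B.fraction_plus[OF f[OF a] f[OF b]] ff[OF a] ff[OF b] fr by blast
    ultimately show "f (a \<boxplus>\<^bsub>A\<^esub> b) = f a \<boxplus>\<^bsub>B\<^esub> f b"
      using B.fraction_inj[OF f[OF ab] B.plus_closed[OF f[OF a] f[OF b]]] by blast
  qed
  moreover have "bij_betw f (carrier (mv_torsion_part A)) (carrier (mv_torsion_part B))"
  proof (rule bij_betw_imageI)
    show "inj_on f (carrier (mv_torsion_part A))"
    proof (rule inj_onI)
      fix a b assume a: "a \<in> carrier (mv_torsion_part A)" and b: "b \<in> carrier (mv_torsion_part A)"
        and eq: "f a = f b"
      obtain k n where k: "A.fraction a k n" using a by (auto simp: A.torsion_part_carrier)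
      then have "A.fraction b k n" using ff[OF a] ff[OF b] eq by metis
      with k show "a = b" using A.fraction_inj tA a b by blast
    qed
    show "f ` carrier (mv_torsion_part A) = carrier (mv_torsion_part B)"
    proof
      show "carrier (mv_torsion_part B) \<subseteq> f ` carrier (mv_torsion_part A)"
      proof
        fix b assume "b \<in> carrier (mv_torsion_part B)"
        then obtain k n where b: "b \<in> carrier B" "B.fraction b k n" by (auto simp: B.torsion_part_carrier)
        then obtain a where a: "a \<in> carrier A" "A.fraction a k n"
          using ex[of n k] by (auto simp: B.fraction_def)
        then have aT: "a \<in> carrier (mv_torsion_part A)" by (auto simp: A.torsion_part_carrier)
        have "f a = b" using B.fraction_inj[OF f[OF aT] b(1) _ b(2)] ff[OF aT] a(2) by blast
        with aT show "b \<in> f ` carrier (mv_torsion_part A)" by blast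
      qed
    qed (use fT in blast)
  qed
  ultimately show ?thesis unfolding mv_isomorphic_def by blast
qed

end

section \<open>Incongruent families and bases\<close>

context preordered_group
begin

text \<open>For prime \<open>p\<close>, linear independence in G / pG over the field with
  \<open>p\<close> elements; \<open>in_span p\<close> is the matching notion of span.\<close>

definition independent :: "int \<Rightarrow> nat set \<Rightarrow> (nat \<Rightarrow> 'r) \<Rightarrow> bool" where
  "independent p J x \<longleftrightarrow> (\<forall>c. dv p (lin_comb J x c) \<longrightarrow> (\<forall>j\<in>J. p dvd c j))"

lemma card_residue_functions:
  "finite J \<Longrightarrow> card (J \<rightarrow>\<^sub>E {0..<int p}) = p ^ card J"
  by (simp add: card_PiE)

lemma incongruent_family_if_independent:
  assumes J: "finite J" and ind: "independent (int p) J x"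
  shows "incongruent_family (int p) (p ^ card J)"
proof -
  let ?F = "J \<rightarrow>\<^sub>E {0..<int p}"
  have "finite ?F" using J by (intro finite_PiE) auto
  then obtain f where f: "bij_betw f {..<card ?F} ?F"
    using ex_bij_betw_nat_finite[of ?F] by (auto simp: atLeast0LessThan)
  have "\<not> dv (int p) (lin_comb J x (f i) - lin_comb J x (f j))"
    if ij: "i < p ^ card J" "j < p ^ card J" "i \<noteq> j" for i j
  proof
    assume "dv (int p) (lin_comb J x (f i) - lin_comb J x (f j))"
    then have "dv (int p) (lin_comb J x (\<lambda>k. f i k - f j k))" by (simp add: lin_comb_diff)
    then have d: "int p dvd f i k - f j k" if "k \<in> J" for k
      using ind that unfolding independent_def by blast
    have F: "f i \<in> ?F" "f j \<in> ?F"
      using f ij(1,2) unfolding card_residue_functions[OF J] bij_betw_def by blast+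
    have "f i = f j"
    proof (rule PiE_ext[OF F])
      fix k assume "k \<in> J"
      then have "f i k \<in> {0..<int p}" "f j k \<in> {0..<int p}" using F by auto
      with d[OF \<open>k \<in> J\<close>] show "f i k = f j k"
        by (metis atLeastLessThan_iff mod_eq_dvd_iff mod_pos_pos_trivial)
    qed
    then show False
      using f ij unfolding card_residue_functions[OF J] bij_betw_def inj_on_def by blast
  qed
  then show ?thesis unfolding incongruent_family_def by (intro exI[of _ "\<lambda>i. lin_comb J x (f i)"]) blast
qed

lemma incongruent_family_bound_if_span:
  assumes J: "finite J" and p: "p > 0" and span: "\<And>g. in_span (int p) J x g"
    and inc: "incongruent_family (int p) n"
  shows "n \<le> p ^ card J"
proof (rule ccontr)
  assume "\<not> ?thesis"
  then have "incongruent_family (int p) (Suc (p ^ card J))"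
    using incongruent_family_mono[OF inc] by simp
  moreover have "\<not> incongruent_family (int p) (Suc (card (J \<rightarrow>\<^sub>E {0..<int p ^ 1})))"
    by (rule incongruent_family_bounded[OF J, where x = x]) (use p span in auto)
  ultimately show False using card_residue_functions[OF J] by simp
qed

lemma incongruent_family_iff_basis:
  assumes "finite J" "p > 0" "independent (int p) J x" "\<And>g. in_span (int p) J x g"
  shows "incongruent_family (int p) n \<longleftrightarrow> n \<le> p ^ card J"
  using incongruent_family_bound_if_span[OF assms(1,2,4)] incongruent_family_mono
    incongruent_family_if_independent[OF assms(1,3)] by blast

lemma incongruent_family_if_unbounded_independent:
  assumes "p \<ge> 2" "\<And>d. \<exists>J x. finite J \<and> card J = d \<and> independent (int p) J x"
  shows "incongruent_family (int p) n"
proof -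
  obtain J x where "finite J" "card J = n" "independent (int p) J x" using assms(2) by blast
  then have "incongruent_family (int p) (p ^ n)" using incongruent_family_if_independent by blast
  moreover have "n \<le> p ^ n" using assms(1) by (simp add: less_imp_le power_gt_expt)
  ultimately show ?thesis by (rule incongruent_family_mono)
qed

text \<open>A coefficient of \<open>y\<close> prime to \<open>p\<close> could be inverted modulo
  \<open>p\<close>, which would put \<open>y\<close> into the span. So \<open>p\<close> divides it
  and its term drops out.\<close>

lemma independent_insert:
  assumes p: "prime p" and ind: "independent (int p) {..<m} x"
    and y: "\<not> in_span (int p) {..<m} x y"
  shows "independent (int p) {..<Suc m} (x(m := y))"
  unfolding independent_def
proof (intro allI impI)
  fix c assume "dv (int p) (lin_comb {..<Suc m} (x(m := y)) c)"
  then have *: "dv (int p) (of_int (c m) * y + lin_comb {..<m} x c)"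
    using lin_comb_insert[of "{..<m}" m x y c] by (simp add: lessThan_Suc)
  have pc: "int p dvd c m"
  proof (rule ccontr)
    assume "\<not> ?thesis"
    then have "coprime (int p) (c m)" using p by (simp add: prime_imp_coprime)
    then obtain s t where st: "s * int p + t * c m = 1" using bezout_int[of "int p" "c m"] by auto
    have "of_int t * (of_int (c m) * y + lin_comb {..<m} x c) + of_int (int p) * (of_int s * y)
      = of_int (s * int p + t * c m) * y + of_int t * lin_comb {..<m} x c"
      by (simp add: algebra_simps)
    also have "\<dots> = y - lin_comb {..<m} x (\<lambda>i. (- t) * c i)"
      unfolding st lin_comb_scale by simp
    finally have "dv (int p) (y - lin_comb {..<m} x (\<lambda>i. (- t) * c i))"
      using dv_add[OF dv_scale[OF *, of t] dv_self[of "int p" "of_int s * y"]] by simp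
    with y show False unfolding in_span_def by blast
  qed
  then obtain k where "c m = int p * k" by blast
  then have "dv (int p) (of_int (c m) * y)" using dv_self[of "int p" "of_int k * y"] by (simp add: mult.assoc)
  from dv_diff[OF * this] have "dv (int p) (lin_comb {..<m} x c)" by simp
  with ind have "\<forall>j\<in>{..<m}. int p dvd c j" unfolding independent_def by blast
  with pc show "\<forall>j\<in>{..<Suc m}. int p dvd c j" by (auto simp: less_Suc_eq)
qed

text \<open>G / pG is a vector space over the field with \<open>p\<close> elements: either it has
  independent tuples of every length, or an independent tuple that cannot be prolonged is a
  basis.\<close>

lemma incongruent_family_dichotomy:
  assumes p: "prime p"
  shows "(\<forall>n. incongruent_family (int p) n) \<or> (\<exists>d. \<forall>n. incongruent_family (int p) n \<longleftrightarrow> n \<le> p ^ d)"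
proof (cases "\<forall>n. \<exists>x. independent (int p) {..<n} x")
  case True
  have "incongruent_family (int p) n" for n
  proof (rule incongruent_family_if_unbounded_independent)
    show "p \<ge> 2" using p by (rule prime_ge_2_nat)
    show "\<exists>J x. finite J \<and> card J = d \<and> independent (int p) J x" for d
      using True by (intro exI[of _ "{..<d}"]) auto
  qed
  then show ?thesis by blast
next
  case False
  define n where "n = (LEAST n. \<not> (\<exists>x. independent (int p) {..<n} x))"
  obtain n0 where "\<not> (\<exists>x. independent (int p) {..<n0} x)" using False by blast
  then have n: "\<not> (\<exists>x. independent (int p) {..<n} x)"
    unfolding n_def by (rule LeastI)
  then have "n \<noteq> 0" by (auto simp: independent_def intro: notI)
  then obtain m where m: "n = Suc m" by (cases n) auto
  obtain x where x: "independent (int p) {..<m} x"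
    using not_less_Least[of m "\<lambda>n. \<not> (\<exists>x. independent (int p) {..<n} x)"] m unfolding n_def by auto
  have "in_span (int p) {..<m} x y" for y
    using independent_insert[OF p x] n m by blast
  from incongruent_family_iff_basis[OF _ _ x this] p show ?thesis
    using prime_gt_0_nat by auto
qed

end

text \<open>An encoding of the subgroups of the rationals that contain 1: \<open>fractions D\<close>
  is such a group, and \<open>fractions_iff\<close> recovers \<open>D\<close> from it.\<close>

definition denominator_set :: "nat set \<Rightarrow> bool" where
  "denominator_set D \<longleftrightarrow> 1 \<in> D \<and> 0 \<notin> D \<and> (\<forall>n\<in>D. \<forall>m. m dvd n \<longrightarrow> m \<in> D) \<and>
     (\<forall>m\<in>D. \<forall>n\<in>D. lcm m n \<in> D)"

definition fractions :: "nat set \<Rightarrow> real set" where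
  "fractions D = {real_of_int k / real n | k n. n \<in> D}"

lemma fractions_iff:
  assumes D: "denominator_set D" and n: "n > 0"
  shows "1 / real n \<in> fractions D \<longleftrightarrow> n \<in> D"
proof
  assume "1 / real n \<in> fractions D"
  then obtain k m where m: "m \<in> D" "1 / real n = real_of_int k / real m" by (auto simp: fractions_def)
  then have "m > 0" using D by (cases m) (auto simp: denominator_set_def)
  then have "real_of_int (int m) = real_of_int (k * int n)" using m(2) n by (simp add: field_simps)
  then have "int m = k * int n" by (simp only: of_int_eq_iff)
  then have "int n dvd int m" by simp
  then have "n dvd m" by simp
  then show "n \<in> D" using D m(1) unfolding denominator_set_def by blast
next
  assume "n \<in> D"
  then show "1 / real n \<in> fractions D"
    unfolding fractions_def by (intro CollectI exI[of _ 1] exI[of _ n]) simp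
qed

lemma fractions_scale: "x \<in> fractions D \<Longrightarrow> real_of_int k * x \<in> fractions D"
proof -
  assume "x \<in> fractions D"
  then obtain j n where n: "x = real_of_int j / real n" "n \<in> D" by (auto simp: fractions_def)
  have "real_of_int k * x = real_of_int (k * j) / real n" by (simp add: n)
  with n(2) show ?thesis unfolding fractions_def by blast
qed

lemma fractions_zero: "denominator_set D \<Longrightarrow> 0 \<in> fractions D"
  using fractions_scale[of "1 / real 1" D 0] fractions_iff[of D 1] by (simp add: denominator_set_def)

lemma fractions_minus: "x \<in> fractions D \<Longrightarrow> - x \<in> fractions D"
  using fractions_scale[of x D "-1"] by simp

lemma fractions_add:
  assumes D: "denominator_set D" and "x \<in> fractions D" "y \<in> fractions D"
  shows "x + y \<in> fractions D"
proof -
  obtain k m l n where x: "x = real_of_int k / real m" "m \<in> D" and y: "y = real_of_int l / real n" "n \<in> D"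
    using assms by (auto simp: fractions_def)
  have mn: "m > 0" "n > 0" using x y D by (auto simp: denominator_set_def intro: gr0I)
  obtain a b where ab: "lcm m n = m * a" "lcm m n = n * b" by (meson dvd_def dvd_lcm1 dvd_lcm2)
  have "lcm m n > 0" using mn by (simp add: lcm_pos_nat)
  then have pos: "a > 0" "b > 0" using ab by (auto intro: gr0I)
  have lcm: "real (lcm m n) = real m * real a" "real (lcm m n) = real n * real b"
    using ab by (metis of_nat_mult)+
  have "x = real_of_int (k * int a) / real (lcm m n)" unfolding lcm(1) using pos by (simp add: x)
  moreover have "y = real_of_int (l * int b) / real (lcm m n)" unfolding lcm(2) using pos by (simp add: y)
  ultimately have "x + y = real_of_int (k * int a + l * int b) / real (lcm m n)"
    by (simp add: add_divide_distrib)
  moreover have "lcm m n \<in> D" using D x(2) y(2) by (simp add: denominator_set_def)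
  ultimately show ?thesis unfolding fractions_def by blast
qed

lemma fractions_rat: "fractions D \<subseteq> \<rat>"
  by (auto simp: fractions_def)

text \<open>If the denominator is \<open>p ^ i\<close> times \<open>m\<close> with \<open>m\<close>
  prime to \<open>p\<close>, then \<open>D\<close> contains \<open>p ^ Suc i\<close> and
  \<open>m\<close>, hence their lcm, which has one more factor \<open>p\<close>.\<close>

lemma fractions_divisible:
  assumes D: "denominator_set D" and p: "prime p" and pD: "\<And>e. p ^ e \<in> D" and x: "x \<in> fractions D"
  shows "x / real p \<in> fractions D"
proof -
  obtain k n where n: "x = real_of_int k / real n" "n \<in> D" using x by (auto simp: fractions_def)
  have n0: "n > 0" using D n(2) by (auto simp: denominator_set_def intro: gr0I)
  obtain m where m: "n = p ^ multiplicity p n * m" "\<not> p dvd m"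
    using multiplicity_decompose'[of n p] n0 p by (metis not_prime_unit not_gr0)
  let ?e = "multiplicity p n"
  have "m \<in> D" using D n(2) m(1) unfolding denominator_set_def by (metis dvd_triv_right)
  then have "lcm (p ^ Suc ?e) m \<in> D" using D pD unfolding denominator_set_def by blast
  moreover have "coprime (p ^ Suc ?e) m" using m(2) p prime_imp_coprime by (metis coprime_power_left_iff)
  then have "lcm (p ^ Suc ?e) m = p ^ Suc ?e * m" by (simp add: lcm_coprime)
  moreover have "p ^ Suc ?e * m = p * n" using m(1) by (metis mult.assoc power_Suc)
  ultimately have "p * n \<in> D" by (simp only:)
  moreover have "x / real p = real_of_int k / real (p * n)" by (simp add: n)
  ultimately show ?thesis unfolding fractions_def by blast
qed

text \<open>If \<open>p ^ e\<close> is the largest power of \<open>p\<close> in \<open>D\<close>, then \<open>1 / p ^ e\<close> generates the fractions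
  modulo \<open>p\<close>.\<close>

lemma fractions_generator:
  assumes D: "denominator_set D" and p: "prime p" and pD: "p ^ e \<in> D" "p ^ Suc e \<notin> D"
  shows "x \<in> fractions D \<Longrightarrow> \<exists>c. (x - real_of_int c / real (p ^ e)) / real p \<in> fractions D"
    and "(real_of_int c / real (p ^ e)) / real p \<in> fractions D \<Longrightarrow> int p dvd c"
proof -
  have p0: "p > 0" using p by (rule prime_gt_0_nat)
  \<comment> \<open>No denominator has more than \<open>e\<close> factors \<open>p\<close>, so every
    fraction can be written over \<open>p ^ e * m\<close> with \<open>m\<close> prime to
    \<open>p\<close>.\<close>
  have decomp: "\<exists>i m. n = p ^ i * m \<and> \<not> p dvd m \<and> i \<le> e \<and> m > 0 \<and> p ^ e * m \<in> D" if n: "n \<in> D" for n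
  proof -
    have n0: "n > 0" using D n by (auto simp: denominator_set_def intro: gr0I)
    obtain m where m: "n = p ^ multiplicity p n * m" "\<not> p dvd m"
      using multiplicity_decompose'[of n p] n0 p by (metis not_prime_unit not_gr0)
    let ?i = "multiplicity p n"
    have "p ^ ?i \<in> D" "m \<in> D" using D n m(1) unfolding denominator_set_def
      by (metis dvd_triv_left, metis dvd_triv_right)
    have "?i \<le> e"
    proof (rule ccontr)
      assume "\<not> ?i \<le> e"
      then have "p ^ Suc e dvd p ^ ?i" by (intro le_imp_power_dvd) simp
      with \<open>p ^ ?i \<in> D\<close> pD(2) D show False unfolding denominator_set_def by blast
    qed
    moreover have "lcm (p ^ e) m \<in> D" using D pD(1) \<open>m \<in> D\<close> unfolding denominator_set_def by blast
    moreover have "coprime (p ^ e) m" using m(2) p prime_imp_coprime by (metis coprime_power_left_iff)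
    then have "lcm (p ^ e) m = p ^ e * m" by (simp add: lcm_coprime)
    moreover have "m > 0" using m(2) by (auto intro: gr0I)
    ultimately show ?thesis using m by auto
  qed
  show "\<exists>c. (x - real_of_int c / real (p ^ e)) / real p \<in> fractions D" if "x \<in> fractions D"
  proof -
    obtain k n where n: "x = real_of_int k / real n" "n \<in> D" using \<open>x \<in> fractions D\<close> by (auto simp: fractions_def)
    obtain i m where m: "n = p ^ i * m" "\<not> p dvd m" "i \<le> e" "m > 0" "p ^ e * m \<in> D" using decomp[OF n(2)] by blast
    have "coprime (int p) (int m)" using m(2) p prime_imp_coprime by (metis coprime_int_iff)
    then obtain s t where st: "s * int p + t * int m = 1" using bezout_int[of "int p" "int m"] by auto
    let ?l = "k * int p ^ (e - i)"
    \<comment> \<open>As \<open>t\<close> inverts \<open>m\<close> modulo \<open>p\<close>, the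
      difference \<open>?l - c * int m\<close> is a multiple of \<open>p\<close>.\<close>
    define c where "c = t * ?l"
    have "c * int m = (t * int m) * ?l" by (simp add: c_def)
    also have "\<dots> = (1 - s * int p) * ?l" using st by (metis add_diff_cancel_left')
    finally have c: "?l - c * int m = int p * (s * ?l)" by (simp add: algebra_simps)
    have pe: "real p ^ e = real p ^ i * real p ^ (e - i)" using m(3) by (simp flip: power_add)
    have "x = real_of_int ?l / real (p ^ e * m)"
      using p0 m(4) by (simp add: n m(1) pe)
    moreover have "real_of_int c / real (p ^ e) = real_of_int (c * int m) / real (p ^ e * m)"
      using m(4) by simp
    ultimately have "x - real_of_int c / real (p ^ e) = real_of_int (?l - c * int m) / real (p ^ e * m)"
      by (simp add: diff_divide_distrib)
    also have "\<dots> = real p * (real_of_int (s * ?l) / real (p ^ e * m))" unfolding c by simp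
    finally have "(x - real_of_int c / real (p ^ e)) / real p = real_of_int (s * ?l) / real (p ^ e * m)"
      using p0 by simp
    then show ?thesis using m(5) unfolding fractions_def by blast
  qed
  show "int p dvd c" if "(real_of_int c / real (p ^ e)) / real p \<in> fractions D"
  proof -
    obtain k n where n: "(real_of_int c / real (p ^ e)) / real p = real_of_int k / real n" "n \<in> D"
      using \<open>(real_of_int c / real (p ^ e)) / real p \<in> fractions D\<close> unfolding fractions_def by blast
    obtain i m where m: "n = p ^ i * m" "\<not> p dvd m" "i \<le> e" "m > 0" using decomp[OF n(2)] by blast
    have pe: "real p ^ e = real p ^ i * real p ^ (e - i)" using m(3) by (simp flip: power_add)
    have "real_of_int (c * int m) = real_of_int (int p * (k * int p ^ (e - i)))"
      using n(1) p0 m(4) unfolding m(1) by (simp add: pe field_simps)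
    then have "c * int m = int p * (k * int p ^ (e - i))" by (simp only: of_int_eq_iff)
    then have "int p dvd c * int m" by simp
    moreover have "\<not> int p dvd int m" using m(2) by simp
    ultimately show ?thesis using p by (simp add: prime_dvd_mult_iff)
  qed
qed

section \<open>Dense groups of real numbers\<close>

lemma countable_algebraic: "countable {x :: real. algebraic x}"
proof -
  have "{x :: real. algebraic x} \<subseteq> (\<Union>q :: int poly \<in> - {0}. {x. poly (map_poly of_int q) x = 0})"
  proof
    fix x :: real assume "x \<in> {x. algebraic x}"
    then obtain f where f: "\<And>i. coeff f i \<in> \<int>" "f \<noteq> 0" "poly f x = 0"
      unfolding algebraic_def by auto
    define q :: "int poly" where "q = map_poly floor f"
    have "map_poly of_int q = f"
      unfolding q_def using f(1) by (intro poly_eqI) (simp add: coeff_map_poly Ints_def; fastforce)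
    with f show "x \<in> (\<Union>q :: int poly \<in> - {0}. {x. poly (map_poly of_int q) x = 0})" by force
  qed
  moreover have "countable (UNIV :: int poly set)"
  proof -
    have "inj (coeffs :: int poly \<Rightarrow> int list)" by (auto simp: inj_def coeffs_eq_iff)
    then show ?thesis by (rule countableI'[of coeffs, OF inj_on_subset[of _ UNIV]] ) auto
  qed
  then have "countable (\<Union>q :: int poly \<in> - {0}. {x :: real. poly (map_poly of_int q) x = 0})"
  proof (intro countable_UN)
    fix q :: "int poly" assume "q \<in> - {0}"
    then have "map_poly real_of_int q \<noteq> 0" by (auto simp: poly_eq_iff coeff_map_poly)
    then show "countable {x. poly (map_poly real_of_int q) x = 0}"
      by (intro countable_finite poly_roots_finite)
  qed (meson countable_subset subset_UNIV)
  ultimately show ?thesis by (rule countable_subset)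
qed

lemma exists_transcendental: "\<exists>x :: real. x > 0 \<and> \<not> algebraic x"
proof (rule ccontr)
  assume "\<not> ?thesis"
  then have "{0<..<1} \<subseteq> {x :: real. algebraic x}" by auto
  then show False
    using countable_subset[OF _ countable_algebraic] uncountable_open_interval[of 0 "1 :: real"] by auto
qed

section \<open>A direct sum of rational groups inside the reals\<close>

locale real_model =
  fixes \<tau> :: real and D :: "nat \<Rightarrow> nat set"
  assumes tau_pos: "\<tau> > 0" and tau_transcendental: "\<not> algebraic \<tau>"
    and denom: "denominator_set (D k)"
    and dense_coord: "D 1 = {1..}"
begin

definition coord_polys :: "real poly set" where
  "coord_polys = {f. \<forall>k. coeff f k \<in> fractions (D k)}"

definition carrier_set :: "real set" where
  "carrier_set = (\<lambda>f. poly f \<tau>) ` coord_polys"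

text \<open>The coefficients are rational, so a nonzero difference would make \<tau> algebraic.
  Coefficients are thus genuine coordinates of real numbers, and the sum of the groups
  \<open>fractions (D k)\<close> is direct.\<close>

lemma poly_tau_inj:
  assumes "f \<in> coord_polys" "g \<in> coord_polys" "poly f \<tau> = poly g \<tau>"
  shows "f = g"
proof (rule ccontr)
  assume "f \<noteq> g"
  then have "f - g \<noteq> 0" "poly (f - g) \<tau> = 0" using assms(3) by auto
  moreover have "coeff (f - g) i \<in> \<rat>" for i
  proof -
    have "coeff f i \<in> \<rat>" "coeff g i \<in> \<rat>"
      using assms(1,2) fractions_rat[of "D i"] unfolding coord_polys_def by blast+
    then show ?thesis by simp
  qed
  ultimately show False using tau_transcendental unfolding algebraic_altdef by blast
qed

lemma coord_polys_closed:
  "0 \<in> coord_polys" "f \<in> coord_polys \<Longrightarrow> g \<in> coord_polys \<Longrightarrow> f + g \<in> coord_polys"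
  "f \<in> coord_polys \<Longrightarrow> - f \<in> coord_polys" "f \<in> coord_polys \<Longrightarrow> smult (real_of_int n) f \<in> coord_polys"
  by (auto simp: coord_polys_def fractions_add[OF denom] fractions_minus fractions_scale fractions_zero[OF denom])

lemma monom_coord_polys: "x \<in> fractions (D k) \<Longrightarrow> monom x k \<in> coord_polys"
  using denom by (auto simp: coord_polys_def fractions_zero)

lemma carrier_set_zero: "0 \<in> carrier_set"
  and carrier_set_add: "x \<in> carrier_set \<Longrightarrow> y \<in> carrier_set \<Longrightarrow> x + y \<in> carrier_set"
  and carrier_set_minus: "x \<in> carrier_set \<Longrightarrow> - x \<in> carrier_set"
  and carrier_set_scale: "x \<in> carrier_set \<Longrightarrow> real_of_int n * x \<in> carrier_set"
  and carrier_set_monom: "x \<in> fractions (D k) \<Longrightarrow> x * \<tau> ^ k \<in> carrier_set"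
proof -
  show "0 \<in> carrier_set"
    unfolding carrier_set_def by (rule image_eqI[of _ _ 0]) (simp_all add: coord_polys_closed)
  show "x \<in> carrier_set \<Longrightarrow> y \<in> carrier_set \<Longrightarrow> x + y \<in> carrier_set"
    unfolding carrier_set_def using coord_polys_closed(2) by (auto simp flip: poly_add)
  show "x \<in> carrier_set \<Longrightarrow> - x \<in> carrier_set"
    unfolding carrier_set_def using coord_polys_closed(3) by (auto simp flip: poly_minus)
  show "x \<in> carrier_set \<Longrightarrow> real_of_int n * x \<in> carrier_set"
    unfolding carrier_set_def using coord_polys_closed(4) by (auto simp flip: poly_smult)
  show "x \<in> fractions (D k) \<Longrightarrow> x * \<tau> ^ k \<in> carrier_set"
    unfolding carrier_set_def using monom_coord_polys by (auto simp: poly_monom intro!: image_eqI[of _ _ "monom x k"])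
qed

lemma carrier_set_one: "1 \<in> carrier_set"
  using carrier_set_monom[of 1 0] fractions_iff[OF denom, of 1 0] denom[of 0] by (simp add: denominator_set_def)

lemma carrier_set_diff: "x \<in> carrier_set \<Longrightarrow> y \<in> carrier_set \<Longrightarrow> x - y \<in> carrier_set"
  using carrier_set_add[OF _ carrier_set_minus, of x y] by simp

text \<open>Coordinate 1 contains all rational multiples of \<tau>, which are already dense.\<close>

lemma carrier_set_dense: assumes "a < b" shows "\<exists>x\<in>carrier_set. a < x \<and> x < b"
proof -
  have "a / \<tau> < b / \<tau>" using assms tau_pos by (simp add: divide_strict_right_mono)
  then obtain r where r: "r \<in> \<rat>" "a / \<tau> < r" "r < b / \<tau>" using Rats_dense_in_real by blast
  obtain k :: int and n :: nat where kn: "n \<noteq> 0" "r = real_of_int k / real n"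
    using r(1) unfolding Rats_eq_int_div_nat by blast
  then have "n \<in> D 1" unfolding dense_coord by simp
  then have "r \<in> fractions (D 1)" unfolding fractions_def kn(2) by blast
  from carrier_set_monom[OF this] r tau_pos show ?thesis
    by (intro bexI[of _ "r * \<tau>"]) (simp_all add: field_simps)
qed

definition model_group :: "real ordered_group" where
  "model_group = \<lparr>carrier = carrier_set, monoid.mult = (+), one = 0,
     order_rel = {(x, y). x \<in> carrier_set \<and> y \<in> carrier_set \<and> x \<le> y}\<rparr>"

definition model_mv :: "real mv" where
  "model_mv = real_unit_mv\<lparr>carrier := carrier_set \<inter> {0..1}\<rparr>"

lemma model_group_simps [simp]:
  "carrier model_group = carrier_set" "x \<otimes>\<^bsub>model_group\<^esub> y = x + y" "\<one>\<^bsub>model_group\<^esub> = 0"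
  "(x, y) \<in> order_rel model_group \<longleftrightarrow> x \<in> carrier_set \<and> y \<in> carrier_set \<and> x \<le> y"
  by (simp_all add: model_group_def)

lemma model_mv_simps [simp]:
  "carrier model_mv = carrier_set \<inter> {0..1}" "x \<boxplus>\<^bsub>model_mv\<^esub> y = min (x + y) 1"
  "mv_neg model_mv x = 1 - x" "mv_zero model_mv = 0" "mv_one model_mv = 1"
  by (simp_all add: model_mv_def real_unit_mv_def mv_one_def)

lemma linordered_comm_group_model: "linordered_comm_group model_group"
proof -
  interpret comm_group model_group
  proof (rule comm_groupI)
    fix x assume "x \<in> carrier model_group"
    then show "\<exists>y\<in>carrier model_group. y \<otimes>\<^bsub>model_group\<^esub> x = \<one>\<^bsub>model_group\<^esub>"
      by (intro bexI[of _ "- x"]) (simp_all add: carrier_set_minus)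
  qed (simp_all add: carrier_set_add carrier_set_zero)
  show ?thesis
    by unfold_locales
      (auto simp: order_on_defs refl_on_def trans_def antisym_def total_on_def carrier_set_add)
qed

lemma model_mv_le: "mv_le model_mv x y \<longleftrightarrow> x \<le> y"
  by (auto simp: mv_le_def min_def)

lemma min_in_carrier: "x \<in> carrier_set \<Longrightarrow> y \<in> carrier_set \<Longrightarrow> min (x + y) 1 \<in> carrier_set"
  by (simp add: min_def carrier_set_add carrier_set_one)

lemma mv_chain_model: "mv_chain model_mv"
proof
  fix x y z assume x: "x \<in> carrier model_mv" and y: "y \<in> carrier model_mv" and z: "z \<in> carrier model_mv"
  show "x \<boxplus>\<^bsub>model_mv\<^esub> y \<boxplus>\<^bsub>model_mv\<^esub> z = x \<boxplus>\<^bsub>model_mv\<^esub> (y \<boxplus>\<^bsub>model_mv\<^esub> z)"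
    using x y z by (simp add: min_def)
next
  fix x y assume x: "x \<in> carrier model_mv" and y: "y \<in> carrier model_mv"
  show "x \<boxplus>\<^bsub>model_mv\<^esub> y \<in> carrier model_mv" using x y by (simp add: min_in_carrier)
  show "mv_neg model_mv (mv_neg model_mv x \<boxplus>\<^bsub>model_mv\<^esub> y) \<boxplus>\<^bsub>model_mv\<^esub> y =
    mv_neg model_mv (mv_neg model_mv y \<boxplus>\<^bsub>model_mv\<^esub> x) \<boxplus>\<^bsub>model_mv\<^esub> x"
    using x y by (simp add: min_def)
  show "mv_le model_mv x y \<or> mv_le model_mv y x" by (auto simp: model_mv_le)
qed (simp_all add: carrier_set_zero carrier_set_diff carrier_set_one add.commute)

lemma atomless_model: "mv_atomless model_mv"
  unfolding mv_atomless_def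
proof (rule notI, elim bexE conjE)
  fix x assume x: "x \<in> carrier model_mv" "mv_less model_mv (mv_zero model_mv) x"
    and eq: "{y \<in> carrier model_mv. mv_le model_mv y x} = {mv_zero model_mv, x}"
  have "0 < x" "x \<le> 1" using x by (simp_all add: mv_less_def model_mv_le)
  then obtain y where y: "y \<in> carrier_set" "0 < y" "y < x" using carrier_set_dense[of 0 x] by blast
  then have "y \<in> {y \<in> carrier model_mv. mv_le model_mv y x}"
    using \<open>x \<le> 1\<close> by (simp add: model_mv_le)
  with y show False unfolding eq by simp
qed

lemma simple_model: "mv_simple model_mv"
  unfolding mv_simple_def mv_embeds_def
  by (rule bexI[of _ "\<lambda>x. x"]) (auto simp: mv_hom_def real_unit_mv_def)

lemma model_inv: "x \<in> carrier_set \<Longrightarrow> inv\<^bsub>model_group\<^esub> x = - x"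
proof -
  interpret G: linordered_comm_group model_group by (rule linordered_comm_group_model)
  show "x \<in> carrier_set \<Longrightarrow> inv\<^bsub>model_group\<^esub> x = - x"
    by (rule G.inv_equality) (simp_all add: carrier_set_minus)
qed

lemma model_pow: "x [^]\<^bsub>model_group\<^esub> (n::nat) = real n * x"
  by (induction n) (simp_all add: algebra_simps)

lemma chang_group_model: "chang_group model_mv model_group 1"
  unfolding chang_group_def
proof (intro conjI linordered_comm_group_model)
  show "strong_unit model_group 1"
    using carrier_set_zero carrier_set_one carrier_set_scale[of 1 "int _"] real_arch_simple
    by (auto simp: strong_unit_def model_pow)
  show "mv_isomorphic model_mv (interval_mv model_group 1)"
    unfolding mv_isomorphic_def
  proof (rule bexI[of _ "\<lambda>x. x"])
    have "carrier (interval_mv model_group 1) = carrier model_mv"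
      using carrier_set_zero carrier_set_one by (auto simp: interval_mv_def)
    then show "bij_betw (\<lambda>x. x) (carrier model_mv) (carrier (interval_mv model_group 1))"
      by (simp add: bij_betw_def)
    show "(\<lambda>x. x) \<in> mv_hom model_mv (interval_mv model_group 1)"
      using carrier_set_zero carrier_set_one
      by (auto simp: mv_hom_def interval_mv_def model_inv min_def carrier_set_add)
  qed
qed

sublocale G: linordered_comm_group model_group
  by (rule linordered_comm_group_model)

sublocale C: preordered_group "group_cone model_group"
  by (rule G.preordered_group_cone)

abbreviation val :: "real free_ring \<Rightarrow> real" where
  "val \<equiv> eval_linear model_group"

lemma val_in: "val x \<in> carrier_set"
  using G.eval_linear_closed by simp

lemma val_add: "val (x + y) = val x + val y"
  and val_minus: "val (- x) = - val x"
  and val_zero: "val 0 = 0"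
  and val_gen: "s \<in> carrier_set \<Longrightarrow> val (gen s) = s"
  using G.eval_linear_add G.eval_linear_minus[of x] model_inv[OF val_in] G.eval_linear_0 G.eval_linear_gen
  by auto

lemma val_diff: "val (x - y) = val x - val y"
  using val_add[of x "- y"] by (simp add: val_minus)

lemma val_of_nat: "val (of_nat n * x) = real n * val x"
  using G.eval_linear_of_nat by (simp add: model_pow)

lemma val_of_int: "val (of_int k * x) = real_of_int k * val x"
proof (cases k rule: int_cases2)
  case (nonneg n)
  then show ?thesis by (simp add: val_of_nat)
next
  case (nonpos n)
  then show ?thesis by (simp add: val_of_nat val_minus)
qed

lemma val_lin_comb: "finite J \<Longrightarrow> val (lin_comb J x c) = (\<Sum>j\<in>J. real_of_int (c j) * val (x j))"
  unfolding lin_comb_def by (induction J rule: finite_induct) (simp_all add: val_zero val_add val_of_int)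

lemma cone_iff: "group_cone model_group x \<longleftrightarrow> val x \<ge> 0"
  using val_in carrier_set_zero by (simp add: group_cone_def)

lemma eq0_iff: "C.eq0 x \<longleftrightarrow> val x = 0"
  using G.eq0_group_cone by simp

lemma dv_iff: "C.dv (int n) x \<longleftrightarrow> (\<exists>s\<in>carrier_set. val x = real n * s)"
proof
  assume "C.dv (int n) x"
  then obtain y where "val (x - of_int (int n) * y) = 0" unfolding C.dv_def eq0_iff by blast
  then have "val x = real n * val y" by (simp add: val_diff val_of_nat)
  then show "\<exists>s\<in>carrier_set. val x = real n * s" using val_in by blast
next
  assume "\<exists>s\<in>carrier_set. val x = real n * s"
  then obtain s where "s \<in> carrier_set" "val x = real n * s" by blast
  then have "C.eq0 (x - of_int (int n) * gen s)"
    unfolding eq0_iff by (simp add: val_diff val_of_nat val_gen)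
  then show "C.dv (int n) x" unfolding C.dv_def by blast
qed

text \<open>The ends of the interval are divided by \<open>n\<close> as real numbers, so plain
  density of the carrier between the quotients suffices.\<close>

lemma regularly_dense_model: "C.regularly_dense"
  unfolding C.regularly_dense_def
proof (intro allI impI)
  fix n :: int and a b assume n: "n \<ge> 1" and ab: "\<not> group_cone model_group (a - b)"
  then have "val a / real_of_int n < val b / real_of_int n"
    by (simp add: cone_iff val_diff divide_strict_right_mono)
  then obtain s where "s \<in> carrier_set" "val a / real_of_int n < s" "s < val b / real_of_int n"
    using carrier_set_dense by blast
  then show "\<exists>x. \<not> group_cone model_group (a - of_int n * x) \<and> \<not> group_cone model_group (of_int n * x - b)"
    using n by (intro exI[of _ "gen s"]) (auto simp: cone_iff val_diff val_of_int val_gen field_simps)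
qed

text \<open>The unit is the constant polynomial 1, so its divisibility is decided in coordinate
  0.\<close>

lemma dv_unit_model: assumes n: "n \<ge> 1" shows "C.dv (int n) (gen 1) \<longleftrightarrow> n \<in> D 0"
proof -
  have "C.dv (int n) (gen 1) \<longleftrightarrow> 1 / real n \<in> carrier_set"
  proof -
    have "1 = real n * s \<longleftrightarrow> s = 1 / real n" for s using n by (auto simp: field_simps)
    then show ?thesis by (simp add: dv_iff val_gen carrier_set_one)
  qed
  also have "\<dots> \<longleftrightarrow> 1 / real n \<in> fractions (D 0)"
  proof
    assume "1 / real n \<in> carrier_set"
    then obtain f where f: "f \<in> coord_polys" "poly f \<tau> = 1 / real n" by (auto simp: carrier_set_def)
    have "smult (real_of_int (int n)) f = monom 1 0"
    proof (rule poly_tau_inj)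
      show "smult (real_of_int (int n)) f \<in> coord_polys" by (rule coord_polys_closed(4)[OF f(1)])
      show "monom 1 0 \<in> coord_polys"
        using fractions_iff[OF denom, of 1 0] denom[of 0] by (intro monom_coord_polys) (simp add: denominator_set_def)
      show "poly (smult (real_of_int (int n)) f) \<tau> = poly (monom 1 0) \<tau>" using f(2) n by (simp add: poly_monom)
    qed
    then have "coeff (smult (real_of_int (int n)) f) 0 = coeff (monom 1 0) 0" by (rule arg_cong)
    then have "coeff f 0 = 1 / real n" using n by (simp add: field_simps)
    with f(1) show "1 / real n \<in> fractions (D 0)" unfolding coord_polys_def by (metis mem_Collect_eq)
  qed (use carrier_set_monom[of "1 / real n" 0] in simp)
  also have "\<dots> \<longleftrightarrow> n \<in> D 0" using fractions_iff[OF denom] n by simp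
  finally show ?thesis .
qed

text \<open>The coordinates that survive modulo a prime \<open>p\<close>, each contributing one
  dimension; the others are divisible by \<open>p\<close>.\<close>

definition nondivisible_coords :: "nat \<Rightarrow> nat set" where
  "nondivisible_coords p = {k. \<exists>e. p ^ e \<notin> D k}"

text \<open>Since \<open>D k\<close> is closed under divisors, this is the largest exponent of
  \<open>p\<close> in \<open>D k\<close> whenever there is one.\<close>

definition coord_exponent :: "nat \<Rightarrow> nat \<Rightarrow> nat" where
  "coord_exponent p k = (LEAST e. p ^ Suc e \<notin> D k)"

lemma coord_exponent:
  assumes "k \<in> nondivisible_coords p"
  shows "p ^ coord_exponent p k \<in> D k" "p ^ Suc (coord_exponent p k) \<notin> D k"
proof -
  obtain e where e: "p ^ e \<notin> D k" using assms by (auto simp: nondivisible_coords_def)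
  have one: "1 \<in> D k" using denom[of k] by (simp add: denominator_set_def)
  with e obtain e' where "e = Suc e'" by (cases e) auto
  with e have "p ^ Suc e' \<notin> D k" by simp
  then show "p ^ Suc (coord_exponent p k) \<notin> D k" unfolding coord_exponent_def by (rule LeastI)
  show "p ^ coord_exponent p k \<in> D k"
  proof (cases "coord_exponent p k")
    case 0
    then show ?thesis using one by simp
  next
    case (Suc m)
    then show ?thesis using not_less_Least[of m "\<lambda>e. p ^ Suc e \<notin> D k"] unfolding coord_exponent_def by auto
  qed
qed

definition basis_elem :: "nat \<Rightarrow> nat \<Rightarrow> real free_ring" where
  "basis_elem p k = gen (1 / real (p ^ coord_exponent p k) * \<tau> ^ k)"

definition comb_poly :: "nat \<Rightarrow> nat set \<Rightarrow> (nat \<Rightarrow> int) \<Rightarrow> real poly" where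
  "comb_poly p J c = (\<Sum>j\<in>J. monom (real_of_int (c j) / real (p ^ coord_exponent p j)) j)"

lemma coeff_comb_poly:
  "finite J \<Longrightarrow> coeff (comb_poly p J c) k = (if k \<in> J then real_of_int (c k) / real (p ^ coord_exponent p k) else 0)"
  by (simp add: comb_poly_def coeff_sum)

context
  fixes p :: nat and J assumes p: "prime p" and J: "finite J" "J \<subseteq> nondivisible_coords p"
begin

lemma generator_in: "k \<in> J \<Longrightarrow> 1 / real (p ^ coord_exponent p k) \<in> fractions (D k)"
  using fractions_iff[OF denom, of "p ^ coord_exponent p k" k] coord_exponent(1)[of k p] J
    prime_gt_0_nat[OF p] by auto

lemma comb_poly_in: "comb_poly p J c \<in> coord_polys"
proof -
  have "coeff (comb_poly p J c) k \<in> fractions (D k)" for k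
    using fractions_scale[OF generator_in, of k "c k"] fractions_zero[OF denom[of k]]
    by (auto simp: coeff_comb_poly[OF J(1)])
  then show ?thesis by (simp add: coord_polys_def)
qed

lemma val_comb: "val (lin_comb J (basis_elem p) c) = poly (comb_poly p J c) \<tau>"
proof -
  have "val (basis_elem p j) = 1 / real (p ^ coord_exponent p j) * \<tau> ^ j" if "j \<in> J" for j
    unfolding basis_elem_def using carrier_set_monom[OF generator_in[OF that]] by (rule val_gen)
  then show ?thesis
    by (simp add: val_lin_comb[OF J(1)] comb_poly_def poly_sum poly_monom)
qed

text \<open>Comparing coefficients splits divisibility by \<open>p\<close> into one condition per
  coordinate, and there the generator has order \<open>p\<close> modulo \<open>p\<close>.\<close>

lemma basis_independent: "C.independent (int p) J (basis_elem p)"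
  unfolding C.independent_def
proof (intro allI impI ballI)
  fix c k assume "C.dv (int p) (lin_comb J (basis_elem p) c)" and k: "k \<in> J"
  then obtain s where "s \<in> carrier_set" "poly (comb_poly p J c) \<tau> = real p * s"
    unfolding dv_iff val_comb by blast
  then obtain f where f: "f \<in> coord_polys" "poly (comb_poly p J c) \<tau> = real p * poly f \<tau>"
    by (auto simp: carrier_set_def)
  have "comb_poly p J c = smult (real_of_int (int p)) f"
    by (rule poly_tau_inj[OF comb_poly_in coord_polys_closed(4)[OF f(1)]]) (simp add: f(2))
  then have "coeff (comb_poly p J c) k = real p * coeff f k" by simp
  then have "real_of_int (c k) / real (p ^ coord_exponent p k) / real p = coeff f k"
    using k prime_gt_0_nat[OF p] by (simp add: coeff_comb_poly[OF J(1)])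
  moreover have "coeff f k \<in> fractions (D k)" using f(1) by (simp add: coord_polys_def)
  ultimately show "int p dvd c k"
    using fractions_generator(2)[OF denom p coord_exponent] k J(2) by (metis subsetD)
qed

end

text \<open>On a surviving coordinate a multiple of the generator corrects the coefficient to one
  divisible by \<open>p\<close>; on the others no correction is made. Finiteness lets all
  corrections be collected in one combination.\<close>

lemma basis_spans:
  assumes p: "prime p" and fin: "finite (nondivisible_coords p)"
  shows "C.in_span (int p) (nondivisible_coords p) (basis_elem p) x"
proof -
  let ?J = "nondivisible_coords p"
  have p0: "p > 0" using p by (rule prime_gt_0_nat)
  obtain f where f: "f \<in> coord_polys" "val x = poly f \<tau>"
    using val_in[of x] by (auto simp: carrier_set_def)
  then have fk: "coeff f k \<in> fractions (D k)" for k by (simp add: coord_polys_def)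
  have "\<exists>c. (coeff f k - real_of_int c / real (p ^ coord_exponent p k)) / real p \<in> fractions (D k)"
    if "k \<in> ?J" for k
    using fractions_generator(1)[OF denom p coord_exponent[OF that] fk] .
  then obtain c where c: "\<And>k. k \<in> ?J \<Longrightarrow>
      (coeff f k - real_of_int (c k) / real (p ^ coord_exponent p k)) / real p \<in> fractions (D k)"
    by metis
  define g where "g = smult (1 / real p) (f - comb_poly p ?J c)"
  have "coeff g k \<in> fractions (D k)" for k
  proof (cases "k \<in> ?J")
    case True
    with c show ?thesis by (simp add: g_def coeff_comb_poly[OF fin])
  next
    case False
    then have "coeff f k / real p \<in> fractions (D k)"
      using fractions_divisible[OF denom p _ fk] by (auto simp: nondivisible_coords_def)
    with False show ?thesis by (simp add: g_def coeff_comb_poly[OF fin])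
  qed
  then have "poly g \<tau> \<in> carrier_set" by (auto simp: carrier_set_def coord_polys_def)
  moreover have "val (x - lin_comb ?J (basis_elem p) c) = real p * poly g \<tau>"
    using p0 by (simp add: val_diff val_comb[OF p fin order.refl] f(2) g_def)
  ultimately show ?thesis unfolding C.in_span_def dv_iff by blast
qed

lemma incongruent_family_model_finite:
  assumes "prime p" "finite (nondivisible_coords p)"
  shows "C.incongruent_family (int p) n \<longleftrightarrow> n \<le> p ^ card (nondivisible_coords p)"
  using C.incongruent_family_iff_basis[OF assms(2) prime_gt_0_nat[OF assms(1)]
      basis_independent[OF assms order.refl] basis_spans[OF assms]] .

lemma incongruent_family_model_infinite:
  assumes p: "prime p" and inf: "infinite (nondivisible_coords p)"
  shows "C.incongruent_family (int p) n"
proof (rule C.incongruent_family_if_unbounded_independent)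
  show "p \<ge> 2" using p by (rule prime_ge_2_nat)
  fix d
  obtain J where "J \<subseteq> nondivisible_coords p" "finite J" "card J = d"
    using infinite_arbitrarily_large[OF inf] by blast
  with basis_independent[OF p] show "\<exists>J x. finite J \<and> card J = d \<and> C.independent (int p) J x" by blast
qed

end

section \<open>The classification\<close>

context preordered_group
begin

text \<open>For the closure of the set of divisors of an element under lcm, which
  \<open>denominator_set\<close> requires.\<close>

lemma dv_lcm: assumes "dv (int m) x" "dv (int n) x" "m > 0" shows "dv (int (lcm m n)) x"
proof -
  obtain y z where yz: "eq0 (x - of_int (int m) * y)" "eq0 (x - of_int (int n) * z)"
    using assms by (auto simp: dv_def)
  define g where "g = gcd (int m) (int n)"
  obtain s t where st: "s * int m + t * int n = g"
    using bezout_int[of "int m" "int n"] unfolding g_def by auto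
  have g0: "g \<noteq> 0" using assms(3) by (simp add: g_def)
  have l: "int m * int n = g * int (lcm m n)"
    unfolding g_def by (metis gcd_int_int_eq of_nat_mult prod_gcd_lcm_nat)
  have mn: "of_int (int m) * of_int (int n) = (of_int g * of_int (int (lcm m n)) :: 'r)"
    using l by (metis of_int_mult)
  have gst: "(of_int g :: 'r) = of_int s * of_int (int m) + of_int t * of_int (int n)"
    using st by (metis of_int_add of_int_mult)
  have "of_int g * (x - of_int (int (lcm m n)) * (of_int s * z + of_int t * y))
      = of_int g * x - (of_int (int m) * of_int (int n)) * (of_int s * z + of_int t * y)"
    unfolding mn by (simp only: right_diff_distrib mult.assoc)
  also have "\<dots> = of_int (s * int m) * (x - of_int (int n) * z) + of_int (t * int n) * (x - of_int (int m) * y)"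
    unfolding gst by (simp add: algebra_simps)
  finally have "eq0 (of_int g * (x - of_int (int (lcm m n)) * (of_int s * z + of_int t * y)))"
    using eq0_add[OF eq0_scale[OF yz(2), of "s * int m"] eq0_scale[OF yz(1), of "t * int n"]] by (simp only:)
  then have "eq0 (x - of_int (int (lcm m n)) * (of_int s * z + of_int t * y))"
    using eq0_scale_iff[OF g0] by blast
  then show ?thesis unfolding dv_def by blast
qed

lemma denominator_set_divisors: "denominator_set {n. n \<ge> 1 \<and> dv (int n) x}"
  unfolding denominator_set_def
  by (auto simp: dv_lcm Suc_le_eq lcm_pos_nat intro: dv_dvd[rotated] gr0I)

text \<open>Dividing \<open>x\<close> by \<open>p\<close> as long as possible ends at an element not
  divisible by \<open>p\<close>, which is incongruent to 0. For the unit this secures the dimension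
  that coordinate 0 takes up.\<close>

lemma incongruent_pair_if_not_divisible:
  assumes p: "p > 0" and e: "\<not> dv (p ^ e) x"
  shows "incongruent_family p 2"
  using e
proof (induction e)
  case 0
  then show ?case by simp
next
  case (Suc e)
  show ?case
  proof (cases "dv (p ^ e) x")
    case True
    then obtain y where y: "eq0 (x - of_int (p ^ e) * y)" by (auto simp: dv_def)
    have "dv (p ^ Suc e) x \<longleftrightarrow> dv (p ^ e * p) (of_int (p ^ e) * y)"
      using dv_cong[OF y] by (simp add: mult.commute)
    also have "\<dots> \<longleftrightarrow> dv p y" using p by (intro dv_mult_iff) simp
    finally have "\<not> dv p y" using Suc.prems by blast
    then show ?thesis unfolding incongruent_family_def
      by (intro exI[of _ "\<lambda>i. if i = 0 then y else 0"]) (auto simp: dv_minus less_2_cases_iff)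
  qed (rule Suc.IH)
qed

end

text \<open>Divisibility of the unit is transferred along homomorphisms in one direction, so the
  isomorphism of torsion parts also has to be used backwards.\<close>

lemma mv_hom_inverse:
  assumes f: "f \<in> mv_hom X Y" "bij_betw f (carrier X) (carrier Y)"
    and X: "mv_zero X \<in> carrier X" "\<And>a. a \<in> carrier X \<Longrightarrow> mv_neg X a \<in> carrier X"
      "\<And>a b. a \<in> carrier X \<Longrightarrow> b \<in> carrier X \<Longrightarrow> a \<boxplus>\<^bsub>X\<^esub> b \<in> carrier X"
  shows "inv_into (carrier X) f \<in> mv_hom Y X"
proof -
  let ?g = "inv_into (carrier X) f"
  have g: "?g b \<in> carrier X" "f (?g b) = b" if "b \<in> carrier Y" for b
    using that f(2) unfolding bij_betw_def by (auto simp: inv_into_into f_inv_into_f)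
  have gf: "?g (f a) = a" if "a \<in> carrier X" for a
    using that f(2) by (simp add: bij_betw_def inv_into_f_f)
  have hom: "f (mv_zero X) = mv_zero Y" "\<And>a. a \<in> carrier X \<Longrightarrow> f (mv_neg X a) = mv_neg Y (f a)"
    "\<And>a b. a \<in> carrier X \<Longrightarrow> b \<in> carrier X \<Longrightarrow> f (a \<boxplus>\<^bsub>X\<^esub> b) = f a \<boxplus>\<^bsub>Y\<^esub> f b"
    using f(1) by (auto simp: mv_hom_def)
  show ?thesis
    unfolding mv_hom_def mem_Collect_eq
  proof (intro conjI ballI)
    show "?g \<in> carrier Y \<rightarrow> carrier X" using g by blast
    show "?g (mv_zero Y) = mv_zero X" using gf[OF X(1)] hom(1) by simp
    show "?g (mv_neg Y b) = mv_neg X (?g b)" if "b \<in> carrier Y" for b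
      using gf[OF X(2)[OF g(1)[OF that]]] hom(2)[OF g(1)[OF that]] g(2)[OF that] by simp
    show "?g (b \<boxplus>\<^bsub>Y\<^esub> c) = ?g b \<boxplus>\<^bsub>X\<^esub> ?g c" if "b \<in> carrier Y" "c \<in> carrier Y" for b c
      using gf[OF X(3)[OF g(1)[OF that(1)] g(1)[OF that(2)]]]
        hom(3)[OF g(1)[OF that(1)] g(1)[OF that(2)]] g(2)[OF that(1)] g(2)[OF that(2)] by simp
  qed
qed

lemma elem_equiv_if_same_invariants:
  assumes A: "mv_presentation P A u h" "preordered_group.regularly_dense P"
    and B: "mv_presentation Q B v k" "preordered_group.regularly_dense Q"
    and dv: "\<And>n. n \<ge> 1 \<Longrightarrow> preordered_group.dv P (int n) u \<longleftrightarrow> preordered_group.dv Q (int n) v"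
    and inc: "\<And>p n. prime p \<Longrightarrow> preordered_group.incongruent_family P (int p) n \<longleftrightarrow>
      preordered_group.incongruent_family Q (int p) n"
  shows "mv_elem_equiv A B"
proof -
  interpret A: mv_presentation P A u h by fact
  interpret B: mv_presentation Q B v k by fact
  interpret mv_presentation_pair P A u h Q B v k ..
  interpret regular_mv_presentation_pair P A u h Q B v k
  proof
    fix p :: int and n assume "prime p"
    then have "prime (nat p)" "int (nat p) = p" using prime_ge_0_int[of p] by auto
    with inc[of "nat p" n] show "A.incongruent_family p n \<longleftrightarrow> B.incongruent_family p n" by simp
  qed (use A(2) B(2) in auto)
  show ?thesis
  proof (rule elem_equiv_of_unit)
    fix n :: int assume "n \<ge> 1"
    with dv[of "nat n"] show "A.dv n u \<longleftrightarrow> B.dv n v" by simp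
  qed
qed

context mv_presentation
begin

text \<open>Coordinate \<open>0\<close> carries the divisors of the unit and coordinate \<open>1\<close> is all of the rationals. The
  coordinate coded by \<open>(p, i)\<close> contributes one dimension modulo \<open>p\<close> if \<open>R p i\<close> holds, and is divisible
  otherwise.\<close>

definition model_denominators :: "(nat \<Rightarrow> nat \<Rightarrow> bool) \<Rightarrow> nat \<Rightarrow> nat set" where
  "model_denominators R k =
     (if k = 0 then {n. n \<ge> 1 \<and> dv (int n) u}
      else if k = 1 then {1..}
      else (case prod_decode (k - 2) of (p, i) \<Rightarrow>
        if prime p \<and> R p i then {n. n \<ge> 1 \<and> coprime p n} else {1..}))"

lemma denominator_set_model: "denominator_set (model_denominators R k)"
proof -
  have 1: "denominator_set {1..}"
    by (auto simp: denominator_set_def Suc_le_eq lcm_pos_nat intro: gr0I)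
  have 2: "denominator_set {n. n \<ge> 1 \<and> coprime p n}" for p
    unfolding denominator_set_def
  proof (intro conjI ballI allI impI)
    fix m n assume mn: "m \<in> {n. n \<ge> 1 \<and> coprime p n}" "n \<in> {n. n \<ge> 1 \<and> coprime p n}"
    then have "coprime p (m * n)" by simp
    moreover have "lcm m n dvd m * n" by (simp add: lcm_least)
    ultimately have "coprime p (lcm m n)" by (metis coprime_divisors dvd_refl)
    with mn show "lcm m n \<in> {n. n \<ge> 1 \<and> coprime p n}" by (simp add: Suc_le_eq lcm_pos_nat)
  next
    fix m n assume n: "n \<in> {n. n \<ge> 1 \<and> coprime p n}" "m dvd n"
    then have "coprime p m" using coprime_divisors[of p p m n] by simp
    with n show "m \<in> {n. n \<ge> 1 \<and> coprime p n}" by (auto simp: Suc_le_eq intro: gr0I)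
  qed auto
  show ?thesis
    unfolding model_denominators_def using 1 2 denominator_set_divisors by (auto split: prod.split)
qed

text \<open>The shift by 2 keeps coded coordinates off 0 and 1, and coordinate 1 is divisible by
  every prime. A coordinate coded for another prime has all powers of \<open>p\<close> among its
  denominators.\<close>

lemma model_nondivisible_coords:
  assumes p: "prime p"
  shows "{k. \<exists>e. p ^ e \<notin> model_denominators R k} =
    {k. k = 0 \<and> (\<exists>e. \<not> dv (int p ^ e) u)} \<union> (\<lambda>i. prod_encode (p, i) + 2) ` {i. R p i}"
proof -
  have p0: "p ^ e \<ge> 1" for e using prime_gt_0_nat[OF p] by (simp add: Suc_le_eq)
  have "(\<exists>e. p ^ e \<notin> model_denominators R (k + 2)) \<longleftrightarrow> k \<in> (\<lambda>i. prod_encode (p, i)) ` {i. R p i}" for k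
  proof -
    obtain q i where qi: "prod_decode k = (q, i)" by (cases "prod_decode k")
    then have k: "k = prod_encode (q, i)" by (metis prod_decode_inverse)
    show ?thesis
    proof (cases "q = p")
      case True
      have "\<not> coprime p (p ^ 1)" using p by auto
      then have "(\<exists>e. \<not> coprime p (p ^ e))" by blast
      with True p p0 show ?thesis by (auto simp: model_denominators_def qi k)
    next
      case False
      have "coprime q (p ^ e)" if "prime q" for e
        using primes_coprime[OF that p False] by simp
      with False p0 show ?thesis by (auto simp: model_denominators_def qi k)
    qed
  qed
  note shift = this
  have "k \<in> {k. \<exists>e. p ^ e \<notin> model_denominators R k} \<longleftrightarrow>
    k \<in> {k. k = 0 \<and> (\<exists>e. \<not> dv (int p ^ e) u)} \<union> (\<lambda>i. prod_encode (p, i) + 2) ` {i. R p i}" for k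
  proof -
    consider "k = 0" | "k = 1" | j where "k = j + 2"
      by (metis One_nat_def Suc_1 add.commute add_2_eq_Suc not0_implies_Suc)
    then show ?thesis
    proof cases
      case 1
      then show ?thesis using p0 by (auto simp: model_denominators_def)
    next
      case 2
      then show ?thesis using p0 by (auto simp: model_denominators_def)
    next
      case 3
      then show ?thesis using shift[of j] by auto
    qed
  qed
  then show ?thesis by blast
qed

end

lemma exists_simple_elem_equiv:
  fixes A :: "'a mv"
  assumes A: "mv_chain A" "mv_atomless A" "mv_regular A"
  shows "\<exists>S :: real mv. mv_chain S \<and> mv_atomless S \<and> mv_simple S \<and> mv_elem_equiv A S"
proof -
  interpret chain: mv_chain A by fact
  obtain h where h: "mv_presentation (group_cone chain.chang) A (gen (1, mv_zero A)) h"
    using mv_presentation_of_chang_group[OF A(1) chain.chang_group_chang] by blast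
  interpret A: mv_presentation "group_cone chain.chang" A "gen (1, mv_zero A)" h by (rule h)
  interpret A: regular_mv_presentation "group_cone chain.chang" A "gen (1, mv_zero A)" h
    by unfold_locales (use A in auto)
  let ?inc = "\<lambda>p. A.incongruent_family (int p)" and ?u = "gen (1, mv_zero A) :: (int \<times> 'a) free_ring"
  define nondiv where "nondiv p \<longleftrightarrow> (\<exists>e. \<not> A.dv (int p ^ e) ?u)" for p
  have "\<exists>d. \<forall>n. ?inc p n \<longleftrightarrow> n \<le> p ^ d" if "prime p" "\<not> (\<forall>n. ?inc p n)" for p
    using A.incongruent_family_dichotomy[OF that(1)] that(2) by blast
  then obtain d where d: "\<And>p n. prime p \<Longrightarrow> \<not> (\<forall>n. ?inc p n) \<Longrightarrow> ?inc p n \<longleftrightarrow> n \<le> p ^ d p"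
    by metis
  define R where "R p i \<longleftrightarrow> (\<forall>n. ?inc p n) \<or> i < (if nondiv p then d p - 1 else d p)" for p i
  obtain \<tau> :: real where \<tau>: "\<tau> > 0" "\<not> algebraic \<tau>" using exists_transcendental by blast
  interpret M: real_model \<tau> "A.model_denominators R"
    by unfold_locales (use \<tau> A.denominator_set_model in \<open>auto simp: A.model_denominators_def\<close>)
  obtain k where k: "mv_presentation (group_cone M.model_group) M.model_mv (gen 1) k"
    using mv_presentation_of_chang_group[OF M.mv_chain_model M.chang_group_model] by blast
  have coords: "M.nondivisible_coords p =
      {k. k = 0 \<and> nondiv p} \<union> (\<lambda>i. prod_encode (p, i) + 2) ` {i. R p i}" if "prime p" for p
    unfolding M.nondivisible_coords_def nondiv_def by (rule A.model_nondivisible_coords[OF that])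
  have inj: "inj (\<lambda>i. prod_encode (p, i) + 2)" for p
    by (auto simp: inj_def dest: injD[OF inj_prod_encode])
  have inc: "?inc p n \<longleftrightarrow> M.C.incongruent_family (int p) n" if p: "prime p" for p n
  proof (cases "\<forall>n. ?inc p n")
    case True
    then have "{i. R p i} = UNIV" by (auto simp: R_def)
    then have "infinite (M.nondivisible_coords p)"
      using inj range_inj_infinite unfolding coords[OF p] by auto
    with True M.incongruent_family_model_infinite[OF p] show ?thesis by blast
  next
    case False
    have R: "{i. R p i} = {..<if nondiv p then d p - 1 else d p}" using False by (auto simp: R_def)
    \<comment> \<open>Makes the subtraction of naturals in \<open>d p - 1\<close> a true one, so
      that adding coordinate 0 gives \<open>d p\<close> again.\<close>
    have "d p \<ge> 1" if "nondiv p"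
    proof -
      obtain e where "\<not> A.dv (int p ^ e) ?u" using \<open>nondiv p\<close> by (auto simp: nondiv_def)
      then have "?inc p 2"
        using A.incongruent_pair_if_not_divisible prime_gt_0_nat[OF p] by simp
      then have "2 \<le> p ^ d p" using d[OF p False] by blast
      then show ?thesis by (cases "d p") auto
    qed
    moreover have "card ((\<lambda>i. prod_encode (p, i) + 2) ` {i. R p i}) = (if nondiv p then d p - 1 else d p)"
      unfolding R by (subst card_image) (use inj in \<open>auto intro: inj_on_subset\<close>)
    moreover have "card (M.nondivisible_coords p) =
        card {k :: nat. k = 0 \<and> nondiv p} + card ((\<lambda>i. prod_encode (p, i) + 2) ` {i. R p i})"
      unfolding coords[OF p] by (rule card_Un_disjoint) (auto simp: R)
    ultimately have "card (M.nondivisible_coords p) = d p" by (cases "nondiv p") auto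
    moreover have "finite (M.nondivisible_coords p)" unfolding coords[OF p] R by auto
    ultimately show ?thesis using M.incongruent_family_model_finite[OF p] d[OF p False] by simp
  qed
  have "A.dv (int n) ?u \<longleftrightarrow> M.C.dv (int n) (gen 1)" if "n \<ge> 1" for n
    using M.dv_unit_model[OF that] that by (simp add: A.model_denominators_def)
  then have "mv_elem_equiv A M.model_mv"
    by (rule elem_equiv_if_same_invariants[OF h A.regularly_dense k M.regularly_dense_model _ inc])
  then show ?thesis using M.mv_chain_model M.atomless_model M.simple_model by blast
qed

lemma elem_equiv_iff_invariants:
  fixes A :: "'a mv" and A' :: "'b mv" and G :: "'g ordered_group" and G' :: "'h ordered_group"
  assumes A: "mv_chain A" "mv_atomless A" "mv_regular A"
    and A': "mv_chain A'" "mv_atomless A'" "mv_regular A'"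
    and G: "chang_group A G u" "chang_group A' G' u'"
  shows "mv_elem_equiv A A' \<longleftrightarrow>
    mv_isomorphic (mv_torsion_part A) (mv_torsion_part A') \<and>
    (\<forall>p :: nat. prime p \<longrightarrow> zakon p G = zakon p G')"
proof -
  obtain h where h: "mv_presentation (group_cone G) A (gen u) h"
    using mv_presentation_of_chang_group[OF A(1) G(1)] by blast
  obtain h' where h': "mv_presentation (group_cone G') A' (gen u') h'"
    using mv_presentation_of_chang_group[OF A'(1) G(2)] by blast
  interpret A: mv_presentation "group_cone G" A "gen u" h by (rule h)
  interpret A': mv_presentation "group_cone G'" A' "gen u'" h' by (rule h')
  interpret rA: regular_mv_presentation "group_cone G" A "gen u" h by unfold_locales (use A in auto)
  interpret rA': regular_mv_presentation "group_cone G'" A' "gen u'" h' by unfold_locales (use A' in auto)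
  interpret pair: mv_presentation_pair "group_cone G" A "gen u" h "group_cone G'" A' "gen u'" h' ..
  interpret rev: mv_presentation_pair "group_cone G'" A' "gen u'" h' "group_cone G" A "gen u" h ..
  interpret pair: dense_mv_presentation_pair "group_cone G" A "gen u" h "group_cone G'" A' "gen u'" h'
    by unfold_locales (rule rA.regularly_dense rA'.regularly_dense)+
  have lG: "linordered_comm_group G" "linordered_comm_group G'"
    using G by (simp_all add: chang_group_def)
  show ?thesis
  proof (intro iffI conjI allI impI)
    assume eq: "mv_elem_equiv A A'"
    show "mv_isomorphic (mv_torsion_part A) (mv_torsion_part A')"
      using pair.elem_equiv_invariants(1)[OF eq] by (rule pair.torsion_part_isomorphic)
    show "zakon p G = zakon p G'" if "prime p" for p
      unfolding zakon_eq_iff[OF lG]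
      using pair.elem_equiv_invariants(2)[OF eq] prime_ge_1_nat[OF that] by blast
  next
    assume *: "mv_isomorphic (mv_torsion_part A) (mv_torsion_part A') \<and>
      (\<forall>p :: nat. prime p \<longrightarrow> zakon p G = zakon p G')"
    then obtain f where f: "f \<in> mv_hom (mv_torsion_part A) (mv_torsion_part A')"
      "bij_betw f (carrier (mv_torsion_part A)) (carrier (mv_torsion_part A'))"
      unfolding mv_isomorphic_def by blast
    have "inv_into (carrier (mv_torsion_part A)) f \<in> mv_hom (mv_torsion_part A') (mv_torsion_part A)"
      by (rule mv_hom_inverse[OF f]) (simp_all add: A.torsion_part_closed)
    then have dv: "A.dv (int n) (gen u) \<longleftrightarrow> A'.dv (int n) (gen u')" if "n \<ge> 1" for n
      using pair.unit_divisible_if_torsion_part_embeds[OF f(1) that]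
        rev.unit_divisible_if_torsion_part_embeds[OF _ that] by blast
    have "A.incongruent_family (int p) n \<longleftrightarrow> A'.incongruent_family (int p) n" if "prime p" for p n
      using * that zakon_eq_iff[OF lG, of p] by blast
    with dv show "mv_elem_equiv A A'"
      by (intro elem_equiv_if_same_invariants[OF h rA.regularly_dense h' rA'.regularly_dense])
  qed
qed

theorem theorem5p12:
  shows "(\<forall>A :: 'a mv. mv_chain A \<and> mv_atomless A \<and> mv_regular A \<longrightarrow>
            (\<exists>S :: real mv. mv_chain S \<and> mv_atomless S \<and> mv_simple S \<and> mv_elem_equiv A S))
       \<and>
         (\<forall>(A :: 'a mv) (A' :: 'b mv) (G :: 'g ordered_group) (G' :: 'h ordered_group) u u'.
            mv_chain A \<and> mv_atomless A \<and> mv_regular A \<and>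
            mv_chain A' \<and> mv_atomless A' \<and> mv_regular A' \<and>
            chang_group A G u \<and> chang_group A' G' u' \<longrightarrow>
            (mv_elem_equiv A A' \<longleftrightarrow>
               mv_isomorphic (mv_torsion_part A) (mv_torsion_part A') \<and>
               (\<forall>p :: nat. prime p \<longrightarrow> zakon p G = zakon p G')))"
proof (intro conjI allI impI, goal_cases)
  case (1 A)
  then show ?case by (elim conjE) (rule exists_simple_elem_equiv)
next
  case (2 A A' G G' u u')
  then show ?case by (elim conjE) (rule elem_equiv_iff_invariants)
qed

end
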